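(* Let $\mu,\nu$ be probability measures on $\mathbb{R}$ with $\mu\preceq_C\nu$ (convex order). Let $h:\mathbb{R}\to\mathbb{R}$ be a differentiable function such that $h'$ is strictly convex and assume that the cost function $c:(x,y)\mapsto h(y-x)$ satisfies the sufficient integrability condition with respect to $\mu,\nu$. Assume moreover that $C_M(\mu,\nu)<+\infty$. Let $\pi\in\Pi_M(\mu,\nu)$. The following statements are equivalent: (a) $\pi$ is left-monotone. (b) $\pi$ is optimal, i.e. it minimizes $\pi'\mapsto\iint c\,d\pi'$ over $\Pi_M(\mu,\nu)$. (c) $\pi$ is the left-curtain coupling in the following sense: for every $\pi'\in\Pi_M(\mu,\nu)$ and every $t\in\mathbb{R}$, $\nu_t^\pi\preceq_C\nu_t^{\pi'}$.
   Context: Convex order: two finite Borel measures $\mu,\nu$ on $\mathbb{R}$ with finite first moments satisfy $\mu\preceq_C\nu$ if $\int\varphi\,d\mu\le\int\varphi\,d\nu$ for every convex $\varphi:\mathbb{R}\to\mathbb{R}$. $\Pi_M(\mu,\nu)$ (martingale transport plans) is the set of Borel measures $\pi$ on $\mathbb{R}\times\mathbb{R}$ with first marginal $\mu$, second marginal $\nu$, whose disintegration $(\pi_x)_{x\in\mathbb{R}}$ into probability measures with respect to $\mu$ satisfies $\int y\,d\pi_x(y)=x$ for $\mu$-a.e. $x$. $C_M(\mu,\nu)=\inf\{\iint c\,d\pi:\pi\in\Pi_M(\mu,\nu)\}$. Sufficient integrability condition: $c(x,y)\ge a(x)+b(y)$ for all $x,y$, where $a$ is $\mu$-integrable and $b$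 is $\nu$-integrable. A martingale transport plan $\pi$ is left-monotone if there is a Borel set $\Gamma\subseteq\mathbb{R}\times\mathbb{R}$ with $\pi(\Gamma)=1$ such that whenever $(x,y^-),(x,y^+),(x',y')\in\Gamma$, one cannot have both $x<x'$ and $y^-<y'<y^+$. For $\pi\in\Pi_M(\mu,\nu)$ and $t\in\mathbb{R}$, $\nu_t^\pi:=\mathrm{proj}^y_\#\big(\pi|_{]-\infty,t]\times\mathbb{R}}\big)$ is the second marginal of the restriction of $\pi$ to $]-\infty,t]\times\mathbb{R}$. *)

theory Defs
  imports "HOL-Probability.Probability"
begin

text \<open>
  Integral with values in \<open>[-\<infinity>, \<infinity>]\<close>: since \<^const>\<open>ennreal\<close> sends negative reals to 0, this is
  the integral of the positive part minus the integral of the negative part. Every integral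
  formed below has a finite negative part under the standing assumptions, so the library's
  convention for \<open>\<infinity> - \<infinity>\<close> plays no role.
\<close>

definition ext_integral :: "'a measure \<Rightarrow> ('a \<Rightarrow> real) \<Rightarrow> ereal" where
  "ext_integral M f =
     enn2ereal (\<integral>\<^sup>+ x. ennreal (f x) \<partial>M) - enn2ereal (\<integral>\<^sup>+ x. ennreal (- f x) \<partial>M)"

definition finite_first_moment :: "real measure \<Rightarrow> bool" where
  "finite_first_moment \<mu> \<longleftrightarrow>
     finite_measure \<mu> \<and> sets \<mu> = sets borel \<and> integrable \<mu> (\<lambda>x. x)"

definition convex_order :: "real measure \<Rightarrow> real measure \<Rightarrow> bool" where
  "convex_order \<mu> \<nu> \<longleftrightarrow> finite_first_moment \<mu> \<and> finite_first_moment \<nu> \<and>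
     (\<forall>\<phi>. convex_on UNIV \<phi> \<longrightarrow> ext_integral \<mu> \<phi> \<le> ext_integral \<nu> \<phi>)"

definition is_disintegration ::
    "(real \<Rightarrow> real measure) \<Rightarrow> real measure \<Rightarrow> (real \<times> real) measure \<Rightarrow> bool" where
  "is_disintegration K \<mu> \<pi> \<longleftrightarrow> K \<in> borel \<rightarrow>\<^sub>M prob_algebra borel \<and>
     (\<forall>A\<in>sets borel. emeasure \<pi> A = (\<integral>\<^sup>+ x. emeasure (K x) {y. (x, y) \<in> A} \<partial>\<mu>))"

text \<open>
  Disintegrations are unique up to a \<open>\<mu>\<close>-null set, so it does not matter which one the
  existential quantifier picks. Integrability is required explicitly because the Bochner
  integral of a non-integrable function is 0 by convention.
\<close>

definition martingale_plans :: "real measure \<Rightarrow> real measure \<Rightarrow> (real \<times> real) measure set" where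
  "martingale_plans \<mu> \<nu> =
     {\<pi>. sets \<pi> = sets borel \<and> distr \<pi> borel fst = \<mu> \<and> distr \<pi> borel snd = \<nu> \<and>
         (\<exists>K. is_disintegration K \<mu> \<pi> \<and>
           (AE x in \<mu>. integrable (K x) (\<lambda>y. y) \<and> (\<integral>y. y \<partial>K x) = x))}"

definition transport_cost :: "(real \<Rightarrow> real \<Rightarrow> real) \<Rightarrow> (real \<times> real) measure \<Rightarrow> ereal" where
  "transport_cost c \<pi> = ext_integral \<pi> (\<lambda>(x, y). c x y)"

definition min_cost :: "(real \<Rightarrow> real \<Rightarrow> real) \<Rightarrow> real measure \<Rightarrow> real measure \<Rightarrow> ereal" where
  "min_cost c \<mu> \<nu> = (INF \<pi>\<in>martingale_plans \<mu> \<nu>. transport_cost c \<pi>)"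

definition sufficient_integrability ::
    "(real \<Rightarrow> real \<Rightarrow> real) \<Rightarrow> real measure \<Rightarrow> real measure \<Rightarrow> bool" where
  "sufficient_integrability c \<mu> \<nu> \<longleftrightarrow>
     (\<exists>a b. integrable \<mu> a \<and> integrable \<nu> b \<and> (\<forall>x y. c x y \<ge> a x + b y))"

definition strictly_convex_on :: "real set \<Rightarrow> (real \<Rightarrow> real) \<Rightarrow> bool" where
  "strictly_convex_on S f \<longleftrightarrow> convex S \<and>
     (\<forall>x\<in>S. \<forall>y\<in>S. \<forall>u>0. \<forall>v>0. x \<noteq> y \<and> u + v = 1 \<longrightarrow>
        f (u * x + v * y) < u * f x + v * f y)"

definition left_monotone :: "(real \<times> real) measure \<Rightarrow> bool" where
  "left_monotone \<pi> \<longleftrightarrow>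
     (\<exists>\<Gamma>\<in>sets borel. emeasure \<pi> \<Gamma> = 1 \<and>
       (\<forall>x y1 y2 x' y'. (x, y1) \<in> \<Gamma> \<and> (x, y2) \<in> \<Gamma> \<and> (x', y') \<in> \<Gamma> \<longrightarrow>
          \<not> (x < x' \<and> y1 < y' \<and> y' < y2)))"

definition optimal_plan ::
    "(real \<Rightarrow> real \<Rightarrow> real) \<Rightarrow> real measure \<Rightarrow> real measure \<Rightarrow> (real \<times> real) measure \<Rightarrow> bool" where
  "optimal_plan c \<mu> \<nu> \<pi> \<longleftrightarrow> \<pi> \<in> martingale_plans \<mu> \<nu> \<and>
     (\<forall>\<pi>'\<in>martingale_plans \<mu> \<nu>. transport_cost c \<pi> \<le> transport_cost c \<pi>')"

definition second_marginal_upto :: "(real \<times> real) measure \<Rightarrow> real \<Rightarrow> real measure" where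
  "second_marginal_upto \<pi> t = distr (restrict_space \<pi> ({..t} \<times> UNIV)) borel snd"

definition left_curtain :: "real measure \<Rightarrow> real measure \<Rightarrow> (real \<times> real) measure \<Rightarrow> bool" where
  "left_curtain \<mu> \<nu> \<pi> \<longleftrightarrow> \<pi> \<in> martingale_plans \<mu> \<nu> \<and>
     (\<forall>\<pi>'\<in>martingale_plans \<mu> \<nu>. \<forall>t.
        convex_order (second_marginal_upto \<pi> t) (second_marginal_upto \<pi>' t))"

end

theory Submission
  imports Defs
begin

text \<open>
  The equivalence is proved as a cycle. If \<open>\<pi>\<close> is left-monotone, its potentials
  \<open>k \<mapsto> E[\<bar>Y - k\<bar>; X \<le> t]\<close> are the smallest among all plans, by a minimum principle, so \<open>\<pi>\<close> is the left
  curtain. Up to terms with the same integral for all plans, the cost is a mixture over \<open>k\<close> of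
  \<open>\<bar>Y - k\<bar>\<close> weighted by nonincreasing functions of \<open>X\<close>, so minimal potentials give minimal cost. If an
  optimal plan charged crossing fibres, exchanging a little mass between them with masses and means
  preserved would lower the cost strictly.
\<close>

text \<open>The derivative of \<open>h\<close> is only assumed strictly convex, so a second
  derivative of \<open>h\<close> may fail to exist at some points. A selection \<open>w\<close> of
  subgradients of \<open>h'\<close> takes its place. It is monotone, which gives the direction of
  every comparison of costs, but it may change sign; its positive and negative parts are therefore
  compared separately, and in opposite directions.

  In the last step a better plan cannot be built from three crossing points, since single points may
  have no mass and fibres are determined only up to a null set. The exchange is instead spread over
  all fibres with \<open>x \<le> t\<close> on one side and \<open>x > t\<close> on the other, with
  weights averaged over the fibres. Optimality then says that a product of two sets of fibres is
  null, so one of the two is null. This is a dichotomy for each \<open>t\<close>, \<open>q1\<close>,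
  \<open>q2\<close>, and countably many rational triples suffice to carve out the set
  \<open>\<Gamma>\<close>.\<close>

section \<open>Convex functions and the segment kernel\<close>

text \<open>On a partition into \<open>n + 1\<close> equal pieces every factor \<open>y - x\<close>
  is \<open>(b - a) / (n + 1)\<close> and the increments of \<open>V\<close> telescope, so the total
  error is of order \<open>1 / n\<close>. \<open>V\<close> may jump, as monotone functions
  do.\<close>

lemma eq_of_telescoping_increments:
  fixes F V :: "real \<Rightarrow> real"
  assumes ab: "a \<le> b"
    and est: "\<And>x y. a \<le> x \<Longrightarrow> x \<le> y \<Longrightarrow> y \<le> b \<Longrightarrow> \<bar>F y - F x\<bar> \<le> (y - x) * (V y - V x)"
  shows "F b = F a"
proof -
  have bound: "\<bar>F b - F a\<bar> \<le> (b - a) * (V b - V a) / real (Suc n)" for n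
  proof -
    define p where "p i = a + real i * ((b - a) / real (Suc n))" for i
    have pS: "p (Suc i) - p i = (b - a) / real (Suc n)" for i
      by (simp only: p_def of_nat_Suc distrib_right)
    have p0: "p 0 = a" and pN: "p (Suc n) = b" by (auto simp: p_def)
    have incp: "incseq p"
      by (rule incseq_SucI) (use pS ab in \<open>metis diff_ge_0_iff_ge divide_nonneg_nonneg of_nat_0_le_iff\<close>)
    have "F b - F a = (\<Sum>i<Suc n. F (p (Suc i)) - F (p i))"
      using sum_lessThan_telescope[of "\<lambda>i. F (p i)" "Suc n"] p0 pN by simp
    also have "\<bar>\<dots>\<bar> \<le> (\<Sum>i<Suc n. \<bar>F (p (Suc i)) - F (p i)\<bar>)"
      by (rule sum_abs)
    also have "\<dots> \<le> (\<Sum>i<Suc n. (b - a) / real (Suc n) * (V (p (Suc i)) - V (p i)))"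
    proof (rule sum_mono)
      fix i assume "i \<in> {..<Suc n}"
      then have "p 0 \<le> p i" "p i \<le> p (Suc i)" "p (Suc i) \<le> p (Suc n)"
        using incp by (auto intro: incseqD)
      then show "\<bar>F (p (Suc i)) - F (p i)\<bar> \<le> (b - a) / real (Suc n) * (V (p (Suc i)) - V (p i))"
        using est[of "p i" "p (Suc i)"] by (simp only: p0 pN pS)
    qed
    also have "\<dots> = (b - a) / real (Suc n) * (V b - V a)"
      using sum_lessThan_telescope[of "\<lambda>i. V (p i)" "Suc n"] p0 pN
      by (simp only: sum_distrib_left[symmetric])
    finally show ?thesis by simp
  qed
  have "(\<lambda>n. (b - a) * (V b - V a) / real (Suc n)) \<longlonglongrightarrow> 0"
    by real_asymp
  then have "\<bar>F b - F a\<bar> \<le> 0"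
    by (rule LIMSEQ_le_const) (use bound in blast)
  then show ?thesis by simp
qed

text \<open>A fundamental theorem of calculus for integrands with jumps: \<open>F\<close> minus the
  indefinite integral of \<open>\<phi>\<close> is constant by telescoping.\<close>

lemma has_integral_of_increments:
  fixes F V \<phi> :: "real \<Rightarrow> real"
  assumes ab: "a \<le> b" and \<phi>: "\<phi> integrable_on {a..b}"
    and est: "\<And>x y. a \<le> x \<Longrightarrow> x \<le> y \<Longrightarrow> y \<le> b \<Longrightarrow>
      \<bar>F y - F x - integral {x..y} \<phi>\<bar> \<le> (y - x) * (V y - V x)"
  shows "(\<phi> has_integral (F b - F a)) {a..b}"
proof -
  define G where "G x = F x - integral {a..x} \<phi>" for x
  have "G b = G a"
  proof (rule eq_of_telescoping_increments[OF ab, where V = V])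
    fix x y assume *: "a \<le> x" "x \<le> y" "y \<le> b"
    have "integral {a..x} \<phi> + integral {x..y} \<phi> = integral {a..y} \<phi>"
      by (rule Henstock_Kurzweil_Integration.integral_combine)
        (use * \<phi> in \<open>auto intro: integrable_subinterval_real\<close>)
    then have "G y - G x = F y - F x - integral {x..y} \<phi>"
      by (simp add: G_def)
    then show "\<bar>G y - G x\<bar> \<le> (y - x) * (V y - V x)" using est[OF *] by simp
  qed
  then have "integral {a..b} \<phi> = F b - F a"
    by (simp add: G_def)
  then show ?thesis using \<phi> by (metis integrable_integral)
qed

text \<open>\<open>v\<close> selects one element of the subdifferential of \<open>f\<close> at every
  point. For \<open>f = h'\<close> it stands in for the second derivative of
  \<open>h\<close>.\<close>

definition is_subgradient :: "(real \<Rightarrow> real) \<Rightarrow> (real \<Rightarrow> real) \<Rightarrow> bool" where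
  "is_subgradient v f \<longleftrightarrow> (\<forall>x y. f x + v x * (y - x) \<le> f y)"

lemma convex_imp_subgradient:
  fixes f :: "real \<Rightarrow> real"
  assumes "convex_on UNIV f"
  shows "\<exists>v. is_subgradient v f"
  unfolding is_subgradient_def
  using convex_le_Inf_differential[OF assms] by (auto intro!: exI)

lemma subgradient_increment:
  assumes "is_subgradient v f" "x \<le> y"
  shows "v x * (y - x) \<le> f y - f x" "f y - f x \<le> v y * (y - x)"
proof -
  have "f x + v x * (y - x) \<le> f y" "f y + v y * (x - y) \<le> f x"
    using assms(1) by (auto simp: is_subgradient_def)
  then show "v x * (y - x) \<le> f y - f x" "f y - f x \<le> v y * (y - x)"
    by (auto simp: algebra_simps)
qed

lemma subgradient_mono:
  assumes "is_subgradient v f"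
  shows "mono v"
proof (rule monoI)
  fix x y :: real assume "x \<le> y"
  show "v x \<le> v y"
  proof (cases "x = y")
    case False
    then have "v x * (y - x) \<le> v y * (y - x)" "y - x > 0"
      using subgradient_increment[OF assms \<open>x \<le> y\<close>] \<open>x \<le> y\<close> by linarith+
    then show ?thesis by simp
  qed simp
qed

text \<open>On \<open>{x..y}\<close> the increment of \<open>f\<close> and the integral of
  \<open>v\<close> both lie between \<open>v x * (y - x)\<close> and \<open>v y * (y - x)\<close>,
  so they differ by at most the width of this range.\<close>

lemma subgradient_has_integral:
  assumes v: "is_subgradient v f" and ab: "a \<le> b"
  shows "(v has_integral (f b - f a)) {a..b}"
proof (rule has_integral_of_increments[OF ab, where V = v])
  have mono: "mono_on {x..y} v" for x y
    using subgradient_mono[OF v] by (simp add: mono_def mono_on_def)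
  then show "v integrable_on {a..b}" by (rule integrable_on_mono_on)
  fix x y assume "a \<le> x" "x \<le> y" "y \<le> b"
  have int: "v integrable_on {x..y}" using mono by (rule integrable_on_mono_on)
  have "integral {x..y} (\<lambda>_. v x) \<le> integral {x..y} v"
    by (rule integral_le) (use int subgradient_mono[OF v] in \<open>auto simp: mono_def\<close>)
  moreover have "integral {x..y} v \<le> integral {x..y} (\<lambda>_. v y)"
    by (rule integral_le) (use int subgradient_mono[OF v] in \<open>auto simp: mono_def\<close>)
  ultimately show "\<bar>f y - f x - integral {x..y} v\<bar> \<le> (y - x) * (v y - v x)"
    using subgradient_increment[OF v \<open>x \<le> y\<close>] \<open>x \<le> y\<close>
    by (auto simp: algebra_simps abs_le_iff)
qed

text \<open>Integration by parts: \<open>(z - k) * g k + h k\<close> is formally an antiderivative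
  of \<open>(z - k) * w k\<close>, with \<open>w\<close> as the derivative of
  \<open>g\<close>.\<close>

lemma taylor_has_integral:
  assumes w: "is_subgradient w g"
    and h: "\<And>x. (h has_real_derivative g x) (at x)" and ab: "a \<le> b"
  shows "((\<lambda>k. (z - k) * w k) has_integral
    ((z - b) * g b + h b - ((z - a) * g a + h a))) {a..b}"
proof -
  have wab: "w integrable_on {a..b}"
    using subgradient_has_integral[OF w ab] by (rule has_integral_integrable)
  have wmono: "x \<le> y \<Longrightarrow> w x \<le> w y" for x y
    using subgradient_mono[OF w] by (simp add: mono_def)
  define B where "B = \<bar>w a\<bar> + \<bar>w b\<bar>"
  have B: "\<bar>w k\<bar> \<le> B" if "a \<le> k" "k \<le> b" for k
    using wmono[OF that(1)] wmono[OF that(2)] by (auto simp: B_def)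
  have B0: "0 \<le> B" by (simp add: B_def)
  have kw: "(\<lambda>k. (c - k) * w k) integrable_on {x..y}" if "a \<le> x" "y \<le> b" for c x y
  proof -
    have "mono_on {a..b} w" using wmono by (simp add: mono_on_def)
    then have "w absolutely_integrable_on {a..b}"
      using integrable_mono_on by (simp add: set_integrable_def integrable_restrict_space)
    then have "(\<lambda>k. (c - k) * w k) absolutely_integrable_on {a..b}"
      by (intro absolutely_integrable_bounded_measurable_product_real)
        (auto intro!: continuous_imp_measurable_on_sets_lebesgue compact_imp_bounded compact_continuous_image continuous_intros)
    then show ?thesis using that
      by (meson absolutely_integrable_on_def atLeastatMost_subset_iff integrable_subinterval_real)
  qed
  show ?thesis
  \<comment> \<open>Two errors arise, each at most \<open>B * (y - x)^2\<close>: one from replacing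
    \<open>g \<xi>\<close> by \<open>g y\<close>, one from the integral of
    \<open>(x - k) * w k\<close>. The factor 3 leaves room.\<close>
  proof (rule has_integral_of_increments[OF ab, where V = "\<lambda>x. 3 * B * x"])
    show "(\<lambda>k. (z - k) * w k) integrable_on {a..b}" by (rule kw) auto
    fix x y assume xy: "a \<le> x" "x \<le> y" "y \<le> b"
    show "\<bar>(z - y) * g y + h y - ((z - x) * g x + h x) - integral {x..y} (\<lambda>k. (z - k) * w k)\<bar>
        \<le> (y - x) * (3 * B * y - 3 * B * x)"
    proof (cases "x = y")
      case False
      then have "x < y" using xy by simp
      obtain \<xi> where \<xi>: "x < \<xi>" "\<xi> < y" "h y - h x = (y - x) * g \<xi>"
        using MVT2[OF \<open>x < y\<close> h] by blast
      have lip: "\<bar>g v - g u\<bar> \<le> B * (y - x)" if "x \<le> u" "u \<le> v" "v \<le> y" for u v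
      proof -
        have "w u * (v - u) \<le> g v - g u" "g v - g u \<le> w v * (v - u)"
          using subgradient_increment[OF w \<open>u \<le> v\<close>] by auto
        moreover have "\<bar>w u * (v - u)\<bar> \<le> B * (y - x)" "\<bar>w v * (v - u)\<bar> \<le> B * (y - x)"
          unfolding abs_mult using that xy B B0 by (auto intro!: mult_mono)
        ultimately show ?thesis by linarith
      qed
      have I: "(w has_integral (g y - g x)) {x..y}"
        using subgradient_has_integral[OF w \<open>x \<le> y\<close>] .
      have xk: "(\<lambda>k. (x - k) * w k) integrable_on {x..y}" using kw xy by auto
      have "integral {x..y} (\<lambda>k. (z - k) * w k) = integral {x..y} (\<lambda>k. (z - x) * w k + (x - k) * w k)"
        by (rule integral_cong) (simp add: algebra_simps)
      also have "\<dots> = (z - x) * (g y - g x) + integral {x..y} (\<lambda>k. (x - k) * w k)"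
        using I xk
        by (subst Henstock_Kurzweil_Integration.integral_add)
          (auto simp: has_integral_integrable integral_unique intro!: integrable_on_mult_right)
      finally have e: "integral {x..y} (\<lambda>k. (z - k) * w k)
        = (z - x) * (g y - g x) + integral {x..y} (\<lambda>k. (x - k) * w k)" .
      have "norm (integral {x..y} (\<lambda>k. (x - k) * w k)) \<le> integral {x..y} (\<lambda>k. (y - x) * B)"
        by (rule integral_norm_bound_integral[OF xk])
          (use xy B in \<open>auto simp: abs_mult intro!: mult_mono\<close>)
      then have J: "\<bar>integral {x..y} (\<lambda>k. (x - k) * w k)\<bar> \<le> (y - x) * ((y - x) * B)"
        using xy by simp
      have "\<bar>(y - x) * (g y - g \<xi>)\<bar> \<le> (y - x) * (B * (y - x))"
        unfolding abs_mult using lip[of \<xi> y] \<xi> xy by (auto intro!: mult_mono)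
      moreover have "(z - y) * g y + h y - ((z - x) * g x + h x) - (z - x) * (g y - g x)
        = - ((y - x) * (g y - g \<xi>))"
        using \<xi>(3) by (simp add: algebra_simps)
      moreover have "0 \<le> (y - x) * ((y - x) * B)" using xy B0 by simp
      ultimately show ?thesis using J unfolding e by (simp add: algebra_simps abs_le_iff)
    qed simp
  qed
qed


text \<open>For fixed \<open>x\<close> this differs from \<open>\<bar>y - k\<bar> / 2\<close> by an affine function of \<open>y\<close>. It vanishes unless \<open>k\<close>
  lies between \<open>x\<close> and \<open>y\<close>, and it is the kernel of the second-order Taylor remainder.\<close>

definition segment_kernel :: "real \<Rightarrow> real \<Rightarrow> real \<Rightarrow> real" where
  "segment_kernel k x y = (if x \<le> k then max 0 (y - k) else max 0 (k - y))"

lemma segment_kernel_nonneg: "0 \<le> segment_kernel k x y"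
  by (simp add: segment_kernel_def)

lemma segment_kernel_shift: "segment_kernel (x + k) x y = segment_kernel k 0 (y - x)"
  by (auto simp: segment_kernel_def)

lemma measurable_segment_kernel[measurable (raw)]:
  assumes [measurable]: "f \<in> borel_measurable M" "g \<in> borel_measurable M" "k \<in> borel_measurable M"
  shows "(\<lambda>\<omega>. segment_kernel (k \<omega>) (f \<omega>) (g \<omega>)) \<in> borel_measurable M"
  unfolding segment_kernel_def by measurable

lemma
  assumes w: "is_subgradient w g"
    and h: "\<And>x. (h has_real_derivative g x) (at x)"
  shows integrable_segment_kernel: "integrable lborel (\<lambda>k. segment_kernel k 0 z * w k)"
    and taylor_segment_kernel:
      "h z = h 0 + g 0 * z + (\<integral>k. segment_kernel k 0 z * w k \<partial>lborel)"
proof -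
  have wmono: "mono w" using subgradient_mono[OF w] .
  have [measurable]: "w \<in> borel_measurable borel" using borel_measurable_mono[OF wmono] .
  define S where "S = {min 0 z..max 0 z}"
  define B where "B = \<bar>w (min 0 z)\<bar> + \<bar>w (max 0 z)\<bar>"
  have B: "\<bar>w k\<bar> \<le> B" if "k \<in> S" for k
    using monoD[OF wmono, of "min 0 z" k] monoD[OF wmono, of k "max 0 z"] that
    by (auto simp: B_def S_def)
  have zero: "segment_kernel k 0 z = 0" if "k \<notin> S" for k
    using that by (auto simp: segment_kernel_def S_def)
  show int: "integrable lborel (\<lambda>k. segment_kernel k 0 z * w k)"
  proof (rule integrableI_bounded_set[where A = S and B = "\<bar>z\<bar> * B"])
    show "AE k in lborel. k \<in> S \<longrightarrow> norm (segment_kernel k 0 z * w k) \<le> \<bar>z\<bar> * B"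
    proof (rule AE_I2, rule impI)
      fix k assume k: "k \<in> S"
      then have "\<bar>segment_kernel k 0 z\<bar> \<le> \<bar>z\<bar>" by (auto simp: segment_kernel_def S_def)
      then show "norm (segment_kernel k 0 z * w k) \<le> \<bar>z\<bar> * B"
        using B[OF k] by (simp add: abs_mult mult_mono)
    qed
  qed (use zero in \<open>auto simp: S_def\<close>)
  have "((\<lambda>k. segment_kernel k 0 z * w k) has_integral (h z - h 0 - g 0 * z)) S"
  proof (cases "0 \<le> z")
    case True
    have "((\<lambda>k. (z - k) * w k) has_integral ((z - z) * g z + h z - ((z - 0) * g 0 + h 0))) {0..z}"
      by (rule taylor_has_integral[OF w h True])
    then have "((\<lambda>k. segment_kernel k 0 z * w k) has_integral ((z - z) * g z + h z - ((z - 0) * g 0 + h 0))) {0..z}"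
      by (rule has_integral_eq[rotated]) (auto simp: segment_kernel_def)
    then show ?thesis using True by (simp add: S_def algebra_simps)
  next
    case False
    then have "z \<le> 0" by simp
    have "((\<lambda>k. (z - k) * w k) has_integral ((z - 0) * g 0 + h 0 - ((z - z) * g z + h z))) {z..0}"
      by (rule taylor_has_integral[OF w h \<open>z \<le> 0\<close>])
    \<comment> \<open>At \<open>k = 0\<close> the kernel takes its first branch and equals 0,
      whereas the negated integrand is \<open>- z * w 0\<close>; hence the exceptional
      point.\<close>
    from has_integral_neg[OF this]
    have "((\<lambda>k. segment_kernel k 0 z * w k) has_integral - ((z - 0) * g 0 + h 0 - ((z - z) * g z + h z))) {z..0}"
      by (rule has_integral_spike_finite[of "{0}", rotated 2]) (use False in \<open>auto simp: segment_kernel_def algebra_simps\<close>)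
    then show ?thesis using False by (simp add: S_def algebra_simps)
  qed
  then have "((\<lambda>k. segment_kernel k 0 z * w k) has_integral (h z - h 0 - g 0 * z)) UNIV"
    by (rule has_integral_on_superset) (use zero in auto)
  with has_integral_integral_lborel[OF int]
  have "(\<integral>k. segment_kernel k 0 z * w k \<partial>lborel) = h z - h 0 - g 0 * z"
    by (rule has_integral_unique)
  then show "h z = h 0 + g 0 * z + (\<integral>k. segment_kernel k 0 z * w k \<partial>lborel)"
    by simp
qed

text \<open>Near the sign change of \<open>w\<close> the two parts can cancel, but there one of them is only of
  first order, so a finite cost forces both parts to be integrable.\<close>

lemma segment_kernel_min_part_bound:
  assumes w: "mono (w :: real \<Rightarrow> real)"
  obtains B where "B \<ge> 0"
    "\<And>z. (\<integral>\<^sup>+k. ennreal (segment_kernel k 0 z * max 0 (w k)) \<partial>lborel) \<le> ennreal (B * \<bar>z\<bar>) \<or>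
         (\<integral>\<^sup>+k. ennreal (segment_kernel k 0 z * max 0 (- w k)) \<partial>lborel) \<le> ennreal (B * \<bar>z\<bar>)"
proof -
  have wm: "x \<le> y \<Longrightarrow> w x \<le> w y" for x y using w by (simp add: mono_def)
  have key: "(\<integral>\<^sup>+k. ennreal (segment_kernel k 0 z * f k) \<partial>lborel) \<le> ennreal (\<bar>w 0\<bar> * \<bar>c\<bar> * \<bar>z\<bar>)"
    if f: "\<And>k. segment_kernel k 0 z \<noteq> 0 \<Longrightarrow> f k \<le> \<bar>w 0\<bar> * indicator {min 0 c..max 0 c} k" for f z c
  proof -
    have "(\<integral>\<^sup>+k. ennreal (segment_kernel k 0 z * f k) \<partial>lborel)
      \<le> (\<integral>\<^sup>+k. ennreal (\<bar>z\<bar> * \<bar>w 0\<bar>) * indicator {min 0 c..max 0 c} k \<partial>lborel)"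
    proof (rule nn_integral_mono)
      fix k
      have "segment_kernel k 0 z * f k \<le> \<bar>z\<bar> * (\<bar>w 0\<bar> * indicator {min 0 c..max 0 c} k)"
      proof (cases "segment_kernel k 0 z = 0")
        case False
        have "segment_kernel k 0 z * f k \<le> segment_kernel k 0 z * (\<bar>w 0\<bar> * indicator {min 0 c..max 0 c} k)"
          using f[OF False] segment_kernel_nonneg by (rule mult_left_mono)
        also have "\<dots> \<le> \<bar>z\<bar> * (\<bar>w 0\<bar> * indicator {min 0 c..max 0 c} k)"
          by (rule mult_right_mono) (auto simp: segment_kernel_def)
        finally show ?thesis .
      qed simp
      then show "ennreal (segment_kernel k 0 z * f k) \<le> ennreal (\<bar>z\<bar> * \<bar>w 0\<bar>) * indicator {min 0 c..max 0 c} k"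
        by (auto simp: indicator_def ennreal_leI ennreal_neg split: if_splits)
    qed
    also have "\<dots> = ennreal (\<bar>z\<bar> * \<bar>w 0\<bar>) * emeasure lborel {min 0 c..max 0 c}"
      by (rule nn_integral_cmult_indicator) simp
    also have "\<dots> = ennreal (\<bar>w 0\<bar> * \<bar>c\<bar> * \<bar>z\<bar>)"
      by (auto simp: ennreal_mult[symmetric] ac_simps max_def min_def)
    finally show ?thesis .
  qed
  \<comment> \<open>If \<open>w 0 \<ge> 0\<close>, \<open>c\<close> is a point where
    \<open>w\<close> is negative, otherwise one where \<open>w\<close> is positive;
    \<open>c = 0\<close> if there is none. For each \<open>z\<close>, one part of \<open>w\<close>
    then vanishes on the segment from 0 to \<open>z\<close> outside
    \<open>{min 0 c..max 0 c}\<close> and is at most \<open>\<bar>w 0\<bar>\<close> inside. The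
    kernel is at most \<open>\<bar>z\<bar>\<close>, which gives the constant
    \<open>\<bar>w 0\<bar> * \<bar>c\<bar>\<close>.\<close>
  have "\<exists>c. (w 0 \<ge> 0 \<and> ((c \<le> 0 \<and> w c < 0) \<or> (c = 0 \<and> (\<forall>k\<le>0. w k \<ge> 0)))) \<or>
    (w 0 < 0 \<and> ((c \<ge> 0 \<and> w c > 0) \<or> (c = 0 \<and> (\<forall>k\<ge>0. w k \<le> 0))))"
    by (metis not_le)
  then obtain c where c: "(w 0 \<ge> 0 \<and> ((c \<le> 0 \<and> w c < 0) \<or> (c = 0 \<and> (\<forall>k\<le>0. w k \<ge> 0)))) \<or>
    (w 0 < 0 \<and> ((c \<ge> 0 \<and> w c > 0) \<or> (c = 0 \<and> (\<forall>k\<ge>0. w k \<le> 0))))"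
    by blast
  show thesis
  proof (rule that[of "\<bar>w 0\<bar> * \<bar>c\<bar>"])
    fix z
    let ?p = "\<lambda>k. max 0 (w k)" and ?n = "\<lambda>k. max 0 (- w k)"
    let ?I = "\<lambda>k. \<bar>w 0\<bar> * indicator {min 0 c..max 0 c} k :: real"
    have r: "segment_kernel k 0 z \<noteq> 0 \<Longrightarrow> (0 \<le> k \<and> k < z) \<or> (z < k \<and> k < 0)" for k
      by (auto simp: segment_kernel_def split: if_splits)
    have "(\<forall>k. segment_kernel k 0 z \<noteq> 0 \<longrightarrow> ?p k \<le> ?I k) \<or>
          (\<forall>k. segment_kernel k 0 z \<noteq> 0 \<longrightarrow> ?n k \<le> ?I k)"
    proof (cases "w 0 \<ge> 0")
      case True
      show ?thesis
      proof (cases "0 \<le> z")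
        case pos: True
        have "?n k \<le> ?I k" if "segment_kernel k 0 z \<noteq> 0" for k
          using wm[of 0 k] r[OF that] pos True by (auto simp: max_def indicator_def)
        then show ?thesis by blast
      next
        case neg: False
        show ?thesis
        proof (cases "c \<le> 0 \<and> w c < 0")
          case True
          have "?p k \<le> ?I k" if "segment_kernel k 0 z \<noteq> 0" for k
            using wm[of k c] wm[of k 0] r[OF that] neg True by (auto simp: indicator_def max_def)
          then show ?thesis by blast
        next
          case False
          have "?n k \<le> ?I k" if "segment_kernel k 0 z \<noteq> 0" for k
          proof -
            have "k \<le> 0" using r[OF that] neg by auto
            then have "0 \<le> w k" using c True False by auto
            then show ?thesis by (simp add: max_def)
          qed
          then show ?thesis by blast
        qed
      qed
    next
      case False
      show ?thesis
      proof (cases "0 \<le> z")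
        case neg: False
        have "?p k \<le> ?I k" if "segment_kernel k 0 z \<noteq> 0" for k
          using wm[of k 0] r[OF that] neg False by (auto simp: max_def indicator_def)
        then show ?thesis by blast
      next
        case pos: True
        show ?thesis
        proof (cases "c \<ge> 0 \<and> w c > 0")
          case True
          have "?n k \<le> ?I k" if "segment_kernel k 0 z \<noteq> 0" for k
            using wm[of c k] wm[of 0 k] r[OF that] pos True False by (auto simp: indicator_def max_def)
          then show ?thesis by blast
        next
          case nc: False
          then have "?p k \<le> ?I k" if "segment_kernel k 0 z \<noteq> 0" for k
            using c False pos r[OF that] by (auto simp: max_def indicator_def)
          then show ?thesis by blast
        qed
      qed
    qed
    then show "(\<integral>\<^sup>+k. ennreal (segment_kernel k 0 z * ?p k) \<partial>lborel) \<le> ennreal (\<bar>w 0\<bar> * \<bar>c\<bar> * \<bar>z\<bar>) \<or>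
      (\<integral>\<^sup>+k. ennreal (segment_kernel k 0 z * ?n k) \<partial>lborel) \<le> ennreal (\<bar>w 0\<bar> * \<bar>c\<bar> * \<bar>z\<bar>)"
    proof
      assume "\<forall>k. segment_kernel k 0 z \<noteq> 0 \<longrightarrow> ?p k \<le> ?I k"
      then show ?thesis by (intro disjI1 key) blast
    next
      assume "\<forall>k. segment_kernel k 0 z \<noteq> 0 \<longrightarrow> ?n k \<le> ?I k"
      then show ?thesis by (intro disjI2 key) blast
    qed
  qed simp
qed

section \<open>Convex order from potentials\<close>

lemma nn_integral_layer_cake:
  fixes f :: "'a \<Rightarrow> real" and g :: "'a \<Rightarrow> ennreal"
  assumes "sigma_finite_measure M"
    and [measurable]: "f \<in> borel_measurable M" "g \<in> borel_measurable M"
  shows "(\<integral>\<^sup>+x. g x * ennreal (f x) \<partial>M) =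
    (\<integral>\<^sup>+r. indicator {0..} r * (\<integral>\<^sup>+x. g x * indicator {x. r < f x} x \<partial>M) \<partial>lborel)"
proof -
  interpret sigma_finite_measure M by fact
  interpret pair_sigma_finite M lborel ..
  have layer: "ennreal (f x) = (\<integral>\<^sup>+r. indicator {0..} r * indicator {x. r < f x} x \<partial>lborel)" for x
  proof -
    have "(\<integral>\<^sup>+r. indicator {0..} r * indicator {x. r < f x} x \<partial>lborel) = (\<integral>\<^sup>+r. indicator {0..<f x} r \<partial>lborel)"
      by (rule nn_integral_cong) (auto simp: indicator_def)
    also have "\<dots> = ennreal (f x)" by (cases "0 \<le> f x") (auto simp: ennreal_neg)
    finally show ?thesis by simp
  qed
  have "(\<integral>\<^sup>+x. g x * ennreal (f x) \<partial>M) =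
    (\<integral>\<^sup>+x. (\<integral>\<^sup>+r. indicator {0..} r * (g x * indicator {x. r < f x} x) \<partial>lborel) \<partial>M)"
  proof (rule nn_integral_cong)
    fix x assume "x \<in> space M"
    show "g x * ennreal (f x) = (\<integral>\<^sup>+r. indicator {0..} r * (g x * indicator {x. r < f x} x) \<partial>lborel)"
      unfolding layer
      by (subst nn_integral_cmult[symmetric]) (simp_all add: indicator_def ac_simps)
  qed
  also have "\<dots> = (\<integral>\<^sup>+r. (\<integral>\<^sup>+x. indicator {0..} r * (g x * indicator {x. r < f x} x) \<partial>M) \<partial>lborel)"
    by (rule Fubini'[symmetric]) (simp add: indicator_def)
  also have "\<dots> = (\<integral>\<^sup>+r. indicator {0..} r * (\<integral>\<^sup>+x. g x * indicator {x. r < f x} x \<partial>M) \<partial>lborel)"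
    by (intro nn_integral_cong nn_integral_cmult) simp
  finally show ?thesis .
qed

text \<open>Reduces a comparison of integrals over different spaces to one inequality per level
  \<open>r\<close>. It is applied where the superlevel sets are half-lines in one variable, so that
  each inequality is one between potentials.\<close>

lemma nn_integral_mono_superlevel:
  fixes f :: "'a \<Rightarrow> real" and f' :: "'b \<Rightarrow> real" and g :: "'a \<Rightarrow> ennreal" and g' :: "'b \<Rightarrow> ennreal"
  assumes "sigma_finite_measure M" "sigma_finite_measure N"
    and "f \<in> borel_measurable M" "g \<in> borel_measurable M"
    and "f' \<in> borel_measurable N" "g' \<in> borel_measurable N"
    and "\<And>r. 0 \<le> r \<Longrightarrow> (\<integral>\<^sup>+x. g x * indicator {x. r < f x} x \<partial>M) \<le>
      (\<integral>\<^sup>+x. g' x * indicator {x. r < f' x} x \<partial>N)"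
  shows "(\<integral>\<^sup>+x. g x * ennreal (f x) \<partial>M) \<le> (\<integral>\<^sup>+x. g' x * ennreal (f' x) \<partial>N)"
  using assms
  by (simp add: nn_integral_layer_cake) (auto intro!: nn_integral_mono simp: indicator_def)

text \<open>\<open>ext_integral\<close> is not additive in general. Here the negative part of the
  sum is dominated by that of \<open>f\<close> and hence has a finite integral.\<close>

lemma ext_integral_add_nonneg:
  assumes f: "integrable M f" and [measurable]: "q \<in> borel_measurable M" and q: "\<And>x. 0 \<le> q x"
  shows "ext_integral M (\<lambda>x. f x + q x) = ereal (\<integral>x. f x \<partial>M) + enn2ereal (\<integral>\<^sup>+x. q x \<partial>M)"
proof -
  have [measurable]: "f \<in> borel_measurable M" using f by simp
  let ?P = "\<integral>\<^sup>+x. ennreal (f x + q x) \<partial>M" and ?N = "\<integral>\<^sup>+x. ennreal (- (f x + q x)) \<partial>M"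
  let ?p = "\<integral>\<^sup>+x. ennreal (f x) \<partial>M" and ?n = "\<integral>\<^sup>+x. ennreal (- f x) \<partial>M" and ?q = "\<integral>\<^sup>+x. ennreal (q x) \<partial>M"
  have fin: "?p \<noteq> \<infinity>" "?n \<noteq> \<infinity>" using f by (auto simp: real_integrable_def)
  have "?N \<le> ?n" by (intro nn_integral_mono ennreal_leI) (use q in auto)
  with fin have N: "?N \<noteq> \<infinity>" by (auto simp: top_unique)
  \<comment> \<open>The claim without subtraction, which makes sense in \<open>ennreal\<close> even
    if the integral of \<open>q\<close> is infinite.\<close>
  have "?P + ?n = (\<integral>\<^sup>+x. ennreal (f x + q x) + ennreal (- f x) \<partial>M)"
    by (rule nn_integral_add[symmetric]) auto
  also have "\<dots> = (\<integral>\<^sup>+x. ennreal (- (f x + q x)) + (ennreal (f x) + ennreal (q x)) \<partial>M)"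
  proof (rule nn_integral_cong)
    fix x
    have "max 0 (f x + q x) + max 0 (- f x) = max 0 (- (f x + q x)) + (max 0 (f x) + q x)"
      using q[of x] by (auto simp: max_def)
    then have "ennreal (max 0 (f x + q x) + max 0 (- f x)) = ennreal (max 0 (- (f x + q x)) + (max 0 (f x) + q x))"
      by simp
    then show "ennreal (f x + q x) + ennreal (- f x) = ennreal (- (f x + q x)) + (ennreal (f x) + ennreal (q x))"
      using q[of x] by (simp add: ennreal_plus)
  qed
  also have "\<dots> = ?N + (?p + ?q)" by (subst nn_integral_add; simp)+
  finally have eq: "?P + ?n = ?N + (?p + ?q)" .
  have int: "(\<integral>x. f x \<partial>M) = enn2real ?p - enn2real ?n"
    using f by (rule real_lebesgue_integral_def)
  obtain a where a: "?p = ennreal a" "0 \<le> a" using fin(1) by (cases ?p) auto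
  obtain b where b: "?n = ennreal b" "0 \<le> b" using fin(2) by (cases ?n) auto
  obtain d where d: "?N = ennreal d" "0 \<le> d" using N by (cases ?N) auto
  show ?thesis
  proof (cases ?q)
    case (real e)
    then have "?P + ennreal b = ennreal (d + (a + e))"
      using eq a b d by (simp add: ennreal_plus)
    moreover then have "?P \<noteq> \<infinity>" by (auto simp: top_add)
    then obtain u where u: "?P = ennreal u" "0 \<le> u" by (cases ?P) auto
    ultimately have "u + b = d + (a + e)"
      using b a d real by (simp add: ennreal_plus[symmetric] del: ennreal_plus)
    then show ?thesis
      unfolding ext_integral_def int u d real a b using u d real a b by (simp add: enn2ereal_ennreal)
  next
    case top
    then have "?P + ennreal b = \<top>" using eq a b by simp
    then have "?P = \<top>" by (simp add: ennreal_add_eq_top)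
    then show ?thesis
      unfolding ext_integral_def int top d using d by (simp add: enn2ereal_ennreal)
  qed
qed

text \<open>A nonempty up-set in \<open>{0<..}\<close> is the half-line from \<open>Inf U\<close>,
  with or without its end point. The resulting hockey-stick function of \<open>y\<close> links
  superlevel sets of monotone functions to potentials.\<close>

lemma emeasure_lborel_interval_inter_upset:
  fixes U :: "real set"
  assumes "U \<noteq> {}" "U \<subseteq> {0<..}" and up: "\<And>x y. x \<in> U \<Longrightarrow> x \<le> y \<Longrightarrow> y \<in> U"
    and U[measurable]: "U \<in> sets borel"
  shows "emeasure lborel ({0<..<y} \<inter> U) = ennreal (max 0 (y - Inf U))"
proof -
  have bdd: "bdd_below U" using assms(2) by (intro bdd_belowI[of _ 0]) auto
  have "{Inf U<..<y} \<subseteq> {0<..<y} \<inter> U"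
  proof
    fix s assume s: "s \<in> {Inf U<..<y}"
    then obtain x where "x \<in> U" "x < s" using cInf_lessD[OF assms(1)] by auto
    then have "s \<in> U" using up by auto
    then show "s \<in> {0<..<y} \<inter> U" using s assms(2) by auto
  qed
  then have "emeasure lborel {Inf U<..<y} \<le> emeasure lborel ({0<..<y} \<inter> U)"
    by (rule emeasure_mono) simp
  moreover have "{0<..<y} \<inter> U \<subseteq> {Inf U..<y}" using cInf_lower[OF _ bdd] by auto
  then have "emeasure lborel ({0<..<y} \<inter> U) \<le> emeasure lborel {Inf U..<y}"
    by (rule emeasure_mono) simp
  ultimately show ?thesis
    by (cases "Inf U \<le> y") (auto simp: max_def)
qed

text \<open>\<open>max 0 (\<sigma> * y - a)\<close> is half of
  \<open>\<bar>y - \<sigma> * a\<bar>\<close> plus an affine function of \<open>y\<close>, and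
  affine functions have equal integrals when mass and mean agree. The sign
  \<open>\<sigma> = - 1\<close> serves the part of a convex function to the left of 0.\<close>

lemma potential_le_imp_upset_le:
  assumes M: "finite_first_moment M" and N: "finite_first_moment N"
    and mass: "measure M UNIV = measure N UNIV" and mean: "(\<integral>x. x \<partial>M) = (\<integral>x. x \<partial>N)"
    and pot: "\<And>k. (\<integral>y. \<bar>y - k\<bar> \<partial>M) \<le> (\<integral>y. \<bar>y - k\<bar> \<partial>N)"
    and \<sigma>: "\<sigma> = 1 \<or> \<sigma> = - 1"
    and U: "U \<subseteq> {0<..}" "\<And>x y. x \<in> U \<Longrightarrow> x \<le> y \<Longrightarrow> y \<in> U" "U \<in> sets borel"
  shows "(\<integral>\<^sup>+y. emeasure lborel ({0<..<\<sigma> * y} \<inter> U) \<partial>M) \<le> (\<integral>\<^sup>+y. emeasure lborel ({0<..<\<sigma> * y} \<inter> U) \<partial>N)"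
proof (cases "U = {}")
  case False
  let ?f = "\<lambda>y. max 0 (\<sigma> * y - Inf U)"
  have f: "?f y = (\<bar>y - \<sigma> * Inf U\<bar> + (\<sigma> * y - Inf U)) / 2" for y
    using \<sigma> by (auto simp: max_def)
  have I: "integrable Q ?f" "(\<integral>y. ?f y \<partial>Q) =
      ((\<integral>y. \<bar>y - \<sigma> * Inf U\<bar> \<partial>Q) + (\<sigma> * (\<integral>y. y \<partial>Q) - measure Q UNIV * Inf U)) / 2"
    if Q: "finite_first_moment Q" for Q
  proof -
    interpret finite_measure Q using Q by (simp add: finite_first_moment_def)
    have [simp]: "space Q = UNIV"
      using Q sets_eq_imp_space_eq[of Q borel] by (simp add: finite_first_moment_def)
    have [simp]: "integrable Q (\<lambda>y. y)" using Q by (simp add: finite_first_moment_def)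
    show "integrable Q ?f" unfolding f by simp
    show "(\<integral>y. ?f y \<partial>Q) =
      ((\<integral>y. \<bar>y - \<sigma> * Inf U\<bar> \<partial>Q) + (\<sigma> * (\<integral>y. y \<partial>Q) - measure Q UNIV * Inf U)) / 2"
      unfolding f by simp
  qed
  have "(\<integral>\<^sup>+y. emeasure lborel ({0<..<\<sigma> * y} \<inter> U) \<partial>Q) = ennreal (\<integral>y. ?f y \<partial>Q)"
    if Q: "finite_first_moment Q" for Q
  proof -
    have "emeasure lborel ({0<..<\<sigma> * y} \<inter> U) = ennreal (?f y)" for y
      by (rule emeasure_lborel_interval_inter_upset[OF False U])
    then have "(\<integral>\<^sup>+y. emeasure lborel ({0<..<\<sigma> * y} \<inter> U) \<partial>Q) = (\<integral>\<^sup>+y. ennreal (?f y) \<partial>Q)"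
      by (simp only:)
    also have "\<dots> = ennreal (\<integral>y. ?f y \<partial>Q)"
      by (rule nn_integral_eq_integral[OF I(1)[OF Q]]) simp
    finally show ?thesis .
  qed
  then show ?thesis
    using M N I(2) mass mean pot by (auto intro!: ennreal_leI divide_right_mono)
qed simp

text \<open>A convex function is a supporting line at 0 plus a mixture of hockey sticks. The mixing
  measure, the second derivative of \<open>\<phi>\<close>, is never formed: layer cake for the
  monotone function \<open>v - v 0\<close> does its work.\<close>

lemma convex_order_of_potentials:
  assumes M: "finite_first_moment M" and N: "finite_first_moment N"
    and mass: "measure M UNIV = measure N UNIV" and mean: "(\<integral>x. x \<partial>M) = (\<integral>x. x \<partial>N)"
    and pot: "\<And>k. (\<integral>y. \<bar>y - k\<bar> \<partial>M) \<le> (\<integral>y. \<bar>y - k\<bar> \<partial>N)"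
  shows "convex_order M N"
  unfolding convex_order_def
proof (intro conjI allI impI M N)
  fix \<phi> :: "real \<Rightarrow> real" assume "convex_on UNIV \<phi>"
  then obtain v where v: "is_subgradient v \<phi>" using convex_imp_subgradient by blast
  have vm: "x \<le> y \<Longrightarrow> v x \<le> v y" for x y using subgradient_mono[OF v] by (simp add: mono_def)
  have [measurable]: "v \<in> borel_measurable borel"
    using borel_measurable_mono[OF subgradient_mono[OF v]] .
  define q where "q y = \<phi> y - \<phi> 0 - v 0 * y" for y
  have q0: "0 \<le> q y" for y
    using v[unfolded is_subgradient_def, rule_format, of 0 y] by (simp add: q_def)
  have "continuous_on UNIV \<phi>"
    by (rule convex_on_continuous) (use \<open>convex_on UNIV \<phi>\<close> in auto)
  then have [measurable]: "\<phi> \<in> borel_measurable borel" by (rule borel_measurable_continuous_onI)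
  have [measurable]: "q \<in> borel_measurable borel" unfolding q_def by measurable
  have vint: "((\<lambda>s. v s - v 0) has_integral (\<phi> b - \<phi> a - (b - a) * v 0)) {a..b}" if "a \<le> b" for a b
    using has_integral_diff[OF subgradient_has_integral[OF v that] has_integral_const_real[of "v 0" a b]] that
    by simp
  \<comment> \<open>On each side of 0, \<open>q\<close> is the integral of its derivative. The
    reflection \<open>s \<mapsto> - s\<close> on the left makes that integrand nondecreasing in
    \<open>s\<close> too.\<close>
  have qrep: "ennreal (q y) = (\<integral>\<^sup>+s. indicator {0<..<y} s * ennreal (v s - v 0) \<partial>lborel) +
      (\<integral>\<^sup>+s. indicator {0<..<- y} s * ennreal (v 0 - v (- s)) \<partial>lborel)" for y
  proof (cases "0 \<le> y")
    case True
    have "ennreal (q y) = (\<integral>\<^sup>+s. ennreal (v s - v 0) * indicator {0..y} s \<partial>lborel)"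
      using vint[OF True] vm by (subst nn_integral_has_integral_lebesgue') (auto simp: q_def algebra_simps)
    also have "\<dots> = (\<integral>\<^sup>+s. indicator {0<..<y} s * ennreal (v s - v 0) \<partial>lborel)"
      by (rule nn_integral_cong_AE)
        (use AE_lborel_singleton[of 0] AE_lborel_singleton[of y] in \<open>eventually_elim, auto simp: indicator_def\<close>)
    finally show ?thesis using True by simp
  next
    case False
    have "((\<lambda>s. v 0 - v s) has_integral q y) {y..0}"
      using has_integral_neg[OF vint[of y 0]] False by (simp add: q_def algebra_simps)
    then have "ennreal (q y) = (\<integral>\<^sup>+s. ennreal (v 0 - v s) * indicator {y..0} s \<partial>lborel)"
      using vm by (subst nn_integral_has_integral_lebesgue') (auto simp: q_def algebra_simps)
    also have "\<dots> = (\<integral>\<^sup>+s. indicator {y<..<0} s * ennreal (v 0 - v s) \<partial>lborel)"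
      by (rule nn_integral_cong_AE)
        (use AE_lborel_singleton[of 0] AE_lborel_singleton[of y] in \<open>eventually_elim, auto simp: indicator_def\<close>)
    also have "\<dots> = (\<integral>\<^sup>+s. indicator {0<..<- y} s * ennreal (v 0 - v (- s)) \<partial>lborel)"
      by (subst nn_integral_real_affine[where c = "-1" and t = 0]) (auto intro!: nn_integral_cong simp: indicator_def)
    finally show ?thesis using False by simp
  qed
  have comp: "(\<integral>\<^sup>+y. (\<integral>\<^sup>+s. indicator {0<..<\<sigma> * y} s * ennreal (f s) \<partial>lborel) \<partial>M) \<le>
      (\<integral>\<^sup>+y. (\<integral>\<^sup>+s. indicator {0<..<\<sigma> * y} s * ennreal (f s) \<partial>lborel) \<partial>N)"
    if \<sigma>: "\<sigma> = 1 \<or> \<sigma> = - 1" and f: "mono f" for \<sigma> and f :: "real \<Rightarrow> real"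
  proof -
    have [measurable]: "f \<in> borel_measurable borel" using borel_measurable_mono[OF f] .
    have eq: "(\<integral>\<^sup>+y. (\<integral>\<^sup>+s. indicator {0<..<\<sigma> * y} s * g s \<partial>lborel) \<partial>Q) =
        (\<integral>\<^sup>+p. (case p of (y, s) \<Rightarrow> indicator {0<..<\<sigma> * y} s * g s) \<partial>(Q \<Otimes>\<^sub>M lborel))"
      if [measurable]: "g \<in> borel_measurable borel" and Q: "finite_first_moment Q" for g :: "real \<Rightarrow> ennreal" and Q
    proof -
      have [measurable_cong]: "sets Q = sets borel" using Q by (simp add: finite_first_moment_def)
      show ?thesis
        by (subst lborel.nn_integral_fst[symmetric]) (simp_all add: indicator_def)
    qed
    have sf: "sigma_finite_measure (Q \<Otimes>\<^sub>M lborel)" if "finite_first_moment Q" for Q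
    proof -
      interpret finite_measure Q using that by (simp add: finite_first_moment_def)
      interpret pair_sigma_finite Q lborel ..
      show ?thesis by (rule sigma_finite_measure_axioms)
    qed
    have [measurable_cong]: "sets M = sets borel" "sets N = sets borel"
      using M N by (auto simp: finite_first_moment_def)
    have "(\<integral>\<^sup>+p. (case p of (y, s) \<Rightarrow> indicator {0<..<\<sigma> * y} s) * ennreal (f (snd p)) \<partial>(M \<Otimes>\<^sub>M lborel)) \<le>
        (\<integral>\<^sup>+p. (case p of (y, s) \<Rightarrow> indicator {0<..<\<sigma> * y} s) * ennreal (f (snd p)) \<partial>(N \<Otimes>\<^sub>M lborel))"
    proof (rule nn_integral_mono_superlevel)
      fix r :: real assume "0 \<le> r"
      \<comment> \<open>Monotonicity of \<open>f\<close> makes this superlevel set an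
        up-set.\<close>
      define U where "U = {s. 0 < s \<and> r < f s}"
      have U: "U \<subseteq> {0<..}" "\<And>x y. x \<in> U \<Longrightarrow> x \<le> y \<Longrightarrow> y \<in> U" "U \<in> sets borel"
        using f by (auto simp: U_def mono_def) (meson less_le_trans)
      have eq2: "(\<integral>\<^sup>+p. (case p of (y, s) \<Rightarrow> indicator {0<..<\<sigma> * y} s) * indicator {p. r < f (snd p)} p \<partial>(Q \<Otimes>\<^sub>M lborel))
        = (\<integral>\<^sup>+y. emeasure lborel ({0<..<\<sigma> * y} \<inter> U) \<partial>Q)" if Q: "finite_first_moment Q" for Q
      proof -
        have "(\<integral>\<^sup>+p. (case p of (y, s) \<Rightarrow> indicator {0<..<\<sigma> * y} s) * indicator {p. r < f (snd p)} p \<partial>(Q \<Otimes>\<^sub>M lborel))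
          = (\<integral>\<^sup>+p. (case p of (y, s) \<Rightarrow> indicator {0<..<\<sigma> * y} s * indicator U s) \<partial>(Q \<Otimes>\<^sub>M lborel))"
          by (rule nn_integral_cong) (auto simp: indicator_def U_def)
        also have "\<dots> = (\<integral>\<^sup>+y. (\<integral>\<^sup>+s. indicator {0<..<\<sigma> * y} s * indicator U s \<partial>lborel) \<partial>Q)"
          using U(3) by (intro eq[symmetric] Q) auto
        also have "\<dots> = (\<integral>\<^sup>+y. emeasure lborel ({0<..<\<sigma> * y} \<inter> U) \<partial>Q)"
          using U(3) by (simp flip: indicator_inter_arith)
        finally show ?thesis .
      qed
      show "(\<integral>\<^sup>+p. (case p of (y, s) \<Rightarrow> indicator {0<..<\<sigma> * y} s) * indicator {p. r < f (snd p)} p \<partial>(M \<Otimes>\<^sub>M lborel))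
        \<le> (\<integral>\<^sup>+p. (case p of (y, s) \<Rightarrow> indicator {0<..<\<sigma> * y} s) * indicator {p. r < f (snd p)} p \<partial>(N \<Otimes>\<^sub>M lborel))"
        unfolding eq2[OF M] eq2[OF N] by (rule potential_le_imp_upset_le[OF M N mass mean pot \<sigma> U])
    qed (use M N in \<open>auto intro!: sf simp: indicator_def split_beta\<close>)
    then show ?thesis
      by (simp add: eq M N split_beta)
  qed
  have qle: "(\<integral>\<^sup>+y. ennreal (q y) \<partial>M) \<le> (\<integral>\<^sup>+y. ennreal (q y) \<partial>N)"
  proof -
    have "(\<integral>\<^sup>+y. ennreal (q y) \<partial>Q) = (\<integral>\<^sup>+y. (\<integral>\<^sup>+s. indicator {0<..<1 * y} s * ennreal (v s - v 0) \<partial>lborel) \<partial>Q) +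
      (\<integral>\<^sup>+y. (\<integral>\<^sup>+s. indicator {0<..<- 1 * y} s * ennreal (v 0 - v (- s)) \<partial>lborel) \<partial>Q)"
      if Q: "finite_first_moment Q" for Q
    proof -
      have [measurable_cong]: "sets Q = sets borel" using Q by (simp add: finite_first_moment_def)
      show ?thesis unfolding qrep
        by (subst nn_integral_add[symmetric]) (simp_all add: indicator_def)
    qed
    moreover have "mono (\<lambda>s. v s - v 0)" "mono (\<lambda>s. v 0 - v (- s))"
      using vm by (auto intro!: monoI)
    ultimately show ?thesis
      using comp[of 1 "\<lambda>s. v s - v 0"] comp[of "- 1" "\<lambda>s. v 0 - v (- s)"] M N
      by (simp add: add_mono)
  qed
  have ext: "ext_integral Q \<phi> = ereal (\<phi> 0 * measure Q UNIV + v 0 * (\<integral>x. x \<partial>Q)) + enn2ereal (\<integral>\<^sup>+y. q y \<partial>Q)"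
    if Q: "finite_first_moment Q" for Q
  proof -
    interpret finite_measure Q using Q by (simp add: finite_first_moment_def)
    have [measurable_cong]: "sets Q = sets borel" using Q by (simp add: finite_first_moment_def)
    have [simp]: "space Q = UNIV" using Q sets_eq_imp_space_eq[of Q borel] by (simp add: finite_first_moment_def)
    have [simp]: "integrable Q (\<lambda>y. y)" using Q by (simp add: finite_first_moment_def)
    have "ext_integral Q \<phi> = ext_integral Q (\<lambda>y. (\<phi> 0 + v 0 * y) + q y)" by (simp add: q_def)
    also have "\<dots> = ereal (\<integral>y. \<phi> 0 + v 0 * y \<partial>Q) + enn2ereal (\<integral>\<^sup>+y. q y \<partial>Q)"
      by (rule ext_integral_add_nonneg) (use q0 in auto)
    finally show ?thesis by (simp add: ac_simps)
  qed
  show "ext_integral M \<phi> \<le> ext_integral N \<phi>"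
    unfolding ext[OF M] ext[OF N] mass mean using qle
    by (intro add_left_mono) (simp add: less_eq_ennreal.rep_eq)
qed

section \<open>Martingale transport plans with a fixed disintegration\<close>

lemma measurable_fst_borel[measurable (raw)]:
  fixes f :: "'a \<Rightarrow> 'b::second_countable_topology \<times> 'c::second_countable_topology"
  assumes "f \<in> M \<rightarrow>\<^sub>M borel"
  shows "(\<lambda>x. fst (f x)) \<in> M \<rightarrow>\<^sub>M borel"
  using assms by (simp flip: borel_prod)

lemma measurable_snd_borel[measurable (raw)]:
  fixes f :: "'a \<Rightarrow> 'b::second_countable_topology \<times> 'c::second_countable_topology"
  assumes "f \<in> M \<rightarrow>\<^sub>M borel"
  shows "(\<lambda>x. snd (f x)) \<in> M \<rightarrow>\<^sub>M borel"
  using assms by (simp flip: borel_prod)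

text \<open>Fixing one disintegration \<open>K\<close> lets the fibres be named. Competing plans are
  further instances with the same \<open>\<mu>\<close> and \<open>\<nu>\<close> and their own
  kernel.\<close>

locale martingale_kernel =
  fixes \<mu> \<nu> :: "real measure" and \<pi> :: "(real \<times> real) measure" and K :: "real \<Rightarrow> real measure"
  assumes prob_\<mu>: "prob_space \<mu>"
    and sets_\<mu>[measurable_cong, simp]: "sets \<mu> = sets borel"
    and int_\<mu>: "integrable \<mu> (\<lambda>x. x)" and int_\<nu>: "integrable \<nu> (\<lambda>x. x)"
    and sets_\<pi>[measurable_cong, simp]: "sets \<pi> = sets borel"
    and fst_\<pi>: "distr \<pi> borel fst = \<mu>" and snd_\<pi>: "distr \<pi> borel snd = \<nu>"
    and disint: "is_disintegration K \<mu> \<pi>"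
    and mart: "AE x in \<mu>. integrable (K x) (\<lambda>y. y) \<and> (\<integral>y. y \<partial>K x) = x"
begin

lemma space_\<mu>[simp]: "space \<mu> = UNIV" using sets_eq_imp_space_eq[OF sets_\<mu>] by simp
lemma space_\<pi>[simp]: "space \<pi> = UNIV" using sets_eq_imp_space_eq[OF sets_\<pi>] by simp

lemma K_prob_algebra[measurable]: "K \<in> borel \<rightarrow>\<^sub>M prob_algebra borel"
  using disint by (simp add: is_disintegration_def)

lemma K_subprob_algebra[measurable]: "K \<in> borel \<rightarrow>\<^sub>M subprob_algebra borel"
  using K_prob_algebra by (rule measurable_prob_algebraD)

lemma prob_K: "prob_space (K x)" and sets_K[measurable_cong, simp]: "sets (K x) = sets borel"
  using measurable_space[OF K_prob_algebra, of x] by (auto simp: space_prob_algebra)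

lemma space_K[simp]: "space (K x) = UNIV" using sets_eq_imp_space_eq[OF sets_K] by simp

lemma measurable_nn_integral_K[measurable (raw)]:
  assumes [measurable]: "(\<lambda>(\<omega>, y). f \<omega> y) \<in> borel_measurable (M \<Otimes>\<^sub>M borel)" "g \<in> M \<rightarrow>\<^sub>M borel"
  shows "(\<lambda>\<omega>. \<integral>\<^sup>+y. f \<omega> y \<partial>K (g \<omega>)) \<in> borel_measurable M"
  by (rule nn_integral_measurable_subprob_algebra2[where N = borel]) measurable

text \<open>Since the integrand depends on the parameter, \<open>K (g \<omega>)\<close> is carried
  by \<open>Pair \<omega>\<close> to the product space, where the integrand is one fixed
  function.\<close>

lemma measurable_integral_K[measurable (raw)]:
  fixes f :: "'a \<Rightarrow> real \<Rightarrow> real"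
  assumes f[measurable]: "(\<lambda>(\<omega>, y). f \<omega> y) \<in> borel_measurable (M \<Otimes>\<^sub>M borel)" and g[measurable]: "g \<in> M \<rightarrow>\<^sub>M borel"
  shows "(\<lambda>\<omega>. \<integral>y. f \<omega> y \<partial>K (g \<omega>)) \<in> borel_measurable M"
proof -
  note measurable_distr2[measurable]
  have "(\<lambda>\<omega>. integral\<^sup>L (distr (K (g \<omega>)) (M \<Otimes>\<^sub>M borel) (Pair \<omega>)) (\<lambda>(\<omega>, y). f \<omega> y)) \<in> borel_measurable M"
    by measurable
  then show ?thesis
    by (rule measurable_cong[THEN iffD1, rotated]) (simp add: integral_distr)
qed

lemma measurable_fst_snd_\<pi>[measurable]: "fst \<in> borel_measurable \<pi>" "snd \<in> borel_measurable \<pi>"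
  using measurable_fst_borel[of "\<lambda>p. p" \<pi>] measurable_snd_borel[of "\<lambda>p. p" \<pi>] by auto

lemma measurable_distr_Pair_K: "(\<lambda>x. distr (K x) borel (Pair x)) \<in> \<mu> \<rightarrow>\<^sub>M subprob_algebra borel"
proof (rule measurable_distr2[where M = borel])
  have "sets (\<mu> \<Otimes>\<^sub>M borel) = sets (borel :: (real \<times> real) measure)"
    by (subst borel_prod[symmetric]) (rule sets_pair_measure_cong; simp)
  then have "(\<lambda>x. x) \<in> \<mu> \<Otimes>\<^sub>M borel \<rightarrow>\<^sub>M (borel :: (real \<times> real) measure)"
    by (rule measurable_ident_sets)
  moreover have "case_prod Pair = (\<lambda>x :: real \<times> real. x)" by auto
  ultimately show "case_prod Pair \<in> \<mu> \<Otimes>\<^sub>M borel \<rightarrow>\<^sub>M (borel :: (real \<times> real) measure)"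
    by (simp only:)
qed simp

text \<open>As a \<open>bind\<close>, the disintegration identity extends from sets to all
  nonnegative integrands.\<close>

lemma \<pi>_eq_bind: "\<pi> = \<mu> \<bind> (\<lambda>x. distr (K x) borel (Pair x))"
proof (rule measure_eqI)
  show "sets \<pi> = sets (\<mu> \<bind> (\<lambda>x. distr (K x) borel (Pair x)))"
    by (subst sets_bind[where N = borel]) auto
  fix A assume "A \<in> sets \<pi>"
  then have [measurable]: "A \<in> sets borel" by simp
  have "emeasure (\<mu> \<bind> (\<lambda>x. distr (K x) borel (Pair x))) A
      = (\<integral>\<^sup>+x. emeasure (distr (K x) borel (Pair x)) A \<partial>\<mu>)"
    by (rule emeasure_bind[where N = borel]) (auto intro: measurable_distr_Pair_K)
  also have "\<dots> = (\<integral>\<^sup>+x. emeasure (K x) {y. (x, y) \<in> A} \<partial>\<mu>)"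
    by (intro nn_integral_cong) (simp add: emeasure_distr vimage_def)
  finally show "emeasure \<pi> A = emeasure (\<mu> \<bind> (\<lambda>x. distr (K x) borel (Pair x))) A"
    using disint by (simp add: is_disintegration_def)
qed

lemma nn_integral_\<pi>:
  assumes [measurable]: "f \<in> borel_measurable borel"
  shows "(\<integral>\<^sup>+p. f p \<partial>\<pi>) = (\<integral>\<^sup>+x. (\<integral>\<^sup>+y. f (x, y) \<partial>K x) \<partial>\<mu>)"
proof -
  have "(\<integral>\<^sup>+p. f p \<partial>\<pi>) = (\<integral>\<^sup>+x. (\<integral>\<^sup>+p. f p \<partial>distr (K x) borel (Pair x)) \<partial>\<mu>)"
    by (subst \<pi>_eq_bind, rule nn_integral_bind[where B = borel]) (auto intro: measurable_distr_Pair_K)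
  then show ?thesis by (simp add: nn_integral_distr)
qed

lemma prob_\<pi>: "prob_space \<pi>"
proof
  interpret prob_space \<mu> by (rule prob_\<mu>)
  have "emeasure \<pi> (space \<pi>) = (\<integral>\<^sup>+x. emeasure (K x) UNIV \<partial>\<mu>)"
    using nn_integral_\<pi>[of "\<lambda>_. 1"] by simp
  also have "\<dots> = 1"
    using prob_space.emeasure_space_1[OF prob_K] by (simp add: emeasure_space_1[simplified])
  finally show "emeasure \<pi> (space \<pi>) = 1" .
qed

sublocale \<mu>: prob_space \<mu> by (rule prob_\<mu>)
sublocale \<pi>: prob_space \<pi> by (rule prob_\<pi>)
sublocale K: prob_space "K x" for x by (rule prob_K)

lemma AE_\<pi>:
  assumes [measurable]: "Measurable.pred borel P"
  shows "(AE p in \<pi>. P p) \<longleftrightarrow> (AE x in \<mu>. AE y in K x. P (x, y))"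
proof -
  have "(AE p in \<pi>. P p) \<longleftrightarrow> (\<integral>\<^sup>+p. indicator {p. \<not> P p} p \<partial>\<pi>) = 0"
    by (subst nn_integral_0_iff_AE) (auto simp: indicator_def)
  also have "\<dots> \<longleftrightarrow> (\<integral>\<^sup>+x. (\<integral>\<^sup>+y. indicator {p. \<not> P p} (x, y) \<partial>K x) \<partial>\<mu>) = 0"
    by (subst nn_integral_\<pi>) simp_all
  also have "\<dots> \<longleftrightarrow> (AE x in \<mu>. (\<integral>\<^sup>+y. indicator {p. \<not> P p} (x, y) \<partial>K x) = 0)"
    by (rule nn_integral_0_iff_AE) (simp add: indicator_def)
  also have "\<dots> \<longleftrightarrow> (AE x in \<mu>. AE y in K x. P (x, y))"
    by (simp add: nn_integral_0_iff_AE indicator_def)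
  finally show ?thesis .
qed

lemma integral_\<pi>_nonneg:
  fixes f :: "real \<times> real \<Rightarrow> real"
  assumes f: "integrable \<pi> f" and nn: "\<And>p. 0 \<le> f p"
  shows "AE x in \<mu>. integrable (K x) (\<lambda>y. f (x, y))"
    and "integrable \<mu> (\<lambda>x. \<integral>y. f (x, y) \<partial>K x)"
    and "(\<integral>p. f p \<partial>\<pi>) = (\<integral>x. (\<integral>y. f (x, y) \<partial>K x) \<partial>\<mu>)"
proof -
  have [measurable]: "f \<in> borel_measurable borel"
    using borel_measurable_integrable[OF f] by simp
  have eq: "(\<integral>\<^sup>+p. f p \<partial>\<pi>) = (\<integral>\<^sup>+x. (\<integral>\<^sup>+y. f (x, y) \<partial>K x) \<partial>\<mu>)"
    by (rule nn_integral_\<pi>) simp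
  have fin: "(\<integral>\<^sup>+p. f p \<partial>\<pi>) < \<infinity>"
    using f nn by (simp add: integrable_iff_bounded)
  then have ae: "AE x in \<mu>. (\<integral>\<^sup>+y. f (x, y) \<partial>K x) \<noteq> \<infinity>"
    unfolding eq by (intro nn_integral_PInf_AE) auto
  show 1: "AE x in \<mu>. integrable (K x) (\<lambda>y. f (x, y))"
    using ae by eventually_elim (use nn in \<open>auto simp: integrable_iff_bounded less_top\<close>)
  have cong: "AE x in \<mu>. ennreal (\<integral>y. f (x, y) \<partial>K x) = (\<integral>\<^sup>+y. f (x, y) \<partial>K x)"
    using 1 by eventually_elim (use nn in \<open>simp add: nn_integral_eq_integral\<close>)
  have m[measurable]: "(\<lambda>x. \<integral>y. f (x, y) \<partial>K x) \<in> borel_measurable borel"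
  proof -
    have "(\<lambda>x. \<integral>y. f (x, y) \<partial>K x) = (\<lambda>x. enn2real (\<integral>\<^sup>+y. f (x, y) \<partial>K x))"
      by (rule ext, subst integral_eq_nn_integral) (use nn in auto)
    then show ?thesis by simp
  qed
  have eq2: "(\<integral>\<^sup>+x. ennreal (\<integral>y. f (x, y) \<partial>K x) \<partial>\<mu>) = (\<integral>\<^sup>+p. f p \<partial>\<pi>)"
    unfolding eq by (rule nn_integral_cong_AE) (rule cong)
  show "integrable \<mu> (\<lambda>x. \<integral>y. f (x, y) \<partial>K x)"
    using eq2 fin nn by (simp add: integrable_iff_bounded integral_nonneg)
  show "(\<integral>p. f p \<partial>\<pi>) = (\<integral>x. (\<integral>y. f (x, y) \<partial>K x) \<partial>\<mu>)"
    using eq2 nn by (subst (1 2) integral_eq_nn_integral) (auto simp: integral_nonneg)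
qed

lemma integral_\<pi>:
  fixes f :: "real \<times> real \<Rightarrow> real"
  assumes f: "integrable \<pi> f"
  shows "AE x in \<mu>. integrable (K x) (\<lambda>y. f (x, y))"
    and "integrable \<mu> (\<lambda>x. \<integral>y. f (x, y) \<partial>K x)"
    and "(\<integral>p. f p \<partial>\<pi>) = (\<integral>x. (\<integral>y. f (x, y) \<partial>K x) \<partial>\<mu>)"
proof -
  let ?p = "\<lambda>p. max 0 (f p)" and ?n = "\<lambda>p. max 0 (- f p)"
  have [measurable]: "f \<in> borel_measurable borel"
    using borel_measurable_integrable[OF f] by simp
  have p: "integrable \<pi> ?p" and n: "integrable \<pi> ?n" using f by auto
  note P = integral_\<pi>_nonneg[OF p, simplified] and N = integral_\<pi>_nonneg[OF n, simplified]
  have d: "f p = ?p p - ?n p" for p by (simp add: max_def)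
  show ae: "AE x in \<mu>. integrable (K x) (\<lambda>y. f (x, y))"
    using P(1) N(1) by eventually_elim (subst d, rule Bochner_Integration.integrable_diff)
  have eq: "AE x in \<mu>. (\<integral>y. f (x, y) \<partial>K x) = (\<integral>y. ?p (x, y) \<partial>K x) - (\<integral>y. ?n (x, y) \<partial>K x)"
    using P(1) N(1) by eventually_elim (subst d, rule Bochner_Integration.integral_diff)
  have [measurable]: "(\<lambda>x. \<integral>y. f (x, y) \<partial>K x) \<in> borel_measurable borel"
    by measurable
  have i: "integrable \<mu> (\<lambda>x. (\<integral>y. ?p (x, y) \<partial>K x) - (\<integral>y. ?n (x, y) \<partial>K x))"
    using P(2) N(2) by (rule Bochner_Integration.integrable_diff)
  show "integrable \<mu> (\<lambda>x. \<integral>y. f (x, y) \<partial>K x)"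
    using i by (rule integrable_cong_AE_imp) (simp, use eq in \<open>eventually_elim, simp only:\<close>)
  have "(\<integral>p. f p \<partial>\<pi>) = (\<integral>p. ?p p \<partial>\<pi>) - (\<integral>p. ?n p \<partial>\<pi>)"
    using p n by (subst d) (rule Bochner_Integration.integral_diff)
  also have "\<dots> = (\<integral>x. (\<integral>y. ?p (x, y) \<partial>K x) - (\<integral>y. ?n (x, y) \<partial>K x) \<partial>\<mu>)"
    unfolding P(3) N(3) using P(2) N(2) by (rule Bochner_Integration.integral_diff[symmetric])
  also have "\<dots> = (\<integral>x. (\<integral>y. f (x, y) \<partial>K x) \<partial>\<mu>)"
    using borel_measurable_integrable[OF i]
  proof (rule integral_cong_AE)
    show "AE x in \<mu>. (\<integral>y. ?p (x, y) \<partial>K x) - (\<integral>y. ?n (x, y) \<partial>K x) = (\<integral>y. f (x, y) \<partial>K x)"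
      using eq by eventually_elim (rule sym)
  qed simp
  finally show "(\<integral>p. f p \<partial>\<pi>) = (\<integral>x. (\<integral>y. f (x, y) \<partial>K x) \<partial>\<mu>)" .
qed

lemma integrable_fst:
  fixes f :: "real \<Rightarrow> real"
  shows "integrable \<mu> f \<Longrightarrow> integrable \<pi> (\<lambda>p. f (fst p))"
  using integrable_distr[OF measurable_fst_snd_\<pi>(1), of f] fst_\<pi> by simp

lemma integrable_snd:
  fixes f :: "real \<Rightarrow> real"
  shows "integrable \<nu> f \<Longrightarrow> integrable \<pi> (\<lambda>p. f (snd p))"
  using integrable_distr[OF measurable_fst_snd_\<pi>(2), of f] snd_\<pi> by simp

lemma integrable_coords[simp]: "integrable \<pi> fst" "integrable \<pi> snd"
  using integrable_fst[OF int_\<mu>] integrable_snd[OF int_\<nu>] by simp_all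

text \<open>The martingale property as it is used later: tested against bounded functions of the
  first coordinate, \<open>snd\<close> may be replaced by \<open>fst\<close>.\<close>

lemma
  assumes [measurable]: "\<alpha> \<in> borel_measurable borel" and \<alpha>: "\<And>x. \<bar>\<alpha> x\<bar> \<le> (B :: real)"
  shows integrable_bounded_fst_snd: "integrable \<pi> (\<lambda>p. \<alpha> (fst p) * snd p)"
    and integral_bounded_fst_snd: "(\<integral>p. \<alpha> (fst p) * snd p \<partial>\<pi>) = (\<integral>x. \<alpha> x * x \<partial>\<mu>)"
proof -
  show i: "integrable \<pi> (\<lambda>p. \<alpha> (fst p) * snd p)"
  proof (rule Bochner_Integration.integrable_bound)
    show "integrable \<pi> (\<lambda>p. B * snd p)" by simp
    show "AE p in \<pi>. norm (\<alpha> (fst p) * snd p) \<le> norm (B * snd p)"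
      using \<alpha> by (intro AE_I2) (auto simp: abs_mult intro!: mult_right_mono order_trans[OF \<alpha>])
  qed simp
  show "(\<integral>p. \<alpha> (fst p) * snd p \<partial>\<pi>) = (\<integral>x. \<alpha> x * x \<partial>\<mu>)"
    unfolding integral_\<pi>(3)[OF i]
    by (rule integral_cong_AE) (simp_all, use mart in \<open>eventually_elim, simp\<close>)
qed

text \<open>Twice the kernel is \<open>\<bar>y - k\<bar> + \<alpha> x * (y - k)\<close>, where
  \<open>\<alpha> x\<close> is 1 for \<open>x \<le> k\<close> and \<open>- 1\<close> otherwise. The
  martingale property replaces \<open>y\<close> by \<open>x\<close> in the second term, which
  becomes \<open>- \<bar>x - k\<bar>\<close>. The integral of the kernel is thus half the gap in
  Jensen's inequality for the fibres over \<open>S\<close>.\<close>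

lemma
  assumes S[measurable]: "S \<in> sets borel"
  shows integrable_segment_kernel_on: "integrable \<pi> (\<lambda>p. indicator S (fst p) * segment_kernel k (fst p) (snd p))"
    and integrable_abs_on: "integrable \<pi> (\<lambda>p. indicator S (fst p) * \<bar>snd p - k\<bar>)"
    and integral_segment_kernel_on:
      "2 * (\<integral>p. indicator S (fst p) * segment_kernel k (fst p) (snd p) \<partial>\<pi>) =
       (\<integral>p. indicator S (fst p) * \<bar>snd p - k\<bar> \<partial>\<pi>) -
       (\<integral>x. indicator S x * \<bar>x - k\<bar> \<partial>\<mu>)"
proof -
  define \<alpha> where "\<alpha> x = indicator S x * (if x \<le> k then 1 else - 1 :: real)" for x
  have [measurable]: "\<alpha> \<in> borel_measurable borel" unfolding \<alpha>_def by measurable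
  have \<alpha>: "\<bar>\<alpha> x\<bar> \<le> 1" for x by (auto simp: \<alpha>_def indicator_def)
  have ic: "integrable \<pi> (\<lambda>p. \<alpha> (fst p))"
    by (rule \<pi>.integrable_const_bound[where B = 1]) (use \<alpha> in auto)
  show i2: "integrable \<pi> (\<lambda>p. indicator S (fst p) * \<bar>snd p - k\<bar>)"
  proof (rule Bochner_Integration.integrable_bound)
    show "integrable \<pi> (\<lambda>p. snd p - k)" by simp
  qed (auto simp: indicator_def)
  note i3 = integrable_bounded_fst_snd[of \<alpha> 1, OF _ \<alpha>, simplified]
  have eq: "indicator S (fst p) * segment_kernel k (fst p) (snd p) =
    (indicator S (fst p) * \<bar>snd p - k\<bar> + (\<alpha> (fst p) * snd p - k * \<alpha> (fst p))) / 2" for p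
    by (auto simp: \<alpha>_def segment_kernel_def indicator_def max_def)
  show "integrable \<pi> (\<lambda>p. indicator S (fst p) * segment_kernel k (fst p) (snd p))"
    unfolding eq using i2 i3 ic by simp
  have "(\<integral>p. \<alpha> (fst p) \<partial>\<pi>) = (\<integral>x. \<alpha> x \<partial>\<mu>)"
    by (subst fst_\<pi>[symmetric], subst integral_distr) auto
  then have "2 * (\<integral>p. indicator S (fst p) * segment_kernel k (fst p) (snd p) \<partial>\<pi>) =
    (\<integral>p. indicator S (fst p) * \<bar>snd p - k\<bar> \<partial>\<pi>) + ((\<integral>x. \<alpha> x * x \<partial>\<mu>) - k * (\<integral>x. \<alpha> x \<partial>\<mu>))"
    unfolding eq using i2 i3 ic by (simp add: integral_bounded_fst_snd[of \<alpha> 1, OF _ \<alpha>])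
  also have "(\<integral>x. \<alpha> x * x \<partial>\<mu>) - k * (\<integral>x. \<alpha> x \<partial>\<mu>) = (\<integral>x. \<alpha> x * x - k * \<alpha> x \<partial>\<mu>)"
  proof (subst Bochner_Integration.integral_diff)
    show "integrable \<mu> (\<lambda>x. \<alpha> x * x)"
      by (rule Bochner_Integration.integrable_bound[OF int_\<mu>]) (use \<alpha> in \<open>auto simp: abs_mult intro!: mult_left_le_one_le\<close>)
    show "integrable \<mu> (\<lambda>x. k * \<alpha> x)"
      by (rule \<mu>.integrable_const_bound[where B = "\<bar>k\<bar>"]) (use \<alpha> in \<open>auto simp: abs_mult intro!: mult_left_le\<close>)
  qed simp
  also have "\<dots> = - (\<integral>x. indicator S x * \<bar>x - k\<bar> \<partial>\<mu>)"
    by (subst Bochner_Integration.integral_minus[symmetric], rule Bochner_Integration.integral_cong)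
      (auto simp: \<alpha>_def indicator_def)
  finally show "2 * (\<integral>p. indicator S (fst p) * segment_kernel k (fst p) (snd p) \<partial>\<pi>) =
       (\<integral>p. indicator S (fst p) * \<bar>snd p - k\<bar> \<partial>\<pi>) - (\<integral>x. indicator S x * \<bar>x - k\<bar> \<partial>\<mu>)"
    by simp
qed

lemma
  shows sets_second_marginal_upto: "sets (second_marginal_upto \<pi> t) = sets borel"
    and integrable_second_marginal_upto: "(f :: real \<Rightarrow> real) \<in> borel_measurable borel \<Longrightarrow>
      integrable (second_marginal_upto \<pi> t) f \<longleftrightarrow> integrable \<pi> (\<lambda>p. indicator {..t} (fst p) * f (snd p))"
    and integral_second_marginal_upto: "(f :: real \<Rightarrow> real) \<in> borel_measurable borel \<Longrightarrow>
      (\<integral>y. f y \<partial>second_marginal_upto \<pi> t) = (\<integral>p. indicator {..t} (fst p) * f (snd p) \<partial>\<pi>)"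
    and finite_first_moment_second_marginal_upto: "finite_first_moment (second_marginal_upto \<pi> t)"
proof -
  have S[measurable]: "{..t} \<times> UNIV \<in> sets \<pi>"
    by (simp add: borel_prod[symmetric])
  then have [simp]: "{..t} \<times> UNIV \<in> sets (borel :: (real \<times> real) measure)" by simp
  have sndm: "snd \<in> borel_measurable (restrict_space \<pi> ({..t} \<times> UNIV))"
    by (rule measurable_restrict_space1) simp
  have ind: "indicat_real ({..t} \<times> UNIV) p = indicator {..t} (fst p)" for p :: "real \<times> real"
    by (cases p) (auto simp: indicator_def)
  show sets: "sets (second_marginal_upto \<pi> t) = sets borel"
    by (simp add: second_marginal_upto_def)
  show int: "integrable (second_marginal_upto \<pi> t) f \<longleftrightarrow> integrable \<pi> (\<lambda>p. indicator {..t} (fst p) * f (snd p))"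
    if "f \<in> borel_measurable borel" for f :: "real \<Rightarrow> real"
    unfolding second_marginal_upto_def using that
    by (subst integrable_distr_eq[OF sndm]) (auto simp: integrable_restrict_space ind)
  show "(\<integral>y. f y \<partial>second_marginal_upto \<pi> t) = (\<integral>p. indicator {..t} (fst p) * f (snd p) \<partial>\<pi>)"
    if "f \<in> borel_measurable borel" for f :: "real \<Rightarrow> real"
    unfolding second_marginal_upto_def using that
    by (subst integral_distr[OF sndm]) (auto simp: integral_restrict_space ind)
  have "finite_measure (second_marginal_upto \<pi> t)"
    unfolding second_marginal_upto_def
    by (intro finite_measure.finite_measure_distr sndm finite_measure_restrict_space) (auto intro: \<pi>.finite_measure)
  moreover have "integrable (second_marginal_upto \<pi> t) (\<lambda>x. x)"
    by (subst int) (auto intro!: integrable_bounded_fst_snd[where B = 1] simp: indicator_def)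
  ultimately show "finite_first_moment (second_marginal_upto \<pi> t)"
    by (simp add: finite_first_moment_def sets)
qed

end

section \<open>Left-monotone plans minimize potentials\<close>

definition potential :: "(real \<times> real) measure \<Rightarrow> real \<Rightarrow> real \<Rightarrow> real" where
  "potential \<pi> t k = (\<integral>p. indicator {..t} (fst p) * \<bar>snd p - k\<bar> \<partial>\<pi>)"

lemma martingale_plansE:
  assumes "prob_space \<mu>" "sets \<mu> = sets borel" "convex_order \<mu> \<nu>" "\<pi> \<in> martingale_plans \<mu> \<nu>"
  obtains K where "martingale_kernel \<mu> \<nu> \<pi> K"
  using assms unfolding martingale_plans_def martingale_kernel_def convex_order_def finite_first_moment_def
  by blast

context martingale_kernel
begin

lemma potential_eq:
  "potential \<pi> t k = 2 * (\<integral>p. indicator {..t} (fst p) * segment_kernel k (fst p) (snd p) \<partial>\<pi>) +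
    (\<integral>x. indicator {..t} x * \<bar>x - k\<bar> \<partial>\<mu>)"
  using integral_segment_kernel_on[of "{..t}" k] by (simp add: potential_def)

lemma potential_lipschitz: "\<bar>potential \<pi> t k - potential \<pi> t l\<bar> \<le> \<bar>k - l\<bar>"
proof -
  have "potential \<pi> t k - potential \<pi> t l =
    (\<integral>p. indicator {..t} (fst p) * \<bar>snd p - k\<bar> - indicator {..t} (fst p) * \<bar>snd p - l\<bar> \<partial>\<pi>)"
    by (simp add: potential_def integrable_abs_on)
  also have "norm \<dots> \<le> (\<integral>p. \<bar>k - l\<bar> \<partial>\<pi>)"
    by (rule Bochner_Integration.integral_norm_bound_integral)
      (intro Bochner_Integration.integrable_diff integrable_abs_on, auto simp: indicator_def)
  finally show ?thesis by (simp add: \<pi>.prob_space[simplified])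
qed

lemma potential_mu_le: "(\<integral>x. indicator {..t} x * \<bar>x - k\<bar> \<partial>\<mu>) \<le> potential \<pi> t k"
  unfolding potential_eq by (simp add: segment_kernel_nonneg)

text \<open>The kernel vanishes once \<open>\<bar>k\<bar>\<close> exceeds
  \<open>\<bar>x\<bar>\<close> and \<open>\<bar>y\<bar>\<close>, and it never exceeds
  \<open>\<bar>y - x\<bar>\<close>. Hence the potential approaches Jensen's lower bound at both ends
  of the line.\<close>

lemma segment_integral_tendsto_0:
  assumes "filterlim (\<lambda>n :: real. \<bar>s n\<bar>) at_top at_top" and [measurable]: "S \<in> sets borel"
  shows "((\<lambda>n. \<integral>p. indicator S (fst p) * segment_kernel (s n) (fst p) (snd p) \<partial>\<pi>) \<longlongrightarrow> 0) at_top"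
proof -
  have "((\<lambda>n. \<integral>p. indicator S (fst p) * segment_kernel (s n) (fst p) (snd p) \<partial>\<pi>) \<longlongrightarrow> (\<integral>p. 0 \<partial>\<pi>)) at_top"
  proof (rule integral_dominated_convergence_at_top[where w = "\<lambda>p. \<bar>snd p - fst p\<bar>"])
    show "AE p in \<pi>. ((\<lambda>n. indicator S (fst p) * segment_kernel (s n) (fst p) (snd p)) \<longlongrightarrow> 0) at_top"
    proof (rule AE_I2)
      fix p :: "real \<times> real"
      have "eventually (\<lambda>n. \<bar>fst p\<bar> + \<bar>snd p\<bar> + 1 \<le> \<bar>s n\<bar>) at_top"
        using assms(1) unfolding filterlim_at_top by blast
      then have "eventually (\<lambda>n. indicator S (fst p) * segment_kernel (s n) (fst p) (snd p) = 0) at_top"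
        by eventually_elim (auto simp: segment_kernel_def max_def)
      then show "((\<lambda>n. indicator S (fst p) * segment_kernel (s n) (fst p) (snd p)) \<longlongrightarrow> 0) at_top"
        by (rule tendsto_eventually)
    qed
  qed (auto intro!: always_eventually simp: segment_kernel_def indicator_def)
  then show ?thesis by simp
qed

text \<open>A nonnegative function with nonpositive integral vanishes almost everywhere. So a fibre
  on one side of \<open>k\<close> whose mean is not strictly on that side sits at \<open>k\<close>;
  \<open>\<sigma>\<close> selects the side.\<close>

lemma integral_nonneg_part_zero:
  assumes "integrable (K x) (\<lambda>y. y)" "(\<integral>y. y \<partial>K x) = x"
    and sgn: "\<sigma> = 1 \<or> \<sigma> = (- 1 :: real)"
    and ae: "AE y in K x. 0 \<le> \<sigma> * (y - k)" and le: "\<sigma> * (x - k) \<le> 0"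
  shows "AE y in K x. y = k"
proof -
  have i: "integrable (K x) (\<lambda>y. \<sigma> * (y - k))" using assms(1) by simp
  have "(\<integral>y. \<sigma> * (y - k) \<partial>K x) = \<sigma> * (x - k)"
    using assms(1,2) by (simp add: K.prob_space[simplified])
  then have "(\<integral>y. \<sigma> * (y - k) \<partial>K x) = 0"
    using le integral_nonneg_AE[OF ae] by linarith
  then have "AE y in K x. \<sigma> * (y - k) = 0"
    using integral_nonneg_eq_0_iff_AE[OF i ae] by simp
  then show ?thesis by eventually_elim (use sgn in auto)
qed

text \<open>\<open>U\<close> is the union of the open hulls of the fibres over \<open>{..t}\<close>. Off \<open>U\<close> the potential of \<open>\<pi>\<close> attains
  the lower bound that Jensen's inequality gives for every plan. On \<open>U\<close> the plan \<open>\<pi>\<close> has already used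
  all of \<open>\<nu>\<close>, so the difference \<open>D\<close> of the potentials is concave there. Hence the rightmost minimizer
  of \<open>D\<close> cannot have a negative value.\<close>

lemma left_monotone_potential_le:
  assumes lm: "left_monotone \<pi>" and P': "martingale_kernel \<mu> \<nu> \<pi>' K'"
  shows "potential \<pi> t k0 \<le> potential \<pi>' t k0"
proof (rule ccontr)
  interpret P': martingale_kernel \<mu> \<nu> \<pi>' K' by fact
  obtain \<Gamma> where \<Gamma>[measurable]: "\<Gamma> \<in> sets borel" and full: "emeasure \<pi> \<Gamma> = 1"
    and mono: "\<And>x y1 y2 x' y'. (x, y1) \<in> \<Gamma> \<Longrightarrow> (x, y2) \<in> \<Gamma> \<Longrightarrow> (x', y') \<in> \<Gamma> \<Longrightarrow>
      \<not> (x < x' \<and> y1 < y' \<and> y' < y2)"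
    using lm unfolding left_monotone_def by blast
  have ae\<Gamma>: "AE p in \<pi>. p \<in> \<Gamma>"
    using full by (intro \<pi>.AE_prob_1) (simp add: \<pi>.emeasure_eq_measure)
  then have aeK: "AE x in \<mu>. AE y in K x. (x, y) \<in> \<Gamma>"
    by (subst (asm) AE_\<pi>) auto
  define V where "V = potential \<pi> t"
  define V' where "V' = potential \<pi>' t"
  define D where "D k = V' k - V k" for k
  define U where "U = {k. \<exists>x y1 y2. x \<le> t \<and> (x, y1) \<in> \<Gamma> \<and> (x, y2) \<in> \<Gamma> \<and> y1 < k \<and> k < y2}"
  assume "\<not> potential \<pi> t k0 \<le> potential \<pi>' t k0"
  then have neg: "D k0 < 0" by (simp add: D_def V_def V'_def)

  have outside: "D k \<ge> 0" if k: "k \<notin> U" for k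
  proof -
    have "AE x in \<mu>. AE y in K x. indicator {..t} x * segment_kernel k x y = 0"
      using aeK mart
    proof eventually_elim
      case (elim x)
      show ?case
      proof (cases "x \<le> t")
        case True
        \<comment> \<open>Since \<open>k\<close> is outside the hull of the fibre, the fibre lies on
          one side of \<open>k\<close>. If \<open>x\<close> is on that side, \<open>k\<close> does
          not separate \<open>x\<close> from \<open>y\<close>; otherwise the fibre sits at
          \<open>k\<close>. The kernel vanishes either way.\<close>
        have side: "(\<forall>y. (x, y) \<in> \<Gamma> \<longrightarrow> y \<le> k) \<or> (\<forall>y. (x, y) \<in> \<Gamma> \<longrightarrow> k \<le> y)"
          using k True unfolding U_def by (smt (verit) mem_Collect_eq)
        then consider "AE y in K x. y \<le> k" | "AE y in K x. k \<le> y"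
          using elim by (elim disjE) (metis (mono_tags, lifting) eventually_mono)+
        then show ?thesis
        proof cases
          case 1
          show ?thesis
          proof (cases "x \<le> k")
            case True
            show ?thesis using 1 by eventually_elim (use True in \<open>simp add: segment_kernel_def\<close>)
          next
            case False
            have "AE y in K x. y = k"
              by (rule integral_nonneg_part_zero[of x "- 1"]) (use elim False 1 in auto)
            then show ?thesis by eventually_elim (simp add: segment_kernel_def)
          qed
        next
          case 2
          show ?thesis
          proof (cases "x \<le> k")
            case False
            show ?thesis using 2 by eventually_elim (use False in \<open>simp add: segment_kernel_def\<close>)
          next
            case True
            have "AE y in K x. y = k"
              by (rule integral_nonneg_part_zero[of x 1]) (use elim True 2 in auto)
            then show ?thesis by eventually_elim (simp add: segment_kernel_def)
          qed
        qed
      qed simp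
    qed
    then have "AE p in \<pi>. indicator {..t} (fst p) * segment_kernel k (fst p) (snd p) = 0"
      by (subst AE_\<pi>) auto
    then have "(\<integral>p. indicator {..t} (fst p) * segment_kernel k (fst p) (snd p) \<partial>\<pi>) = 0"
      by (rule integral_eq_zero_AE)
    then show ?thesis
      using P'.potential_mu_le[of t k] by (simp add: D_def V_def V'_def potential_eq)
  qed

  have inside: "\<exists>e>0. D (k - e) + D (k + e) \<le> 2 * D k" if k: "k \<in> U" for k
  proof -
    obtain x y1 y2 where xy: "x \<le> t" "(x, y1) \<in> \<Gamma>" "(x, y2) \<in> \<Gamma>" "y1 < k" "k < y2"
      using k by (auto simp: U_def)
    \<comment> \<open>The largest \<open>e\<close> for which \<open>k - e\<close> and
      \<open>k + e\<close> stay in \<open>{y1..y2}\<close>. The second difference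
      \<open>\<psi>\<close> of the absolute value is a tent between these points, and its integrals
      are the second differences of the potentials.\<close>
    define e where "e = min (k - y1) (y2 - k)"
    define \<psi> where "\<psi> y = \<bar>y - (k - e)\<bar> + \<bar>y - (k + e)\<bar> - 2 * \<bar>y - k\<bar>" for y
    have e: "0 < e" using xy by (simp add: e_def)
    have [measurable]: "\<psi> \<in> borel_measurable borel" unfolding \<psi>_def by measurable
    have \<psi>0: "0 \<le> \<psi> y" for y
      using abs_triangle_ineq[of "y - (k - e)" "y - (k + e)"] abs_mult[of 2 "y - k"]
      by (simp add: \<psi>_def algebra_simps)
    have \<psi>i: "y1 < y \<and> y < y2" if "\<psi> y \<noteq> 0" for y
    proof (rule ccontr)
      assume "\<not> (y1 < y \<and> y < y2)"
      then have "y \<le> k - e \<or> k + e \<le> y" by (auto simp: e_def min_def)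
      then have "\<psi> y = 0" using e by (auto simp: \<psi>_def)
      then show False using that by simp
    qed
    interpret N: prob_space \<nu>
      using \<pi>.prob_space_distr[of snd borel] by (simp add: snd_\<pi>)
    have sets\<nu>[measurable_cong]: "sets \<nu> = sets borel" using sets_distr[of \<pi> borel snd] by (simp add: snd_\<pi>)
    have i\<nu>: "integrable \<nu> \<psi>" unfolding \<psi>_def using int_\<nu> by simp
    have comb: "potential Q t (k - e) + potential Q t (k + e) - 2 * potential Q t k =
        (\<integral>p. indicator {..t} (fst p) * \<psi> (snd p) \<partial>Q)"
      if "martingale_kernel \<mu> \<nu> Q L" for Q L
    proof -
      interpret Q: martingale_kernel \<mu> \<nu> Q L by fact
      have "indicator {..t} (fst p) * \<psi> (snd p) = indicator {..t} (fst p) * \<bar>snd p - (k - e)\<bar> +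
        indicator {..t} (fst p) * \<bar>snd p - (k + e)\<bar> - 2 * (indicator {..t} (fst p) * \<bar>snd p - k\<bar>)" for p :: "real \<times> real"
        by (simp add: \<psi>_def algebra_simps)
      then show ?thesis
        unfolding potential_def by (simp add: Q.integrable_abs_on)
    qed
    have all: "(\<integral>p. \<psi> (snd p) \<partial>Q) = (\<integral>y. \<psi> y \<partial>\<nu>)" if "martingale_kernel \<mu> \<nu> Q L" for Q L
    proof -
      interpret Q: martingale_kernel \<mu> \<nu> Q L by fact
      show ?thesis by (subst Q.snd_\<pi>[symmetric], subst integral_distr) auto
    qed
    have "(\<integral>p. indicator {..t} (fst p) * \<psi> (snd p) \<partial>\<pi>') \<le> (\<integral>p. \<psi> (snd p) \<partial>\<pi>')"
      by (rule integral_mono_AE')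
        (use P'.integrable_snd[OF i\<nu>] \<psi>0 in \<open>auto simp: indicator_def\<close>)
    also have "\<dots> = (\<integral>p. \<psi> (snd p) \<partial>\<pi>)"
      using all[OF P'] all[OF martingale_kernel_axioms] by simp
    \<comment> \<open>A point of \<open>\<Gamma>\<close> with first coordinate beyond
      \<open>t\<close> lies over some \<open>x' > x\<close>, so left-monotonicity keeps it out of
      the interval where \<open>\<psi>\<close> is positive. For \<open>\<pi>\<close> the restriction
      to \<open>{..t}\<close> therefore loses nothing, whereas for \<open>\<pi>'\<close> it may lose
      something.\<close>
    also have "\<dots> = (\<integral>p. indicator {..t} (fst p) * \<psi> (snd p) \<partial>\<pi>)"
    proof (rule integral_cong_AE)
      show "AE p in \<pi>. \<psi> (snd p) = indicator {..t} (fst p) * \<psi> (snd p)"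
        using ae\<Gamma>
      proof eventually_elim
        case (elim p)
        show ?case
        proof (cases "fst p \<le> t")
          case False
          then have "x < fst p" using xy by simp
          then have "\<not> (y1 < snd p \<and> snd p < y2)"
            using mono[OF xy(2,3), of "fst p" "snd p"] elim by simp
          then show ?thesis using \<psi>i by fastforce
        qed simp
      qed
    qed measurable
    finally have "potential \<pi>' t (k - e) + potential \<pi>' t (k + e) - 2 * potential \<pi>' t k
      \<le> potential \<pi> t (k - e) + potential \<pi> t (k + e) - 2 * potential \<pi> t k"
      unfolding comb[OF P'] comb[OF martingale_kernel_axioms] .
    then have "D (k - e) + D (k + e) \<le> 2 * D k"
      unfolding D_def V_def V'_def by argo
    then show ?thesis using e by blast
  qed

  have cont: "continuous_on UNIV D"
  proof -
    have "2-lipschitz_on UNIV D"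
    proof (rule lipschitz_onI)
      fix k l :: real
      show "dist (D k) (D l) \<le> 2 * dist k l"
        using potential_lipschitz[of t k l] P'.potential_lipschitz[of t k l]
          abs_triangle_ineq4[of "V' k - V' l" "V k - V l"]
        unfolding D_def V_def V'_def dist_real_def by argo
    qed simp
    then show ?thesis by (rule lipschitz_on_continuous_on)
  qed

  \<comment> \<open>Far out, \<open>V\<close> is close to Jensen's lower bound, which also bounds
    \<open>V'\<close> from below. So values of \<open>D\<close> as low as \<open>D k0\<close> occur
    only in a bounded set.\<close>
  have far: "\<exists>N. \<forall>k\<ge>N. D k0 < D (\<sigma> * k)" if \<sigma>: "\<sigma> = 1 \<or> \<sigma> = - 1" for \<sigma>
  proof -
    let ?R = "\<lambda>k. \<integral>p. indicator {..t} (fst p) * segment_kernel (\<sigma> * k) (fst p) (snd p) \<partial>\<pi>"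
    have "(?R \<longlongrightarrow> 0) at_top"
      by (rule segment_integral_tendsto_0) (use \<sigma> in \<open>auto simp: filterlim_abs_real\<close>)
    then have "eventually (\<lambda>k. ?R k < - D k0 / 2) at_top"
      by (rule order_tendstoD) (use neg in simp)
    then obtain N where N: "\<And>k. k \<ge> N \<Longrightarrow> ?R k < - D k0 / 2"
      by (auto simp: eventually_at_top_linorder)
    have "D k0 < D (\<sigma> * k)" if "k \<ge> N" for k
      using N[OF that] P'.potential_mu_le[of t "\<sigma> * k"]
      unfolding D_def V_def V'_def potential_eq[of t "\<sigma> * k"] by argo
    then show ?thesis by blast
  qed
  obtain N1 N2 where N: "\<And>k. k \<ge> N1 \<Longrightarrow> D k0 < D k" "\<And>k. k \<ge> N2 \<Longrightarrow> D k0 < D (- k)"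
    using far[of 1] far[of "- 1"] by auto

  define S where "S = {k. D k \<le> D k0}"
  have "closed S" unfolding S_def
    using cont by (intro closed_Collect_le) auto
  moreover have "S \<subseteq> {- N2..N1}"
  proof
    fix k assume "k \<in> S"
    then show "k \<in> {- N2..N1}" using N(1)[of k] N(2)[of "- k"] by (force simp: S_def)
  qed
  then have "bounded S" by (rule bounded_subset[rotated]) auto
  ultimately have "compact S" by (simp add: compact_eq_bounded_closed)
  moreover have "S \<noteq> {}" by (auto simp: S_def)
  ultimately obtain m where m: "m \<in> S" "\<And>k. k \<in> S \<Longrightarrow> D m \<le> D k"
    using continuous_attains_inf[of S D] cont continuous_on_subset by blast
  have glob: "D m \<le> D k" for k
  proof (cases "k \<in> S")
    case False
    then show ?thesis using m(1) by (simp add: S_def)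
  qed (rule m)
  define T where "T = {k. D k \<le> D m}"
  have "closed T" unfolding T_def
    using cont by (intro closed_Collect_le) auto
  moreover have "T \<subseteq> S" using m(1) by (auto simp: T_def S_def)
  ultimately have "compact T" using \<open>compact S\<close> by (metis compact_Int_closed inf.absorb_iff2)
  moreover have "m \<in> T" by (simp add: T_def)
  ultimately obtain k where k: "k \<in> T" "\<And>l. l \<in> T \<Longrightarrow> l \<le> k"
    using compact_attains_sup[of T] by blast
  have "D k = D m" using glob[of k] k(1) by (simp add: T_def)
  moreover have "k \<in> U"
    using outside[of k] neg m(1) \<open>D k = D m\<close> by (force simp: S_def)
  then obtain e where e: "0 < e" "D (k - e) + D (k + e) \<le> 2 * D k" using inside by blast
  \<comment> \<open>\<open>D (k - e)\<close> is not below the minimum, so by concavity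
    \<open>D (k + e)\<close> is not above it: a minimizer further to the right.\<close>
  ultimately have "D (k + e) \<le> D m" using glob[of "k - e"] by linarith
  then have "k + e \<le> k" by (intro k(2)) (simp add: T_def)
  then show False using e by simp
qed

text \<open>Both measures have mass \<open>measure \<mu> {..t}\<close> and, by the martingale
  property, the first moment of \<open>\<mu>\<close> over \<open>{..t}\<close>. So potentials decide
  the convex order.\<close>

lemma convex_order_second_marginal_upto:
  assumes P': "martingale_kernel \<mu> \<nu> \<pi>' K'"
  shows "convex_order (second_marginal_upto \<pi> t) (second_marginal_upto \<pi>' t) \<longleftrightarrow>
    (\<forall>k. potential \<pi> t k \<le> potential \<pi>' t k)"
proof -
  interpret P': martingale_kernel \<mu> \<nu> \<pi>' K' by fact
  have pot: "potential Q t k = (\<integral>y. \<bar>y - k\<bar> \<partial>second_marginal_upto Q t)"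
    "integrable (second_marginal_upto Q t) (\<lambda>y. \<bar>y - k\<bar>)"
    "measure (second_marginal_upto Q t) UNIV = measure \<mu> {..t}"
    "(\<integral>y. y \<partial>second_marginal_upto Q t) = (\<integral>x. indicator {..t} x * x \<partial>\<mu>)"
    if "martingale_kernel \<mu> \<nu> Q L" for Q L k
  proof -
    interpret Q: martingale_kernel \<mu> \<nu> Q L by fact
    show "potential Q t k = (\<integral>y. \<bar>y - k\<bar> \<partial>second_marginal_upto Q t)"
      by (simp add: potential_def Q.integral_second_marginal_upto)
    show "integrable (second_marginal_upto Q t) (\<lambda>y. \<bar>y - k\<bar>)"
      by (simp add: Q.integrable_second_marginal_upto Q.integrable_abs_on)
    have "measure (second_marginal_upto Q t) UNIV = (\<integral>y. 1 \<partial>second_marginal_upto Q t)"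
      using sets_eq_imp_space_eq[OF Q.sets_second_marginal_upto[of t]] by simp
    also have "\<dots> = (\<integral>p. indicator {..t} (fst p) \<partial>Q)"
      using Q.integral_second_marginal_upto[of "\<lambda>_. 1" t] by simp
    also have "\<dots> = (\<integral>x. indicator {..t} x \<partial>\<mu>)"
      by (subst Q.fst_\<pi>[symmetric], subst integral_distr) auto
    finally show "measure (second_marginal_upto Q t) UNIV = measure \<mu> {..t}" by simp
    show "(\<integral>y. y \<partial>second_marginal_upto Q t) = (\<integral>x. indicator {..t} x * x \<partial>\<mu>)"
      using Q.integral_bounded_fst_snd[of "indicator {..t}" 1]
      by (simp add: Q.integral_second_marginal_upto)
  qed
  have ext: "ext_integral M f = ereal (\<integral>y. f y \<partial>M)" if "integrable M f" for M :: "real measure" and f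
    using ext_integral_add_nonneg[OF that, of "\<lambda>_. 0"] by (simp add: zero_ennreal.rep_eq)
  show ?thesis
  proof
    assume co: "convex_order (second_marginal_upto \<pi> t) (second_marginal_upto \<pi>' t)"
    show "\<forall>k. potential \<pi> t k \<le> potential \<pi>' t k"
    proof
      fix k
      have "convex_on UNIV (\<lambda>y :: real. \<bar>y - k\<bar>)"
        using convex_on_dist[of UNIV k] by (simp add: dist_real_def abs_minus_commute)
      then have "ext_integral (second_marginal_upto \<pi> t) (\<lambda>y. \<bar>y - k\<bar>)
          \<le> ext_integral (second_marginal_upto \<pi>' t) (\<lambda>y. \<bar>y - k\<bar>)"
        using co by (simp add: convex_order_def)
      then show "potential \<pi> t k \<le> potential \<pi>' t k"
        using pot(1,2)[OF P'] pot(1,2)[OF martingale_kernel_axioms] by (simp add: ext)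
    qed
  next
    assume "\<forall>k. potential \<pi> t k \<le> potential \<pi>' t k"
    then show "convex_order (second_marginal_upto \<pi> t) (second_marginal_upto \<pi>' t)"
      using pot[OF P'] pot[OF martingale_kernel_axioms]
      by (intro convex_order_of_potentials finite_first_moment_second_marginal_upto
          P'.finite_first_moment_second_marginal_upto) simp_all
  qed
qed

end

section \<open>Cost of plans with minimal potentials\<close>

text \<open>Superlevel sets of a nonincreasing function are down-sets and may or may not contain
  their end point, whereas potentials speak of \<open>{..t}\<close>.\<close>

lemma downset_cases:
  fixes S :: "real set"
  assumes "\<And>x y. x \<in> S \<Longrightarrow> y \<le> x \<Longrightarrow> y \<in> S"
  obtains "S = {}" | "S = UNIV" | t where "S = {..t}" | t where "S = {..<t}"
proof (cases "S \<noteq> {} \<and> S \<noteq> UNIV")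
  case True
  then obtain u where u: "u \<notin> S" by auto
  have bdd: "bdd_above S"
    by (rule bdd_aboveI[of _ u]) (use assms u in \<open>meson linear\<close>)
  have lt: "x \<in> S" if "x < Sup S" for x
    using that less_cSupD[of S x] True assms by (meson less_imp_le)
  have le: "x \<le> Sup S" if "x \<in> S" for x using cSup_upper[OF that bdd] .
  show ?thesis
  proof (cases "Sup S \<in> S")
    case True
    then have "S = {..Sup S}" using lt le by (auto simp: le_less)
    then show ?thesis by (rule that(3))
  next
    case False
    then have "S = {..<Sup S}" using lt le by (auto simp: less_le)
    then show ?thesis by (rule that(4))
  qed
qed (use that in blast)

section \<open>Comparison of mixtures of segment kernels\<close>

context martingale_kernel
begin

text \<open>By \<open>integral_segment_kernel_on\<close> with \<open>S = UNIV\<close>, the two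
  marginals determine this integral.\<close>

lemma segment_integral_UNIV:
  assumes P': "martingale_kernel \<mu> \<nu> \<pi>' K'"
  shows "(\<integral>p. segment_kernel k (fst p) (snd p) \<partial>\<pi>) = (\<integral>p. segment_kernel k (fst p) (snd p) \<partial>\<pi>')"
proof -
  interpret P': martingale_kernel \<mu> \<nu> \<pi>' K' by fact
  have "(\<integral>p. \<bar>snd p - k\<bar> \<partial>\<pi>) = (\<integral>y. \<bar>y - k\<bar> \<partial>\<nu>)"
    by (subst snd_\<pi>[symmetric], subst integral_distr) auto
  moreover have "(\<integral>p. \<bar>snd p - k\<bar> \<partial>\<pi>') = (\<integral>y. \<bar>y - k\<bar> \<partial>\<nu>)"
    by (subst P'.snd_\<pi>[symmetric], subst integral_distr) auto
  ultimately show ?thesis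
    using integral_segment_kernel_on[of UNIV k] P'.integral_segment_kernel_on[of UNIV k] by simp
qed

lemma segment_integral_downset_mono:
  assumes P': "martingale_kernel \<mu> \<nu> \<pi>' K'"
    and pot: "\<And>t k. potential \<pi> t k \<le> potential \<pi>' t k"
    and S: "\<And>x y. x \<in> S \<Longrightarrow> y \<le> x \<Longrightarrow> y \<in> S"
  shows "(\<integral>p. indicator S (fst p) * segment_kernel k (fst p) (snd p) \<partial>\<pi>)
    \<le> (\<integral>p. indicator S (fst p) * segment_kernel k (fst p) (snd p) \<partial>\<pi>')"
proof -
  interpret P': martingale_kernel \<mu> \<nu> \<pi>' K' by fact
  have closed: "(\<integral>p. indicator {..t} (fst p) * segment_kernel k (fst p) (snd p) \<partial>\<pi>)
    \<le> (\<integral>p. indicator {..t} (fst p) * segment_kernel k (fst p) (snd p) \<partial>\<pi>')" for t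
    using pot[of t k] by (simp add: potential_eq P'.potential_eq)
  show ?thesis
  proof (rule downset_cases[of S])
    show "y \<in> S" if "x \<in> S" "y \<le> x" for x y using that by (rule S)
    show ?thesis if "S = {}" using that by simp
    show ?thesis if "S = UNIV" using segment_integral_UNIV[OF P', of k] that by simp
    show ?thesis if "S = {..t}" for t using closed[of t] that by simp
    fix t assume 4: "S = {..<t}"
    \<comment> \<open>An open half-line is the increasing limit of closed ones. With
      \<open>n\<close> instead of \<open>Suc n\<close> the first set would be \<open>{..t}\<close>,
      because division by 0 gives 0.\<close>
    have lim: "(\<lambda>n. \<integral>p. indicator {..t - 1 / real (Suc n)} (fst p) * segment_kernel k (fst p) (snd p) \<partial>Q)
      \<longlonglongrightarrow> (\<integral>p. indicator {..<t} (fst p) * segment_kernel k (fst p) (snd p) \<partial>Q)"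
      if "martingale_kernel \<mu> \<nu> Q L" for Q L
    proof -
      interpret Q: martingale_kernel \<mu> \<nu> Q L by fact
      show ?thesis
      proof (rule integral_dominated_convergence[where w = "\<lambda>p. segment_kernel k (fst p) (snd p)"])
        show "integrable Q (\<lambda>p. segment_kernel k (fst p) (snd p))"
          using Q.integrable_segment_kernel_on[of UNIV k] by simp
        show "AE p in Q. (\<lambda>n. indicator {..t - 1 / real (Suc n)} (fst p) * segment_kernel k (fst p) (snd p))
          \<longlonglongrightarrow> indicator {..<t} (fst p) * segment_kernel k (fst p) (snd p)"
        proof (rule AE_I2)
          fix p :: "real \<times> real"
          have "eventually (\<lambda>n. indicator {..t - 1 / real (Suc n)} (fst p) = (indicator {..<t} (fst p) :: real)) sequentially"
          proof (cases "fst p < t")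
            case True
            have "(\<lambda>n. t - 1 / real (Suc n)) \<longlonglongrightarrow> t" by real_asymp
            then have "eventually (\<lambda>n. fst p < t - 1 / real (Suc n)) sequentially"
              using True by (rule order_tendstoD)
            then show ?thesis by eventually_elim (use True in auto)
          next
            case False
            have "t - 1 / real (Suc n) < fst p" for n
              using False by (smt (verit) of_nat_0_less_iff zero_less_Suc zero_less_divide_1_iff)
            then show ?thesis using False by (auto simp: indicator_def not_le)
          qed
          then have "eventually (\<lambda>n. indicator {..t - 1 / real (Suc n)} (fst p) * segment_kernel k (fst p) (snd p)
             = indicator {..<t} (fst p) * segment_kernel k (fst p) (snd p)) sequentially"
            by eventually_elim simp
          then show "(\<lambda>n. indicator {..t - 1 / real (Suc n)} (fst p) * segment_kernel k (fst p) (snd p))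
            \<longlonglongrightarrow> indicator {..<t} (fst p) * segment_kernel k (fst p) (snd p)"
            by (rule tendsto_eventually)
        qed
      qed (auto simp: indicator_def segment_kernel_nonneg)
    qed
    show ?thesis unfolding 4
      by (rule LIMSEQ_le[OF lim[OF martingale_kernel_axioms] lim[OF P']]) (use closed in blast)
  qed
qed

text \<open>The complement is a down-set, and the integrals over the whole line agree for the two
  plans, which reverses the inequality.\<close>

lemma segment_integral_upset_mono:
  assumes P': "martingale_kernel \<mu> \<nu> \<pi>' K'"
    and pot: "\<And>t k. potential \<pi> t k \<le> potential \<pi>' t k"
    and S: "\<And>x y. x \<in> S \<Longrightarrow> x \<le> y \<Longrightarrow> y \<in> S" and [measurable]: "S \<in> sets borel"
  shows "(\<integral>p. indicator S (fst p) * segment_kernel k (fst p) (snd p) \<partial>\<pi>')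
    \<le> (\<integral>p. indicator S (fst p) * segment_kernel k (fst p) (snd p) \<partial>\<pi>)"
proof -
  interpret P': martingale_kernel \<mu> \<nu> \<pi>' K' by fact
  have compl: "(\<integral>p. indicator S (fst p) * segment_kernel k (fst p) (snd p) \<partial>Q) =
      (\<integral>p. segment_kernel k (fst p) (snd p) \<partial>Q) -
      (\<integral>p. indicator (- S) (fst p) * segment_kernel k (fst p) (snd p) \<partial>Q)"
    if "martingale_kernel \<mu> \<nu> Q L" for Q L
  proof -
    interpret Q: martingale_kernel \<mu> \<nu> Q L by fact
    have "(\<integral>p. indicator S (fst p) * segment_kernel k (fst p) (snd p) \<partial>Q) =
        (\<integral>p. segment_kernel k (fst p) (snd p) - indicator (- S) (fst p) * segment_kernel k (fst p) (snd p) \<partial>Q)"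
      by (rule Bochner_Integration.integral_cong) (auto simp: indicator_def)
    then show ?thesis
      using Q.integrable_segment_kernel_on[of UNIV k]
      by (simp add: Q.integrable_segment_kernel_on del: indicator_simps)
  qed
  have "(\<integral>p. indicator (- S) (fst p) * segment_kernel k (fst p) (snd p) \<partial>\<pi>)
    \<le> (\<integral>p. indicator (- S) (fst p) * segment_kernel k (fst p) (snd p) \<partial>\<pi>')"
    by (rule segment_integral_downset_mono[OF P' pot]) (use S in blast)
  then show ?thesis
    using segment_integral_UNIV[OF P', of k]
    unfolding compl[OF P'] compl[OF martingale_kernel_axioms] by simp
qed

text \<open>After the substitution \<open>k \<mapsto> k - x\<close> the kernel has the same pole
  \<open>k\<close> for all fibres, and \<open>x\<close> enters the weight \<open>f (k - x)\<close>.
  Layer cake in the values of \<open>f\<close> leaves, for each \<open>k\<close> and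
  \<open>r\<close>, an integral over \<open>{x. r < f (k - x)}\<close>, which is a down-set or an
  up-set when \<open>f\<close> is monotone.\<close>

lemma nn_integral_segment_mono:
  assumes P: "martingale_kernel \<mu> \<nu> \<pi>1 K1" and P': "martingale_kernel \<mu> \<nu> \<pi>2 K2"
    and [measurable]: "f \<in> borel_measurable borel"
    and le: "\<And>k r. 0 \<le> r \<Longrightarrow> (\<integral>p. indicator {x. r < f (k - x)} (fst p) * segment_kernel k (fst p) (snd p) \<partial>\<pi>1)
      \<le> (\<integral>p. indicator {x. r < f (k - x)} (fst p) * segment_kernel k (fst p) (snd p) \<partial>\<pi>2)"
  shows "(\<integral>\<^sup>+p. (\<integral>\<^sup>+k. ennreal (segment_kernel k 0 (snd p - fst p)) * ennreal (f k) \<partial>lborel) \<partial>\<pi>1)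
    \<le> (\<integral>\<^sup>+p. (\<integral>\<^sup>+k. ennreal (segment_kernel k 0 (snd p - fst p)) * ennreal (f k) \<partial>lborel) \<partial>\<pi>2)"
proof -
  have shift: "(\<integral>\<^sup>+k. ennreal (segment_kernel k 0 (y - x)) * ennreal (f k) \<partial>lborel) =
    (\<integral>\<^sup>+k. ennreal (segment_kernel k x y) * ennreal (f (k - x)) \<partial>lborel)" for x y
    by (subst (2) nn_integral_real_affine[where c = 1 and t = x]) (auto simp: segment_kernel_shift)
  interpret P: martingale_kernel \<mu> \<nu> \<pi>1 K1 by fact
  interpret P': martingale_kernel \<mu> \<nu> \<pi>2 K2 by fact
  have eq: "(\<integral>\<^sup>+p. (\<integral>\<^sup>+k. ennreal (segment_kernel k 0 (snd p - fst p)) * ennreal (f k) \<partial>lborel) \<partial>Q) =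
    (\<integral>\<^sup>+q. ennreal (segment_kernel (snd q) (fst (fst q)) (snd (fst q))) * ennreal (f (snd q - fst (fst q))) \<partial>(Q \<Otimes>\<^sub>M lborel))"
    if "martingale_kernel \<mu> \<nu> Q L" for Q L
  proof -
    interpret Q: martingale_kernel \<mu> \<nu> Q L by fact
    show ?thesis unfolding shift
      by (subst lborel.nn_integral_fst[symmetric]) simp_all
  qed
  have level: "(\<integral>\<^sup>+q. ennreal (segment_kernel (snd q) (fst (fst q)) (snd (fst q))) *
        indicator {q. r < f (snd q - fst (fst q))} q \<partial>(Q \<Otimes>\<^sub>M lborel)) =
      (\<integral>\<^sup>+k. ennreal (\<integral>p. indicator {x. r < f (k - x)} (fst p) * segment_kernel k (fst p) (snd p) \<partial>Q) \<partial>lborel)"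
    if "martingale_kernel \<mu> \<nu> Q L" for Q L r
  proof -
    interpret Q: martingale_kernel \<mu> \<nu> Q L by fact
    interpret pair_sigma_finite Q lborel ..
    have "(\<integral>\<^sup>+q. ennreal (segment_kernel (snd q) (fst (fst q)) (snd (fst q))) *
        indicator {q. r < f (snd q - fst (fst q))} q \<partial>(Q \<Otimes>\<^sub>M lborel)) =
      (\<integral>\<^sup>+k. (\<integral>\<^sup>+p. ennreal (segment_kernel k (fst p) (snd p)) * indicator {q. r < f (snd q - fst (fst q))} (p, k) \<partial>Q) \<partial>lborel)"
      by (subst nn_integral_snd[symmetric]) simp_all
    also have "\<dots> = (\<integral>\<^sup>+k. (\<integral>\<^sup>+p. ennreal (indicator {x. r < f (k - x)} (fst p) * segment_kernel k (fst p) (snd p)) \<partial>Q) \<partial>lborel)"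
      by (intro nn_integral_cong) (auto simp: indicator_def)
    also have "\<dots> = (\<integral>\<^sup>+k. ennreal (\<integral>p. indicator {x. r < f (k - x)} (fst p) * segment_kernel k (fst p) (snd p) \<partial>Q) \<partial>lborel)"
      by (intro nn_integral_cong nn_integral_eq_integral Q.integrable_segment_kernel_on)
        (auto simp: segment_kernel_nonneg)
    finally show ?thesis .
  qed
  have sf: "sigma_finite_measure (Q \<Otimes>\<^sub>M lborel)" if "martingale_kernel \<mu> \<nu> Q L" for Q L
  proof -
    interpret Q: martingale_kernel \<mu> \<nu> Q L by fact
    interpret pair_sigma_finite Q lborel ..
    show ?thesis by (rule sigma_finite_measure_axioms)
  qed
  show ?thesis
    unfolding eq[OF P] eq[OF P']
    by (rule nn_integral_mono_superlevel)
      (auto simp: level[OF P] level[OF P'] intro!: sf[OF P] sf[OF P'] nn_integral_mono ennreal_leI le)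
qed

lemma integral_displacement: "(\<integral>p. snd p - fst p \<partial>\<pi>) = 0"
proof -
  have "(\<integral>p. fst p \<partial>\<pi>) = (\<integral>x. x \<partial>\<mu>)"
    by (subst fst_\<pi>[symmetric], subst integral_distr) auto
  then show ?thesis
    using integral_bounded_fst_snd[of "\<lambda>_. 1" 1] by simp
qed

lemma ext_integral_neg_part_finite:
  assumes suff: "sufficient_integrability c \<mu> \<nu>"
  shows "(\<integral>\<^sup>+p. ennreal (- c (fst p) (snd p)) \<partial>\<pi>) < \<infinity>"
proof -
  obtain a b where ab: "integrable \<mu> a" "integrable \<nu> b" "\<And>x y. c x y \<ge> a x + b y"
    using suff by (auto simp: sufficient_integrability_def)
  have i: "integrable \<pi> (\<lambda>p. - (a (fst p) + b (snd p)))"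
    using integrable_fst[OF ab(1)] integrable_snd[OF ab(2)] by simp
  have "(\<integral>\<^sup>+p. ennreal (- c (fst p) (snd p)) \<partial>\<pi>) \<le> (\<integral>\<^sup>+p. ennreal (- (a (fst p) + b (snd p))) \<partial>\<pi>)"
  proof (intro nn_integral_mono ennreal_leI)
    fix p show "- c (fst p) (snd p) \<le> - (a (fst p) + b (snd p))"
      using ab(3)[of "fst p" "snd p"] by simp
  qed
  also have "\<dots> < \<infinity>"
    using i by (simp add: real_integrable_def less_top)
  finally show ?thesis .
qed

lemma integrable_of_finite_cost:
  assumes "sufficient_integrability c \<mu> \<nu>"
    and [measurable]: "(\<lambda>p. c (fst p) (snd p)) \<in> borel_measurable \<pi>"
    and "transport_cost c \<pi> < \<infinity>"
  shows "integrable \<pi> (\<lambda>p. c (fst p) (snd p))"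
proof -
  have neg: "(\<integral>\<^sup>+p. ennreal (- c (fst p) (snd p)) \<partial>\<pi>) \<noteq> \<infinity>"
    using ext_integral_neg_part_finite[OF assms(1)] by simp
  moreover have "(\<integral>\<^sup>+p. ennreal (c (fst p) (snd p)) \<partial>\<pi>) \<noteq> \<infinity>"
  proof
    assume "(\<integral>\<^sup>+p. ennreal (c (fst p) (snd p)) \<partial>\<pi>) = \<infinity>"
    moreover obtain d where "(\<integral>\<^sup>+p. ennreal (- c (fst p) (snd p)) \<partial>\<pi>) = ennreal d" "0 \<le> d"
      using neg by (cases "\<integral>\<^sup>+p. ennreal (- c (fst p) (snd p)) \<partial>\<pi>") auto
    ultimately have "transport_cost c \<pi> = \<infinity>"
      by (simp add: transport_cost_def ext_integral_def split_beta enn2ereal_ennreal)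
    then show False using assms(3) by simp
  qed
  ultimately show ?thesis by (simp add: real_integrable_def)
qed

lemma transport_cost_eq_integral:
  assumes "integrable \<pi> (\<lambda>p. c (fst p) (snd p))"
  shows "transport_cost c \<pi> = ereal (\<integral>p. c (fst p) (snd p) \<partial>\<pi>)"
  using ext_integral_add_nonneg[OF assms, of "\<lambda>_. 0"] by (simp add: zero_ennreal.rep_eq transport_cost_def case_prod_beta')

end

text \<open>By Taylor's formula the cost is \<open>h 0 + g 0 (y - x) + \<integral> segment_kernel k x y * w (k - x) dk\<close>, and for
  each \<open>k\<close> the factor \<open>w (k - x)\<close> is nonincreasing in \<open>x\<close>.\<close>

lemma (in martingale_kernel) curtain_cost_le:
  assumes P': "martingale_kernel \<mu> \<nu> \<pi>' K'"
    and pot: "\<And>t k. potential \<pi> t k \<le> potential \<pi>' t k"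
    and w: "is_subgradient w g" and h: "\<And>x. (h has_real_derivative g x) (at x)"
    and c: "\<And>x y. c x y = h (y - x)" and suff: "sufficient_integrability c \<mu> \<nu>"
  shows "transport_cost c \<pi> \<le> transport_cost c \<pi>'"
proof (cases "transport_cost c \<pi>' < \<infinity>")
  case True
  interpret P': martingale_kernel \<mu> \<nu> \<pi>' K' by fact
  have wm: "x \<le> y \<Longrightarrow> w x \<le> w y" for x y using subgradient_mono[OF w] by (simp add: mono_def)
  have [measurable]: "w \<in> borel_measurable borel"
    using borel_measurable_mono[OF subgradient_mono[OF w]] .
  have "continuous_on UNIV h" using h by (meson DERIV_isCont continuous_at_imp_continuous_on)
  then have [measurable]: "h \<in> borel_measurable borel" by (rule borel_measurable_continuous_onI)
  let ?z = "\<lambda>p :: real \<times> real. snd p - fst p"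
  \<comment> \<open>\<open>A\<close> and \<open>B\<close> are the contributions of the positive and
    the negative part of \<open>w\<close>. By the choice of \<open>C\<close> below, at every
    \<open>z\<close> at least one of them is at most linear.\<close>
  define A where "A z = (\<integral>k. segment_kernel k 0 z * max 0 (w k) \<partial>lborel)" for z
  define B where "B z = (\<integral>k. segment_kernel k 0 z * max 0 (- w k) \<partial>lborel)" for z
  have iw: "integrable lborel (\<lambda>k. segment_kernel k 0 z * w k)" for z
    by (rule integrable_segment_kernel[OF w h])
  have iA: "integrable lborel (\<lambda>k. segment_kernel k 0 z * max 0 (w k))" for z
    by (rule Bochner_Integration.integrable_bound[OF iw[of z]])
      (auto simp: abs_mult segment_kernel_nonneg intro!: mult_left_mono)
  have iB: "integrable lborel (\<lambda>k. segment_kernel k 0 z * max 0 (- w k))" for z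
    by (rule Bochner_Integration.integrable_bound[OF iw[of z]])
      (auto simp: abs_mult segment_kernel_nonneg intro!: mult_left_mono)
  have A0: "0 \<le> A z" and B0: "0 \<le> B z" for z
    by (auto simp: A_def B_def segment_kernel_nonneg)
  have nA: "ennreal (A z) = (\<integral>\<^sup>+k. ennreal (segment_kernel k 0 z) * ennreal (max 0 (w k)) \<partial>lborel)" for z
    unfolding A_def using iA[of z]
    by (subst nn_integral_eq_integral[symmetric]) (auto simp: segment_kernel_nonneg ennreal_mult)
  have nB: "ennreal (B z) = (\<integral>\<^sup>+k. ennreal (segment_kernel k 0 z) * ennreal (max 0 (- w k)) \<partial>lborel)" for z
    unfolding B_def using iB[of z]
    by (subst nn_integral_eq_integral[symmetric]) (auto simp: segment_kernel_nonneg ennreal_mult)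
  have [measurable]: "A \<in> borel_measurable borel" "B \<in> borel_measurable borel"
    unfolding A_def B_def by measurable
  have hAB: "h z = h 0 + g 0 * z + (A z - B z)" for z
  proof -
    have "A z - B z = (\<integral>k. segment_kernel k 0 z * max 0 (w k) - segment_kernel k 0 z * max 0 (- w k) \<partial>lborel)"
      unfolding A_def B_def using iA iB by simp
    also have "\<dots> = (\<integral>k. segment_kernel k 0 z * w k \<partial>lborel)"
      by (rule Bochner_Integration.integral_cong) (auto simp: max_def)
    finally show ?thesis using taylor_segment_kernel[OF w h, of z] by simp
  qed
  obtain C where C: "C \<ge> 0" "\<And>z. A z \<le> C * \<bar>z\<bar> \<or> B z \<le> C * \<bar>z\<bar>"
  proof (rule segment_kernel_min_part_bound[OF subgradient_mono[OF w]])
    fix C :: real assume "0 \<le> C" and *: "\<And>z. (\<integral>\<^sup>+k. ennreal (segment_kernel k 0 z * max 0 (w k)) \<partial>lborel) \<le> ennreal (C * \<bar>z\<bar>) \<or>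
         (\<integral>\<^sup>+k. ennreal (segment_kernel k 0 z * max 0 (- w k)) \<partial>lborel) \<le> ennreal (C * \<bar>z\<bar>)"
    have "A z \<le> C * \<bar>z\<bar> \<or> B z \<le> C * \<bar>z\<bar>" for z
    proof -
      have "ennreal (A z) \<le> ennreal (C * \<bar>z\<bar>) \<or> ennreal (B z) \<le> ennreal (C * \<bar>z\<bar>)"
        using *[of z] by (simp add: nA nB ennreal_mult segment_kernel_nonneg)
      then show ?thesis using \<open>0 \<le> C\<close> by (simp add: ennreal_le_iff)
    qed
    with \<open>0 \<le> C\<close> show thesis by (rule that)
  qed
  have cm: "(\<lambda>p. c (fst p) (snd p)) = (\<lambda>p. h (?z p))" by (simp add: c)
  have ic': "integrable \<pi>' (\<lambda>p. h (?z p))"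
    using P'.integrable_of_finite_cost[OF suff _ True] unfolding cm by simp
  have iz: "integrable \<pi> ?z" "integrable \<pi>' ?z" by auto
  \<comment> \<open>Where \<open>B\<close> is at most linear, \<open>A\<close> is bounded by the
    cost plus linear terms; elsewhere \<open>A\<close> itself is at most linear.\<close>
  have iA': "integrable \<pi>' (\<lambda>p. A (?z p))"
  proof (rule Bochner_Integration.integrable_bound)
    show "integrable \<pi>' (\<lambda>p. \<bar>h (?z p)\<bar> + \<bar>h 0\<bar> + (\<bar>g 0\<bar> + C) * \<bar>?z p\<bar>)"
      using ic' iz by simp
    have "A z \<le> \<bar>h z\<bar> + \<bar>h 0\<bar> + (\<bar>g 0\<bar> + C) * \<bar>z\<bar>" for z
      using hAB[of z] C(2)[of z] abs_mult[of "g 0" z] mult_nonneg_nonneg[OF C(1) abs_ge_zero[of z]]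
        mult_nonneg_nonneg[OF abs_ge_zero[of "g 0"] abs_ge_zero[of z]]
      unfolding distrib_right by linarith
    then show "AE p in \<pi>'. norm (A (?z p)) \<le> norm (\<bar>h (?z p)\<bar> + \<bar>h 0\<bar> + (\<bar>g 0\<bar> + C) * \<bar>?z p\<bar>)"
      unfolding real_norm_def abs_of_nonneg[OF A0] by (intro AE_I2 order_trans[OF _ abs_ge_self])
  qed measurable
  have iB': "integrable \<pi>' (\<lambda>p. B (?z p))"
  proof -
    have "B z = h 0 + g 0 * z + A z - h z" for z using hAB[of z] by simp
    then show ?thesis using ic' iz iA' by simp
  qed
  \<comment> \<open>\<open>max 0 (w (k - x))\<close> is nonincreasing in \<open>x\<close>, so its
    superlevel sets are down-sets. For the negative part they are up-sets and \<open>SB\<close>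
    points the other way. Both favour \<open>\<pi>\<close>, as \<open>B\<close> enters the cost with
    a minus sign.\<close>
  have SA: "(\<integral>\<^sup>+p. ennreal (A (?z p)) \<partial>\<pi>) \<le> (\<integral>\<^sup>+p. ennreal (A (?z p)) \<partial>\<pi>')"
    unfolding nA
    by (rule nn_integral_segment_mono[OF martingale_kernel_axioms P'], simp)
      (rule segment_integral_downset_mono[OF P' pot], use wm in \<open>auto simp: less_max_iff_disj intro: less_le_trans\<close>)
  have SB: "(\<integral>\<^sup>+p. ennreal (B (?z p)) \<partial>\<pi>') \<le> (\<integral>\<^sup>+p. ennreal (B (?z p)) \<partial>\<pi>)"
    unfolding nB
    by (rule nn_integral_segment_mono[OF P' martingale_kernel_axioms], simp)
      (rule segment_integral_upset_mono[OF P' pot], use wm in \<open>auto simp: less_max_iff_disj intro: less_le_trans\<close>)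
  have iA1: "integrable \<pi> (\<lambda>p. A (?z p))"
  proof (rule integrableI_nonneg)
    show "(\<integral>\<^sup>+p. ennreal (A (?z p)) \<partial>\<pi>) < \<infinity>"
      using SA iA' A0 by (auto simp: integrable_iff_bounded intro: le_less_trans)
  qed (use A0 in auto)
  \<comment> \<open>Finite cost of \<open>\<pi>\<close> is not yet known, and \<open>SB\<close>
    bounds \<open>B\<close> from the wrong side. But where \<open>B\<close> is more than linear,
    \<open>A\<close> is at most linear, so \<open>B\<close> is bounded by the negative part of
    \<open>h\<close> plus linear terms, and that negative part is integrable by the lower bound on
    \<open>c\<close>.\<close>
  have iB1: "integrable \<pi> (\<lambda>p. B (?z p))"
  proof (rule Bochner_Integration.integrable_bound)
    have "integrable \<pi> (\<lambda>p. max 0 (- h (?z p)))"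
    proof (rule integrableI_nonneg)
      show "(\<integral>\<^sup>+p. ennreal (max 0 (- h (?z p))) \<partial>\<pi>) < \<infinity>"
        using ext_integral_neg_part_finite[OF suff] by (simp add: c)
    qed auto
    then show "integrable \<pi> (\<lambda>p. max 0 (- h (?z p)) + \<bar>h 0\<bar> + (\<bar>g 0\<bar> + C) * \<bar>?z p\<bar>)"
      using iz by simp
    have "B z \<le> max 0 (- h z) + \<bar>h 0\<bar> + (\<bar>g 0\<bar> + C) * \<bar>z\<bar>" for z
      using hAB[of z] C(2)[of z] abs_mult[of "g 0" z] mult_nonneg_nonneg[OF C(1) abs_ge_zero[of z]]
        mult_nonneg_nonneg[OF abs_ge_zero[of "g 0"] abs_ge_zero[of z]]
      unfolding distrib_right by linarith
    then show "AE p in \<pi>. norm (B (?z p)) \<le> norm (max 0 (- h (?z p)) + \<bar>h 0\<bar> + (\<bar>g 0\<bar> + C) * \<bar>?z p\<bar>)"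
      unfolding real_norm_def abs_of_nonneg[OF B0] by (intro AE_I2 order_trans[OF _ abs_ge_self])
  qed measurable
  have "(\<integral>p. A (?z p) \<partial>\<pi>) \<le> (\<integral>p. A (?z p) \<partial>\<pi>')"
    using SA iA1 iA' A0 by (simp add: nn_integral_eq_integral integral_nonneg)
  moreover have "(\<integral>p. B (?z p) \<partial>\<pi>') \<le> (\<integral>p. B (?z p) \<partial>\<pi>)"
    using SB iB1 iB' B0 by (simp add: nn_integral_eq_integral integral_nonneg)
  moreover have "(\<integral>p. h (?z p) \<partial>\<pi>) = h 0 + (\<integral>p. A (?z p) \<partial>\<pi>) - (\<integral>p. B (?z p) \<partial>\<pi>)"
    unfolding hAB[of "_ - _"] using iA1 iB1 iz integral_displacement
    by (simp add: \<pi>.prob_space[simplified] del: Bochner_Integration.integral_diff) (simp add: iA1 iB1)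
  moreover have "(\<integral>p. h (?z p) \<partial>\<pi>') = h 0 + (\<integral>p. A (?z p) \<partial>\<pi>') - (\<integral>p. B (?z p) \<partial>\<pi>')"
    unfolding hAB[of "_ - _"] using iA' iB' iz P'.integral_displacement
    by (simp add: P'.\<pi>.prob_space[simplified] del: Bochner_Integration.integral_diff) (simp add: iA' iB')
  moreover have "integrable \<pi> (\<lambda>p. h (?z p))"
    unfolding hAB[of "_ - _"] using iA1 iB1 iz by simp
  ultimately show ?thesis
    using transport_cost_eq_integral[of c] P'.transport_cost_eq_integral[of c] ic' unfolding cm by simp
qed simp

section \<open>Exchanging mass between fibres\<close>

definition add_measure :: "'a measure \<Rightarrow> 'a measure \<Rightarrow> 'a measure" where
  "add_measure M N = measure_of (space M) (sets M) (\<lambda>A. emeasure M A + emeasure N A)"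

lemma sets_add_measure[simp, measurable_cong]: "sets (add_measure M N) = sets M"
  and space_add_measure[simp]: "space (add_measure M N) = space M"
  by (simp_all add: add_measure_def)

lemma emeasure_add_measure:
  assumes [measurable_cong]: "sets N = sets M" and A: "A \<in> sets M"
  shows "emeasure (add_measure M N) A = emeasure M A + emeasure N A"
  unfolding add_measure_def
proof (rule emeasure_measure_of_sigma[OF sets.sigma_algebra_axioms _ _ A])
  show "positive (sets M) (\<lambda>A. emeasure M A + emeasure N A)"
    by (simp add: positive_def)
  show "countably_additive (sets M) (\<lambda>A. emeasure M A + emeasure N A)"
  proof (rule countably_additiveI)
    fix A :: "nat \<Rightarrow> 'a set" assume A: "range A \<subseteq> sets M" "disjoint_family A"
    have "(\<Sum>i. emeasure M (A i)) = emeasure M (\<Union>i. A i)" "(\<Sum>i. emeasure N (A i)) = emeasure N (\<Union>i. A i)"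
      using A by (auto intro!: suminf_emeasure simp: assms(1))
    then show "(\<Sum>i. emeasure M (A i) + emeasure N (A i)) = emeasure M (\<Union>i. A i) + emeasure N (\<Union>i. A i)"
      by (subst suminf_add[symmetric]) auto
  qed
qed

lemma nn_integral_add_measure:
  assumes [measurable_cong]: "sets N = sets M" and "f \<in> borel_measurable M"
  shows "(\<integral>\<^sup>+x. f x \<partial>add_measure M N) = (\<integral>\<^sup>+x. f x \<partial>M) + (\<integral>\<^sup>+x. f x \<partial>N)"
  using assms(2)
proof induction
  case (cong f g)
  moreover have "space N = space M" using assms(1) by (rule sets_eq_imp_space_eq)
  ultimately have "(\<integral>\<^sup>+x. f x \<partial>Q) = (\<integral>\<^sup>+x. g x \<partial>Q)" if "space Q = space M" for Q
    using that by (intro nn_integral_cong) simp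
  then show ?case using cong \<open>space N = space M\<close> by simp
next
  case (set A)
  then show ?case using assms(1) by (simp add: emeasure_add_measure)
next
  case (mult u c)
  then show ?case by (simp add: nn_integral_cmult distrib_left)
next
  case (add u v)
  then show ?case by (simp add: nn_integral_add ac_simps)
next
  case (seq U)
  have [measurable]: "U i \<in> borel_measurable M" for i by (rule seq)
  have "(\<integral>\<^sup>+x. (SUP i. U i x) \<partial>add_measure M N) = (SUP i. (\<integral>\<^sup>+x. U i x \<partial>M) + (\<integral>\<^sup>+x. U i x \<partial>N))"
    using seq by (subst nn_integral_monotone_convergence_SUP) simp_all
  also have "\<dots> = (SUP i. \<integral>\<^sup>+x. U i x \<partial>M) + (SUP i. \<integral>\<^sup>+x. U i x \<partial>N)"
    using seq(3) by (intro ennreal_SUP_add) (auto simp: incseq_def le_fun_def intro!: nn_integral_mono)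
  also have "\<dots> = (\<integral>\<^sup>+x. (SUP i. U i x) \<partial>M) + (\<integral>\<^sup>+x. (SUP i. U i x) \<partial>N)"
    using seq by (subst (1 2) nn_integral_monotone_convergence_SUP) simp_all
  finally show ?case by (simp add: image_comp SUP_apply[abs_def])
qed

lemma
  fixes f :: "'a \<Rightarrow> real"
  assumes [measurable_cong]: "sets N = sets M" and M: "integrable M f" and N: "integrable N f"
  shows integrable_add_measure: "integrable (add_measure M N) f"
    and integral_add_measure: "(\<integral>x. f x \<partial>add_measure M N) = (\<integral>x. f x \<partial>M) + (\<integral>x. f x \<partial>N)"
proof -
  have [measurable]: "f \<in> borel_measurable M" using M by simp
  have fin: "(\<integral>\<^sup>+x. ennreal (f x) \<partial>M) < \<top>" "(\<integral>\<^sup>+x. ennreal (f x) \<partial>N) < \<top>"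
    "(\<integral>\<^sup>+x. ennreal (- f x) \<partial>M) < \<top>" "(\<integral>\<^sup>+x. ennreal (- f x) \<partial>N) < \<top>"
    using M N by (auto simp: real_integrable_def less_top)
  show i: "integrable (add_measure M N) f"
    using fin by (simp add: real_integrable_def nn_integral_add_measure assms(1) less_top)
  show "(\<integral>x. f x \<partial>add_measure M N) = (\<integral>x. f x \<partial>M) + (\<integral>x. f x \<partial>N)"
    using fin unfolding real_lebesgue_integral_def[OF i] real_lebesgue_integral_def[OF M] real_lebesgue_integral_def[OF N]
    by (simp add: nn_integral_add_measure assms(1) enn2real_plus)
qed

text \<open>The amount \<open>w x y s\<close> of mass is moved from \<open>(x, y)\<close> to \<open>(s, y)\<close>. This never affects the second
  marginal; when the mass exchanged between any two fibres has the same total and the same mean in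
  both directions, the result is again a martingale transport plan.\<close>

locale fibre_exchange = martingale_kernel +
  fixes w :: "real \<Rightarrow> real \<Rightarrow> real \<Rightarrow> real" and N :: real
  assumes w_measurable: "(\<lambda>(x, y, s). w x y s) \<in> borel_measurable borel"
    and w_nonneg: "\<And>x y s. 0 \<le> w x y s" and w_le_1: "\<And>x y s. w x y s \<le> 1"
    and w_support: "\<And>x y s. w x y s \<noteq> 0 \<Longrightarrow> \<bar>x\<bar> \<le> N \<and> \<bar>y\<bar> \<le> N \<and> \<bar>s\<bar> \<le> N"
    and balance_mass: "\<And>x s. (\<integral>y. w x y s \<partial>K x) = (\<integral>y. w s y x \<partial>K s)"
    and balance_mean: "\<And>x s. (\<integral>y. w x y s * y \<partial>K x) = (\<integral>y. w s y x * y \<partial>K s)"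
begin

lemma measurable_w[measurable (raw)]:
  assumes [measurable]: "f \<in> borel_measurable M" "g \<in> borel_measurable M" "k \<in> borel_measurable M"
  shows "(\<lambda>\<omega>. w (f \<omega>) (g \<omega>) (k \<omega>)) \<in> borel_measurable M"
proof -
  have "(\<lambda>\<omega>. (f \<omega>, g \<omega>, k \<omega>)) \<in> M \<rightarrow>\<^sub>M borel" by (intro borel_measurable_Pair) measurable
  from measurable_compose[OF this w_measurable] show ?thesis by simp
qed

text \<open>The share of the mass at \<open>(x, y)\<close> that leaves. It is at most 1 because
  \<open>w \<le> 1\<close> and \<open>\<mu>\<close> is a probability measure, so
  \<open>1 - out x y\<close> can serve as a density.\<close>

definition out :: "real \<Rightarrow> real \<Rightarrow> real" where
  "out x y = (\<integral>s. w x y s \<partial>\<mu>)"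

text \<open>Fibre \<open>x\<close> keeps the share \<open>1 - out x y\<close> and receives from
  every \<open>(s, y)\<close> the share \<open>w s y x\<close>; summing over all sources is
  integration against \<open>\<pi>\<close>.\<close>

definition kernel :: "real \<Rightarrow> real measure" where
  "kernel x = add_measure (density (K x) (\<lambda>y. ennreal (1 - out x y)))
     (distr (density \<pi> (\<lambda>p. ennreal (w (fst p) (snd p) x))) borel snd)"

definition plan :: "(real \<times> real) measure" where
  "plan = add_measure (density \<pi> (\<lambda>p. ennreal (1 - out (fst p) (snd p))))
     (distr (density (\<pi> \<Otimes>\<^sub>M \<mu>) (\<lambda>q. ennreal (w (fst (fst q)) (snd (fst q)) (snd q)))) borel (\<lambda>q. (snd q, snd (fst q))))"

lemma measurable_out[measurable (raw)]:
  assumes [measurable]: "f \<in> borel_measurable M" "g \<in> borel_measurable M"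
  shows "(\<lambda>\<omega>. out (f \<omega>) (g \<omega>)) \<in> borel_measurable M"
  unfolding out_def by measurable

lemma integrable_w_\<mu>: "integrable \<mu> (\<lambda>s. w x y s)"
  by (rule \<mu>.integrable_const_bound[where B = 1]) (use w_nonneg w_le_1 in auto)

lemma out_bounds: "0 \<le> out x y" "out x y \<le> 1"
proof -
  show "0 \<le> out x y" unfolding out_def using w_nonneg by (simp add: integral_nonneg)
  have "out x y \<le> (\<integral>s. 1 \<partial>\<mu>)" unfolding out_def
    by (rule integral_mono) (use integrable_w_\<mu> w_le_1 in auto)
  then show "out x y \<le> 1" by (simp add: \<mu>.prob_space[simplified])
qed

lemma ennreal_out: "ennreal (out x y) = (\<integral>\<^sup>+s. ennreal (w x y s) \<partial>\<mu>)"
  unfolding out_def using integrable_w_\<mu> w_nonneg by (simp add: nn_integral_eq_integral)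

lemma sets_kernel[simp, measurable_cong]: "sets (kernel x) = sets borel"
  and sets_plan[simp, measurable_cong]: "sets plan = sets borel"
  by (simp_all add: kernel_def plan_def)

lemma nn_integral_kernel:
  assumes [measurable]: "f \<in> borel_measurable borel"
  shows "(\<integral>\<^sup>+y. f y \<partial>kernel x) = (\<integral>\<^sup>+y. ennreal (1 - out x y) * f y \<partial>K x) +
    (\<integral>\<^sup>+p. ennreal (w (fst p) (snd p) x) * f (snd p) \<partial>\<pi>)"
  unfolding kernel_def
  by (subst nn_integral_add_measure) (simp_all add: nn_integral_density nn_integral_distr)

lemma nn_integral_plan:
  assumes [measurable]: "f \<in> borel_measurable borel"
  shows "(\<integral>\<^sup>+p. f p \<partial>plan) = (\<integral>\<^sup>+p. ennreal (1 - out (fst p) (snd p)) * f p \<partial>\<pi>) +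
    (\<integral>\<^sup>+p. (\<integral>\<^sup>+s. ennreal (w (fst p) (snd p) s) * f (s, snd p) \<partial>\<mu>) \<partial>\<pi>)"
proof -
  have [measurable]: "(\<lambda>q :: (real \<times> real) \<times> real. (snd q, snd (fst q))) \<in> \<pi> \<Otimes>\<^sub>M \<mu> \<rightarrow>\<^sub>M borel"
    by (rule borel_measurable_Pair) measurable
  have "(\<integral>\<^sup>+p. f p \<partial>plan) = (\<integral>\<^sup>+p. ennreal (1 - out (fst p) (snd p)) * f p \<partial>\<pi>) +
    (\<integral>\<^sup>+q. ennreal (w (fst (fst q)) (snd (fst q)) (snd q)) * f (snd q, snd (fst q)) \<partial>(\<pi> \<Otimes>\<^sub>M \<mu>))"
    unfolding plan_def
    by (subst nn_integral_add_measure) (simp_all add: nn_integral_density nn_integral_distr)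
  also have "(\<integral>\<^sup>+q. ennreal (w (fst (fst q)) (snd (fst q)) (snd q)) * f (snd q, snd (fst q)) \<partial>(\<pi> \<Otimes>\<^sub>M \<mu>)) =
    (\<integral>\<^sup>+p. (\<integral>\<^sup>+s. ennreal (w (fst p) (snd p) s) * f (s, snd p) \<partial>\<mu>) \<partial>\<pi>)"
    by (subst \<mu>.nn_integral_fst[symmetric]) simp_all
  finally show ?thesis .
qed

lemma bounded_kernel_integral:
  assumes [measurable]: "(\<lambda>(y, s). f y s) \<in> borel_measurable (borel \<Otimes>\<^sub>M borel)"
    and f: "\<And>y s. \<bar>f y s\<bar> \<le> (B :: real)"
  shows "(\<integral>y. (\<integral>s. f y s \<partial>\<mu>) \<partial>K x) = (\<integral>s. (\<integral>y. f y s \<partial>K x) \<partial>\<mu>)"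
proof -
  interpret pair_prob_space "K x" \<mu> ..
  have "integrable (K x \<Otimes>\<^sub>M \<mu>) (\<lambda>(y, s). f y s)"
    by (rule P.integrable_const_bound[where B = B]) (use f in auto)
  then show ?thesis by (rule Fubini_integral[symmetric])
qed

lemma w_mult_bound: "\<bar>w x y s * y\<bar> \<le> \<bar>N\<bar>"
proof (cases "w x y s = 0")
  case False
  then have "\<bar>y\<bar> \<le> N" using w_support by blast
  then have "\<bar>w x y s\<bar> * \<bar>y\<bar> \<le> 1 * \<bar>N\<bar>" using w_nonneg w_le_1 by (intro mult_mono) auto
  then show ?thesis by (simp add: abs_mult)
qed simp

text \<open>What fibre \<open>x\<close> receives equals, when tested against
  \<open>\<theta>\<close>, what it gives: the pairwise balance is integrated over the partner
  \<open>s\<close>. It is used with \<open>\<theta> y = 1\<close> for the mass and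
  \<open>\<theta> y = y\<close> for the mean.\<close>

lemma exchange_balance:
  assumes [measurable]: "\<theta> \<in> borel_measurable borel"
    and bal: "\<And>x s. (\<integral>y. w x y s * \<theta> y \<partial>K x) = (\<integral>y. w s y x * \<theta> y \<partial>K s)"
    and bnd: "\<And>x y s. \<bar>w x y s * \<theta> y\<bar> \<le> (B :: real)"
  shows "integrable \<pi> (\<lambda>p. w (fst p) (snd p) x * \<theta> (snd p))"
    and "(\<integral>p. w (fst p) (snd p) x * \<theta> (snd p) \<partial>\<pi>) = (\<integral>y. out x y * \<theta> y \<partial>K x)"
proof -
  show i: "integrable \<pi> (\<lambda>p. w (fst p) (snd p) x * \<theta> (snd p))"
    by (rule \<pi>.integrable_const_bound[where B = B]) (use bnd in auto)
  have "(\<integral>p. w (fst p) (snd p) x * \<theta> (snd p) \<partial>\<pi>) = (\<integral>s. (\<integral>y. w x y s * \<theta> y \<partial>K x) \<partial>\<mu>)"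
    using integral_\<pi>(3)[OF i] by (simp add: bal[of x])
  also have "\<dots> = (\<integral>y. (\<integral>s. w x y s * \<theta> y \<partial>\<mu>) \<partial>K x)"
    by (rule bounded_kernel_integral[symmetric, where B = B]) (use bnd in auto)
  also have "\<dots> = (\<integral>y. out x y * \<theta> y \<partial>K x)"
    by (simp add: out_def)
  finally show "(\<integral>p. w (fst p) (snd p) x * \<theta> (snd p) \<partial>\<pi>) = (\<integral>y. out x y * \<theta> y \<partial>K x)" .
qed

lemma prob_space_kernel: "prob_space (kernel x)"
proof
  have sp: "space (kernel x) = UNIV" using sets_eq_imp_space_eq[OF sets_kernel] by simp
  have o: "integrable (K x) (out x)"
    by (rule K.integrable_const_bound[where B = 1]) (use out_bounds in auto)
  have b: "integrable \<pi> (\<lambda>p. w (fst p) (snd p) x)" "(\<integral>p. w (fst p) (snd p) x \<partial>\<pi>) = (\<integral>y. out x y \<partial>K x)"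
    using exchange_balance[of "\<lambda>_. 1" 1 x] balance_mass w_nonneg w_le_1 by auto
  have "emeasure (kernel x) (space (kernel x)) = (\<integral>\<^sup>+y. 1 \<partial>kernel x)"
    by simp
  also have "\<dots> = (\<integral>\<^sup>+y. ennreal (1 - out x y) \<partial>K x) + (\<integral>\<^sup>+p. ennreal (w (fst p) (snd p) x) \<partial>\<pi>)"
    by (subst nn_integral_kernel) simp_all
  also have "\<dots> = ennreal (\<integral>y. 1 - out x y \<partial>K x) + ennreal (\<integral>p. w (fst p) (snd p) x \<partial>\<pi>)"
    using o b(1) out_bounds w_nonneg by (subst (1 2) nn_integral_eq_integral) auto
  also have "\<dots> = ennreal ((\<integral>y. 1 - out x y \<partial>K x) + (\<integral>p. w (fst p) (snd p) x \<partial>\<pi>))"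
    using out_bounds w_nonneg by (intro ennreal_plus[symmetric] integral_nonneg) auto
  also have "\<dots> = 1" using o b(2) by (simp add: K.prob_space[simplified])
  finally show "emeasure (kernel x) (space (kernel x)) = 1" .
qed

lemma mean_kernel:
  assumes "integrable (K x) (\<lambda>y. y)" "(\<integral>y. y \<partial>K x) = x"
  shows "integrable (kernel x) (\<lambda>y. y)" "(\<integral>y. y \<partial>kernel x) = x"
proof -
  have b: "integrable \<pi> (\<lambda>p. w (fst p) (snd p) x * snd p)"
    "(\<integral>p. w (fst p) (snd p) x * snd p \<partial>\<pi>) = (\<integral>y. out x y * y \<partial>K x)"
    using exchange_balance[of "\<lambda>y. y" "\<bar>N\<bar>" x] balance_mean w_mult_bound by auto
  have io: "integrable (K x) (\<lambda>y. out x y * y)"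
    by (rule Bochner_Integration.integrable_bound[OF assms(1)])
      (use out_bounds in \<open>auto simp: abs_mult intro!: mult_left_le_one_le\<close>)
  have i1: "integrable (density (K x) (\<lambda>y. ennreal (1 - out x y))) (\<lambda>y. y)"
  proof (subst integrable_real_density)
    show "integrable (K x) (\<lambda>y. (1 - out x y) * y)"
      unfolding left_diff_distrib using assms(1) io by simp
  qed (use out_bounds in auto)
  have "integrable (density \<pi> (\<lambda>p. ennreal (w (fst p) (snd p) x))) snd"
    using w_nonneg b(1) by (subst integrable_real_density) auto
  then have i2: "integrable (distr (density \<pi> (\<lambda>p. ennreal (w (fst p) (snd p) x))) borel snd) (\<lambda>y. y)"
    by (subst integrable_distr_eq) auto
  show "integrable (kernel x) (\<lambda>y. y)"
    unfolding kernel_def by (rule integrable_add_measure) (use i1 i2 in auto)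
  have "(\<integral>y. y \<partial>kernel x) = (\<integral>y. (1 - out x y) * y \<partial>K x) + (\<integral>p. w (fst p) (snd p) x * snd p \<partial>\<pi>)"
    unfolding kernel_def using out_bounds w_nonneg
    by (subst integral_add_measure[OF _ i1 i2])
      (simp_all add: integral_real_density integral_distr)
  also have "\<dots> = x" unfolding b(2) left_diff_distrib using assms io by simp
  finally show "(\<integral>y. y \<partial>kernel x) = x" .
qed

lemma measurable_kernel: "kernel \<in> borel \<rightarrow>\<^sub>M prob_algebra borel"
proof (rule measurable_prob_algebraI[OF prob_space_kernel measurable_subprob_algebra])
  show "subprob_space (kernel x)" for x
    using prob_space_kernel by (rule prob_space_imp_subprob_space)
  fix A :: "real set" assume [measurable]: "A \<in> sets borel"
  have "emeasure (kernel x) A = (\<integral>\<^sup>+y. ennreal (1 - out x y) * indicator A y \<partial>K x) +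
    (\<integral>\<^sup>+p. ennreal (w (fst p) (snd p) x) * indicator A (snd p) \<partial>\<pi>)" for x
    using nn_integral_kernel[of "indicator A" x] by simp
  then show "(\<lambda>x. emeasure (kernel x) A) \<in> borel_measurable borel"
    by simp
qed simp

text \<open>\<open>kernel\<close> collects what arrives in a fixed target fibre, \<open>plan\<close>
  sends out what leaves a fixed source point. Tonelli identifies the two descriptions.\<close>

lemma emeasure_plan:
  assumes A[measurable]: "A \<in> sets borel"
  shows "emeasure plan A = (\<integral>\<^sup>+x. emeasure (kernel x) {y. (x, y) \<in> A} \<partial>\<mu>)"
proof -
  interpret pair_sigma_finite \<pi> \<mu> ..
  have fib: "{y. (x, y) \<in> A} \<in> sets borel" for x
    using sets_Pair1[of A borel borel x] A by (simp add: borel_prod vimage_def)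
  have [measurable]: "(\<lambda>q :: (real \<times> real) \<times> real. (snd q, snd (fst q))) \<in> \<pi> \<Otimes>\<^sub>M \<mu> \<rightarrow>\<^sub>M borel"
    by (rule borel_measurable_Pair) measurable
  have "(\<integral>\<^sup>+x. emeasure (kernel x) {y. (x, y) \<in> A} \<partial>\<mu>) =
    (\<integral>\<^sup>+x. (\<integral>\<^sup>+y. ennreal (1 - out x y) * indicator A (x, y) \<partial>K x) +
      (\<integral>\<^sup>+p. ennreal (w (fst p) (snd p) x) * indicator A (x, snd p) \<partial>\<pi>) \<partial>\<mu>)"
  proof (rule nn_integral_cong)
    fix x
    have "emeasure (kernel x) {y. (x, y) \<in> A} = (\<integral>\<^sup>+y. indicator {y. (x, y) \<in> A} y \<partial>kernel x)"
      using fib by simp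
    then show "emeasure (kernel x) {y. (x, y) \<in> A} = (\<integral>\<^sup>+y. ennreal (1 - out x y) * indicator A (x, y) \<partial>K x) +
      (\<integral>\<^sup>+p. ennreal (w (fst p) (snd p) x) * indicator A (x, snd p) \<partial>\<pi>)"
      using fib[of x] by (simp add: nn_integral_kernel indicator_def)
  qed
  also have "\<dots> = (\<integral>\<^sup>+x. (\<integral>\<^sup>+y. ennreal (1 - out x y) * indicator A (x, y) \<partial>K x) \<partial>\<mu>) +
      (\<integral>\<^sup>+x. (\<integral>\<^sup>+p. ennreal (w (fst p) (snd p) x) * indicator A (x, snd p) \<partial>\<pi>) \<partial>\<mu>)"
    by (rule nn_integral_add) measurable
  also have "(\<integral>\<^sup>+x. (\<integral>\<^sup>+p. ennreal (w (fst p) (snd p) x) * indicator A (x, snd p) \<partial>\<pi>) \<partial>\<mu>) =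
      (\<integral>\<^sup>+p. (\<integral>\<^sup>+x. ennreal (w (fst p) (snd p) x) * indicator A (x, snd p) \<partial>\<mu>) \<partial>\<pi>)"
    by (rule Fubini') measurable
  also have "(\<integral>\<^sup>+x. (\<integral>\<^sup>+y. ennreal (1 - out x y) * indicator A (x, y) \<partial>K x) \<partial>\<mu>) =
      (\<integral>\<^sup>+p. ennreal (1 - out (fst p) (snd p)) * indicator A p \<partial>\<pi>)"
    by (subst nn_integral_\<pi>) simp_all
  finally show ?thesis
    using nn_integral_plan[of "indicator A"] by simp
qed

lemma martingale_kernel_plan: "martingale_kernel \<mu> \<nu> plan kernel"
proof (unfold martingale_kernel_def, intro conjI)
  show "prob_space \<mu>" by (rule prob_\<mu>)
  show "integrable \<mu> (\<lambda>x. x)" "integrable \<nu> (\<lambda>x. x)" by (rule int_\<mu>, rule int_\<nu>)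
  have [simp]: "space plan = UNIV" using sets_eq_imp_space_eq[OF sets_plan] by simp
  have [measurable]: "fst \<in> borel_measurable plan" "snd \<in> borel_measurable plan"
    using measurable_fst_borel[of "\<lambda>p. p" plan] measurable_snd_borel[of "\<lambda>p. p" plan] by auto
  interpret L: prob_space "kernel x" for x by (rule prob_space_kernel)
  have spk: "space (kernel x) = UNIV" for x using sets_eq_imp_space_eq[OF sets_kernel] by simp
  show "distr plan borel fst = \<mu>"
  proof (rule measure_eqI)
    fix A assume "A \<in> sets (distr plan borel fst)"
    then have [measurable]: "A \<in> sets borel" by simp
    have "emeasure (distr plan borel fst) A = emeasure plan (fst -` A)"
      by (simp add: emeasure_distr)
    also have "\<dots> = (\<integral>\<^sup>+x. emeasure (kernel x) {y. (x, y) \<in> fst -` A} \<partial>\<mu>)"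
      by (rule emeasure_plan) (use measurable_sets[of fst plan borel A] in simp)
    also have "\<dots> = (\<integral>\<^sup>+x. indicator A x \<partial>\<mu>)"
      using L.emeasure_space_1 by (intro nn_integral_cong) (auto simp: spk indicator_def)
    finally show "emeasure (distr plan borel fst) A = emeasure \<mu> A" by simp
  qed simp
  show "distr plan borel snd = \<nu>"
  proof (rule measure_eqI)
    show "sets (distr plan borel snd) = sets \<nu>" by (subst snd_\<pi>[symmetric]) simp
    fix A assume "A \<in> sets (distr plan borel snd)"
    then have [measurable]: "A \<in> sets borel" by simp
    have "emeasure (distr plan borel snd) A = (\<integral>\<^sup>+p. indicator A (snd p) \<partial>plan)"
      by (subst nn_integral_indicator[symmetric], simp, subst nn_integral_distr) simp_all
    also have "\<dots> = (\<integral>\<^sup>+p. ennreal (1 - out (fst p) (snd p)) * indicator A (snd p) \<partial>\<pi>) +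
      (\<integral>\<^sup>+p. ennreal (out (fst p) (snd p)) * indicator A (snd p) \<partial>\<pi>)"
      by (subst nn_integral_plan) (simp_all add: nn_integral_multc ennreal_out)
    also have "\<dots> = (\<integral>\<^sup>+p. ennreal (1 - out (fst p) (snd p)) * indicator A (snd p) +
      ennreal (out (fst p) (snd p)) * indicator A (snd p) \<partial>\<pi>)"
      by (rule nn_integral_add[symmetric]) measurable
    also have "\<dots> = (\<integral>\<^sup>+p. indicator A (snd p) \<partial>\<pi>)"
      using out_bounds by (intro nn_integral_cong) (simp flip: distrib_right ennreal_plus)
    also have "\<dots> = emeasure (distr \<pi> borel snd) A"
      by (subst nn_integral_indicator[symmetric], simp, subst nn_integral_distr) simp_all
    finally show "emeasure (distr plan borel snd) A = emeasure \<nu> A" by (simp add: snd_\<pi>)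
  qed
  show "is_disintegration kernel \<mu> plan"
    unfolding is_disintegration_def using measurable_kernel emeasure_plan by blast
  show "AE x in \<mu>. integrable (kernel x) (\<lambda>y. y) \<and> (\<integral>y. y \<partial>kernel x) = x"
    using mart by eventually_elim (use mean_kernel in auto)
qed simp_all

end

lemma (in martingale_kernel) plan_mem: "\<pi> \<in> martingale_plans \<mu> \<nu>"
  using fst_\<pi> snd_\<pi> disint mart unfolding martingale_plans_def by auto

section \<open>Change of cost under an exchange\<close>

context fibre_exchange
begin

text \<open>Mass moved from \<open>(x, y)\<close> to \<open>(s, y)\<close> changes the cost by
  \<open>c (s, y) - c (x, y)\<close>. Since \<open>w\<close> lives on a box where \<open>c\<close>
  is bounded, this change is integrable although \<open>c\<close> itself may be unbounded.\<close>

lemma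
  fixes c :: "real \<times> real \<Rightarrow> real"
  assumes [measurable]: "c \<in> borel_measurable borel" and ic: "integrable \<pi> c"
    and B: "\<And>x y. \<bar>x\<bar> \<le> N \<Longrightarrow> \<bar>y\<bar> \<le> N \<Longrightarrow> \<bar>c (x, y)\<bar> \<le> B"
  shows integrable_plan: "integrable plan c"
    and integral_plan: "(\<integral>p. c p \<partial>plan) = (\<integral>p. c p \<partial>\<pi>) +
      (\<integral>x. (\<integral>s. (\<integral>y. w x y s * (c (s, y) - c (x, y)) \<partial>K x) \<partial>\<mu>) \<partial>\<mu>)"
proof -
  interpret pair_prob_space \<pi> \<mu> ..
  have w1: "\<bar>w x y s * c (s, y)\<bar> \<le> \<bar>B\<bar>" and w2: "\<bar>w x y s * c (x, y)\<bar> \<le> \<bar>B\<bar>" for x y s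
  proof -
    have *: "\<bar>w x y s * d\<bar> \<le> \<bar>B\<bar>" if "w x y s \<noteq> 0 \<Longrightarrow> \<bar>d\<bar> \<le> B" for d
    proof (cases "w x y s = 0")
      case False
      then have "\<bar>w x y s\<bar> * \<bar>d\<bar> \<le> 1 * \<bar>B\<bar>"
        using w_nonneg w_le_1 that[OF False] by (intro mult_mono) auto
      then show ?thesis by (simp add: abs_mult)
    qed simp
    show "\<bar>w x y s * c (s, y)\<bar> \<le> \<bar>B\<bar>" "\<bar>w x y s * c (x, y)\<bar> \<le> \<bar>B\<bar>"
      using B w_support by (intro *; blast)+
  qed
  have [measurable]: "(\<lambda>q :: (real \<times> real) \<times> real. (snd q, snd (fst q))) \<in> \<pi> \<Otimes>\<^sub>M \<mu> \<rightarrow>\<^sub>M borel"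
    by (rule borel_measurable_Pair) measurable
  have io: "integrable \<pi> (\<lambda>p. out (fst p) (snd p) * c p)"
    by (rule Bochner_Integration.integrable_bound[OF ic])
      (use out_bounds in \<open>auto simp: abs_mult intro!: mult_left_le_one_le\<close>)
  have i1: "integrable (density \<pi> (\<lambda>p. ennreal (1 - out (fst p) (snd p)))) c"
  proof (subst integrable_real_density)
    show "integrable \<pi> (\<lambda>p. (1 - out (fst p) (snd p)) * c p)"
      unfolding left_diff_distrib using ic io by simp
  qed (use out_bounds in auto)
  have iw1: "integrable (\<pi> \<Otimes>\<^sub>M \<mu>) (\<lambda>q. w (fst (fst q)) (snd (fst q)) (snd q) * c (snd q, snd (fst q)))"
    by (rule P.integrable_const_bound[where B = "\<bar>B\<bar>"]) (use w1 in auto)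
  have iw2: "integrable (\<pi> \<Otimes>\<^sub>M \<mu>) (\<lambda>q. w (fst (fst q)) (snd (fst q)) (snd q) * c (fst q))"
  proof (rule P.integrable_const_bound[where B = "\<bar>B\<bar>"])
    show "AE q in \<pi> \<Otimes>\<^sub>M \<mu>. norm (w (fst (fst q)) (snd (fst q)) (snd q) * c (fst q)) \<le> \<bar>B\<bar>"
      using w2[of "fst (fst q)" "snd (fst q)" "snd q" for q] by (intro AE_I2) simp
  qed measurable
  have i2: "integrable (distr (density (\<pi> \<Otimes>\<^sub>M \<mu>) (\<lambda>q. ennreal (w (fst (fst q)) (snd (fst q)) (snd q)))) borel
      (\<lambda>q. (snd q, snd (fst q)))) c"
    using iw1 w_nonneg by (subst integrable_distr_eq) (simp_all add: integrable_real_density)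
  show "integrable plan c"
    unfolding plan_def by (rule integrable_add_measure) (use i1 i2 in auto)
  have outc: "(\<integral>p. out (fst p) (snd p) * c p \<partial>\<pi>) =
      (\<integral>q. w (fst (fst q)) (snd (fst q)) (snd q) * c (fst q) \<partial>(\<pi> \<Otimes>\<^sub>M \<mu>))"
    using integral_fst'[OF iw2] by (simp add: out_def)
  have "(\<integral>p. c p \<partial>plan) = (\<integral>p. (1 - out (fst p) (snd p)) * c p \<partial>\<pi>) +
      (\<integral>q. w (fst (fst q)) (snd (fst q)) (snd q) * c (snd q, snd (fst q)) \<partial>(\<pi> \<Otimes>\<^sub>M \<mu>))"
    unfolding plan_def using out_bounds w_nonneg
    by (subst integral_add_measure[OF _ i1 i2])
      (simp_all add: integral_real_density integral_distr)
  also have "\<dots> = (\<integral>p. c p \<partial>\<pi>) +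
      (\<integral>q. w (fst (fst q)) (snd (fst q)) (snd q) * (c (snd q, snd (fst q)) - c (fst q)) \<partial>(\<pi> \<Otimes>\<^sub>M \<mu>))"
    unfolding left_diff_distrib right_diff_distrib using ic io iw1 iw2 by (simp add: outc)
  also have "(\<integral>q. w (fst (fst q)) (snd (fst q)) (snd q) * (c (snd q, snd (fst q)) - c (fst q)) \<partial>(\<pi> \<Otimes>\<^sub>M \<mu>)) =
      (\<integral>p. (\<integral>s. w (fst p) (snd p) s * (c (s, snd p) - c p) \<partial>\<mu>) \<partial>\<pi>)"
    using integral_fst'[of "\<lambda>q. w (fst (fst q)) (snd (fst q)) (snd q) * (c (snd q, snd (fst q)) - c (fst q))"] iw1 iw2
    by (simp add: right_diff_distrib)
  also have "\<dots> = (\<integral>x. (\<integral>y. (\<integral>s. w x y s * (c (s, y) - c (x, y)) \<partial>\<mu>) \<partial>K x) \<partial>\<mu>)"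
  proof -
    have "integrable \<pi> (\<lambda>p. (\<integral>s. w (fst p) (snd p) s * (c (s, snd p) - c p) \<partial>\<mu>))"
      using integrable_fst'[of "\<lambda>q. w (fst (fst q)) (snd (fst q)) (snd q) * (c (snd q, snd (fst q)) - c (fst q))"] iw1 iw2
      by (simp add: right_diff_distrib)
    from integral_\<pi>(3)[OF this] show ?thesis by simp
  qed
  also have "\<dots> = (\<integral>x. (\<integral>s. (\<integral>y. w x y s * (c (s, y) - c (x, y)) \<partial>K x) \<partial>\<mu>) \<partial>\<mu>)"
  proof (rule Bochner_Integration.integral_cong[OF refl])
    fix x
    show "(\<integral>y. (\<integral>s. w x y s * (c (s, y) - c (x, y)) \<partial>\<mu>) \<partial>K x) = (\<integral>s. (\<integral>y. w x y s * (c (s, y) - c (x, y)) \<partial>K x) \<partial>\<mu>)"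
    proof (rule bounded_kernel_integral[where B = "2 * \<bar>B\<bar>"])
      show "\<bar>w x y s * (c (s, y) - c (x, y))\<bar> \<le> 2 * \<bar>B\<bar>" for y s
        using w1[of x y s] w2[of x y s] unfolding right_diff_distrib by linarith
    qed measurable
  qed
  finally show "(\<integral>p. c p \<partial>plan) = (\<integral>p. c p \<partial>\<pi>) +
      (\<integral>x. (\<integral>s. (\<integral>y. w x y s * (c (s, y) - c (x, y)) \<partial>K x) \<partial>\<mu>) \<partial>\<mu>)" .
qed

text \<open>Twice the double integral of \<open>\<Phi>\<close> is that of
  \<open>\<Phi> x s + \<Phi> s x\<close>, which is nonpositive. If the total is not negative, the
  sum vanishes almost everywhere, so \<open>S \<times> T\<close> is null for the product measure and
  one factor is null.\<close>

lemma null_of_no_gain: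
  fixes c :: "real \<times> real \<Rightarrow> real"
  defines "\<Phi> x s \<equiv> \<integral>y. w x y s * (c (s, y) - c (x, y)) \<partial>K x"
  assumes [measurable]: "c \<in> borel_measurable borel"
    and B: "\<And>x y. \<bar>x\<bar> \<le> N \<Longrightarrow> \<bar>y\<bar> \<le> N \<Longrightarrow> \<bar>c (x, y)\<bar> \<le> B"
    and no_gain: "0 \<le> (\<integral>x. (\<integral>s. \<Phi> x s \<partial>\<mu>) \<partial>\<mu>)"
    and le: "\<And>x s. \<Phi> x s + \<Phi> s x \<le> 0"
    and less: "\<And>x s. x \<in> S \<Longrightarrow> s \<in> T \<Longrightarrow> \<Phi> x s + \<Phi> s x < 0"
    and [measurable]: "S \<in> sets borel" "T \<in> sets borel"
  shows "emeasure \<mu> S = 0 \<or> emeasure \<mu> T = 0"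
proof -
  interpret MM: pair_prob_space \<mu> \<mu> ..
  have bnd: "\<bar>w x y s * (c (s, y) - c (x, y))\<bar> \<le> 2 * \<bar>B\<bar>" for x y s
  proof (cases "w x y s = 0")
    case False
    then have "\<bar>c (s, y)\<bar> \<le> B" "\<bar>c (x, y)\<bar> \<le> B" using B w_support by blast+
    then have "\<bar>c (s, y) - c (x, y)\<bar> \<le> 2 * \<bar>B\<bar>" by linarith
    then have "\<bar>w x y s\<bar> * \<bar>c (s, y) - c (x, y)\<bar> \<le> 1 * (2 * \<bar>B\<bar>)"
      using w_nonneg w_le_1 by (intro mult_mono) auto
    then show ?thesis by (simp add: abs_mult)
  qed simp
  have [measurable]: "(\<lambda>q. \<Phi> (fst q) (snd q)) \<in> borel_measurable (\<mu> \<Otimes>\<^sub>M \<mu>)"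
    unfolding \<Phi>_def by measurable
  have "\<bar>\<Phi> x s\<bar> \<le> 2 * \<bar>B\<bar>" for x s
  proof -
    have "norm (\<Phi> x s) \<le> (\<integral>y. 2 * \<bar>B\<bar> \<partial>K x)"
      unfolding \<Phi>_def
      by (rule Bochner_Integration.integral_norm_bound_integral)
        (use bnd in \<open>auto intro!: K.integrable_const_bound[where B = "2 * \<bar>B\<bar>"]\<close>)
    then show ?thesis by (simp add: K.prob_space[simplified])
  qed
  then have i: "integrable (\<mu> \<Otimes>\<^sub>M \<mu>) (\<lambda>(x, s). \<Phi> x s)"
    by (intro MM.P.integrable_const_bound[where B = "2 * \<bar>B\<bar>"]) (auto simp: split_beta)
  have i': "integrable (\<mu> \<Otimes>\<^sub>M \<mu>) (\<lambda>(x, s). \<Phi> s x)"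
    using MM.integrable_product_swap[OF i] by simp
  have "(\<integral>q. (case q of (x, s) \<Rightarrow> \<Phi> s x) \<partial>(\<mu> \<Otimes>\<^sub>M \<mu>)) = (\<integral>q. (case q of (x, s) \<Rightarrow> \<Phi> x s) \<partial>(\<mu> \<Otimes>\<^sub>M \<mu>))"
    using MM.integral_product_swap[OF borel_measurable_integrable[OF i]] by simp
  moreover have "(\<integral>q. (case q of (x, s) \<Rightarrow> \<Phi> x s) \<partial>(\<mu> \<Otimes>\<^sub>M \<mu>)) = (\<integral>x. (\<integral>s. \<Phi> x s \<partial>\<mu>) \<partial>\<mu>)"
    by (rule MM.integral_fst[OF i, symmetric])
  ultimately have ge: "0 \<le> (\<integral>q. (case q of (x, s) \<Rightarrow> \<Phi> x s + \<Phi> s x) \<partial>(\<mu> \<Otimes>\<^sub>M \<mu>))"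
    using i i' no_gain by (simp add: case_prod_beta')
  have neg: "integrable (\<mu> \<Otimes>\<^sub>M \<mu>) (\<lambda>(x, s). - (\<Phi> x s + \<Phi> s x))"
    using i i' by (simp add: case_prod_beta')
  have nn: "AE q in \<mu> \<Otimes>\<^sub>M \<mu>. 0 \<le> (case q of (x, s) \<Rightarrow> - (\<Phi> x s + \<Phi> s x))"
  proof (rule AE_I2)
    fix q show "0 \<le> (case q of (x, s) \<Rightarrow> - (\<Phi> x s + \<Phi> s x))"
      using le[of "fst q" "snd q"] unfolding case_prod_beta' by linarith
  qed
  have "(\<integral>q. (case q of (x, s) \<Rightarrow> - (\<Phi> x s + \<Phi> s x)) \<partial>(\<mu> \<Otimes>\<^sub>M \<mu>)) = 0"
    using ge integral_nonneg_AE[OF nn] i i' by (simp add: case_prod_beta')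
  then have "AE q in \<mu> \<Otimes>\<^sub>M \<mu>. (case q of (x, s) \<Rightarrow> - (\<Phi> x s + \<Phi> s x)) = 0"
    using integral_nonneg_eq_0_iff_AE[OF neg nn] by blast
  then have "AE q in \<mu> \<Otimes>\<^sub>M \<mu>. q \<notin> S \<times> T"
    by eventually_elim (use less in force)
  then have "emeasure (\<mu> \<Otimes>\<^sub>M \<mu>) (S \<times> T) = 0"
    by (subst (asm) AE_iff_measurable[where N = "S \<times> T"]) (auto simp: space_pair_measure)
  then show ?thesis
    by (subst (asm) \<mu>.emeasure_pair_measure_Times) auto
qed

end

text \<open>\<open>y - x\<close> and \<open>z - s\<close> lie strictly between \<open>y - s\<close>
  and \<open>z - x\<close> and have the same sum; \<open>u\<close> and \<open>v\<close> are the
  weights. Read for \<open>g = h'\<close>, this says that \<open>h (y - x) - h (y - s)\<close> has a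
  strictly increasing derivative in \<open>y\<close>.\<close>

lemma strictly_convex_four_points:
  assumes g: "strictly_convex_on UNIV g" and xs: "x < s" and yz: "y < z"
  shows "g (y - x) + g (z - s) < g (y - s) + g (z - x)"
proof -
  define d where "d = (z - y) + (s - x)"
  have d: "d > 0" using xs yz by (simp add: d_def)
  define u v where "u = (s - x) / d" and "v = (z - y) / d"
  have uv: "u > 0" "v > 0" "u + v = 1"
    using d xs yz by (auto simp: u_def v_def d_def add_divide_distrib[symmetric])
  have dd: "u * d = s - x" "v * d = z - y" using d by (auto simp: u_def v_def)
  have e: "z - x = (y - s) + d" by (simp add: d_def)
  have 1: "v * (y - s) + u * (z - x) = y - x"
  proof -
    have "v * (y - s) + u * (z - x) = (u + v) * (y - s) + u * d" unfolding e by (simp add: algebra_simps)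
    then show ?thesis using uv(3) dd by simp
  qed
  have 2: "u * (y - s) + v * (z - x) = z - s"
  proof -
    have "u * (y - s) + v * (z - x) = (u + v) * (y - s) + v * d" unfolding e by (simp add: algebra_simps)
    then show ?thesis using uv(3) dd by simp
  qed
  have ne: "y - s \<noteq> z - x" using xs yz by simp
  have "g (v * (y - s) + u * (z - x)) < v * g (y - s) + u * g (z - x)"
    using g uv ne unfolding strictly_convex_on_def by (metis UNIV_I add.commute)
  moreover have "g (u * (y - s) + v * (z - x)) < u * g (y - s) + v * g (z - x)"
    using g uv ne unfolding strictly_convex_on_def by (metis UNIV_I)
  ultimately have "g (y - x) + g (z - s) < (u + v) * g (y - s) + (u + v) * g (z - x)"
    unfolding 1 2 by (simp add: algebra_simps)
  then show ?thesis using uv(3) by simp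
qed

lemma strictly_convex_imp_convex:
  assumes "strictly_convex_on UNIV g"
  shows "convex_on UNIV g"
proof (rule convex_onI)
  fix t x y :: real assume t: "0 < t" "t < 1"
  show "g ((1 - t) *\<^sub>R x + t *\<^sub>R y) \<le> (1 - t) * g x + t * g y"
  proof (cases "x = y")
    case False
    have "\<forall>u>0. \<forall>v>0. x \<noteq> y \<and> u + v = 1 \<longrightarrow> g (u * x + v * y) < u * g x + v * g y"
      using assms by (simp add: strictly_convex_on_def)
    from this[rule_format, of "1 - t" t] show ?thesis using t False by simp
  qed (simp add: algebra_simps)
qed simp

text \<open>Subtracting from \<open>h (y - x) - h (y - s)\<close> its chord through
  \<open>q1\<close> and \<open>q2\<close> leaves a function with zeros at \<open>q1\<close> and
  \<open>q2\<close> that strictly decreases up to the mean-value point \<open>\<xi>\<close> and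
  strictly increases after it.\<close>

lemma strict_chord:
  assumes g: "strictly_convex_on UNIV g" and h: "\<And>x. (h has_real_derivative g x) (at x)"
    and xs: "x < s" and q: "q1 < q2"
  obtains \<alpha> \<beta> where
    "\<And>y. y \<le> q1 \<or> q2 \<le> y \<Longrightarrow> \<alpha> + \<beta> * y \<le> h (y - x) - h (y - s)"
    "\<And>y. q1 < y \<Longrightarrow> y < q2 \<Longrightarrow> h (y - x) - h (y - s) < \<alpha> + \<beta> * y"
proof -
  define D where "D y = h (y - x) - h (y - s)" for y
  define D' where "D' y = g (y - x) - g (y - s)" for y
  define \<beta> where "\<beta> = (D q2 - D q1) / (q2 - q1)"
  define \<alpha> where "\<alpha> = D q1 - \<beta> * q1"
  define e where "e y = D y - (\<alpha> + \<beta> * y)" for y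
  have shift: "((\<lambda>y. h (y - a)) has_real_derivative g (y - a)) (at y)" for a y
    using DERIV_shift[of h "g (y - a)" y "- a"] h[of "y - a"] by simp
  have de: "(e has_real_derivative (D' y - \<beta>)) (at y)" for y
    unfolding e_def D_def D'_def by (auto intro!: derivative_eq_intros shift)
  have mono: "D' y < D' z" if "y < z" for y z
    using strictly_convex_four_points[OF g xs that] by (simp add: D'_def)
  have "\<beta> * (q2 - q1) = D q2 - D q1" using q by (simp add: \<beta>_def)
  then have e12: "e q1 = 0" "e q2 = 0" by (auto simp: e_def \<alpha>_def algebra_simps)
  obtain \<xi> where \<xi>: "q1 < \<xi>" "\<xi> < q2" "e q2 - e q1 = (q2 - q1) * (D' \<xi> - \<beta>)"
    using MVT2[OF q de] by blast
  then have z: "D' \<xi> = \<beta>" using e12 q by simp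
  have dec: "e b < e a" if ab: "a < b" "b \<le> \<xi>" for a b
  proof -
    obtain \<zeta> where "a < \<zeta>" "\<zeta> < b" "e b - e a = (b - a) * (D' \<zeta> - \<beta>)"
      using MVT2[OF ab(1) de] by blast
    moreover from this have "D' \<zeta> < \<beta>" using mono[of \<zeta> \<xi>] ab z by simp
    ultimately have "e b - e a < 0" using ab(1) by (simp add: mult_less_0_iff)
    then show ?thesis by simp
  qed
  have inc: "e a < e b" if ab: "a < b" "\<xi> \<le> a" for a b
  proof -
    obtain \<zeta> where "a < \<zeta>" "\<zeta> < b" "e b - e a = (b - a) * (D' \<zeta> - \<beta>)"
      using MVT2[OF ab(1) de] by blast
    moreover from this have "\<beta> < D' \<zeta>" using mono[of \<xi> \<zeta>] ab z by simp
    ultimately have "0 < e b - e a" using ab(1) by (simp add: zero_less_mult_iff)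
    then show ?thesis by simp
  qed
  show thesis
  proof (rule that)
    fix y assume "y \<le> q1 \<or> q2 \<le> y"
    then have "0 \<le> e y"
      using dec[of y q1] inc[of q2 y] e12 \<xi> by (cases "y = q1 \<or> y = q2") auto
    then show "\<alpha> + \<beta> * y \<le> h (y - x) - h (y - s)" by (simp add: e_def D_def)
  next
    fix y assume "q1 < y" "y < q2"
    then have "e y < 0"
      using dec[of q1 y] inc[of y q2] e12 by (cases "y \<le> \<xi>") auto
    then show "h (y - x) - h (y - s) < \<alpha> + \<beta> * y" by (simp add: e_def D_def)
  qed
qed

section \<open>Optimal plans are left-monotone\<close>

context martingale_kernel
begin

lemma measurable_emeasure_K[measurable (raw)]:
  assumes [measurable]: "f \<in> borel_measurable M" "A \<in> sets borel"
  shows "(\<lambda>\<omega>. emeasure (K (f \<omega>)) A) \<in> borel_measurable M"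
proof -
  have "(\<lambda>\<omega>. \<integral>\<^sup>+y. indicator A y \<partial>K (f \<omega>)) \<in> borel_measurable M" by measurable
  then show ?thesis by simp
qed

lemma
  fixes A :: "real set" and N q :: real
  assumes [measurable]: "A \<in> sets borel" and A: "\<And>y. y \<in> A \<Longrightarrow> \<bar>y\<bar> \<le> N"
  shows integrable_indicator_id: "integrable (K x) (\<lambda>y. indicator A y * y)"
    and integral_indicator_id_bound: "\<bar>\<integral>y. indicator A y * y \<partial>K x\<bar> \<le> \<bar>N\<bar>"
    and integral_indicator_id_le: "(\<And>y. y \<in> A \<Longrightarrow> y \<le> q) \<Longrightarrow>
      (\<integral>y. indicator A y * y \<partial>K x) \<le> q * (\<integral>y. indicat_real A y \<partial>K x)"
    and integral_indicator_id_ge: "(\<And>y. y \<in> A \<Longrightarrow> q \<le> y) \<Longrightarrow>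
      q * (\<integral>y. indicat_real A y \<partial>K x) \<le> (\<integral>y. indicator A y * y \<partial>K x)"
proof -
  have b: "\<bar>indicator A y * y\<bar> \<le> \<bar>N\<bar>" for y using A[of y] by (auto simp: indicator_def)
  show i: "integrable (K x) (\<lambda>y. indicator A y * y)"
    by (rule K.integrable_const_bound[where B = "\<bar>N\<bar>"]) (use b in auto)
  have "norm (\<integral>y. indicator A y * y \<partial>K x) \<le> (\<integral>y. \<bar>N\<bar> \<partial>K x)"
    by (rule Bochner_Integration.integral_norm_bound_integral[OF i]) (use b in auto)
  then show "\<bar>\<integral>y. indicator A y * y \<partial>K x\<bar> \<le> \<bar>N\<bar>"
    by (simp add: K.prob_space[simplified])
  have j: "integrable (K x) (\<lambda>y. q * indicator A y)" for q :: real
    by (rule K.integrable_const_bound[where B = "\<bar>q\<bar>"]) (auto simp: indicator_def)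
  have e: "q * (\<integral>y. indicat_real A y \<partial>K x) = (\<integral>y. q * indicator A y \<partial>K x)" for q :: real
    by simp
  show "(\<integral>y. indicator A y * y \<partial>K x) \<le> q * (\<integral>y. indicat_real A y \<partial>K x)" if "\<And>y. y \<in> A \<Longrightarrow> y \<le> q"
    unfolding e by (rule integral_mono[OF i j]) (use that in \<open>auto simp: indicator_def\<close>)
  show "q * (\<integral>y. indicat_real A y \<partial>K x) \<le> (\<integral>y. indicator A y * y \<partial>K x)" if "\<And>y. y \<in> A \<Longrightarrow> q \<le> y"
    unfolding e by (rule integral_mono[OF j i]) (use that in \<open>auto simp: indicator_def\<close>)
qed

text \<open>In \<open>no_crossing_box\<close> fibres over \<open>x \<in> E1\<close> give mass on \<open>L \<union> R\<close> and receive mass on \<open>J\<close>, fibres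
  over \<open>s \<in> E2\<close> do the opposite. The weights come from moving, for every \<open>y1 \<in> L\<close>, \<open>y2 \<in> R\<close> and \<open>y' \<in> J\<close>, the
  masses \<open>y2 - y'\<close> at \<open>y1\<close> and \<open>y' - y1\<close> at \<open>y2\<close> from \<open>x\<close> to \<open>s\<close> against the mass \<open>y2 - y1\<close> at \<open>y'\<close>,
  averaged over the fibres. The chord through \<open>q1\<close> and \<open>q2\<close> of the strictly convex function
  \<open>c x y - c s y\<close> of \<open>y\<close> is not seen by a balanced exchange, so every such exchange lowers the cost.\<close>

lemma no_crossing_box:
  assumes g: "strictly_convex_on UNIV g" and h: "\<And>x. (h has_real_derivative g x) (at x)"
    and ic: "integrable \<pi> (\<lambda>p. h (snd p - fst p))"
    and opt: "\<And>\<pi>' K'. martingale_kernel \<mu> \<nu> \<pi>' K' \<Longrightarrow> integrable \<pi>' (\<lambda>p. h (snd p - fst p)) \<Longrightarrow>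
      (\<integral>p. h (snd p - fst p) \<partial>\<pi>) \<le> (\<integral>p. h (snd p - fst p) \<partial>\<pi>')"
    and q: "q1 < q2"
  shows "(AE x in \<mu>. x \<in> {- n..t} \<longrightarrow> emeasure (K x) {- n..<q1} = 0 \<or> emeasure (K x) {q2<..n} = 0) \<or>
    (AE s in \<mu>. s \<in> {t<..n} \<longrightarrow> emeasure (K s) {q1<..<q2} = 0)"
proof -
  define N where "N = \<bar>n\<bar> + \<bar>t\<bar> + \<bar>q1\<bar> + \<bar>q2\<bar>"
  define E1 E2 L R J where "E1 = {- n..t}" and "E2 = {t<..n}" and "L = {- n..<q1}" and "R = {q2<..n}"
    and "J = {q1<..<q2}"
  note defs = E1_def E2_def L_def R_def J_def
  have N0: "0 \<le> N" by (simp add: N_def)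
  have box: "y \<in> E1 \<or> y \<in> E2 \<or> y \<in> L \<or> y \<in> R \<or> y \<in> J \<Longrightarrow> \<bar>y\<bar> \<le> N" for y
    by (auto simp: defs N_def)
  have [measurable]: "E1 \<in> sets borel" "E2 \<in> sets borel" "L \<in> sets borel" "R \<in> sets borel" "J \<in> sets borel"
    by (auto simp: defs)
  \<comment> \<open>Mass and first moment of the fibres on \<open>L\<close>, \<open>R\<close> and
    \<open>J\<close>. Averages over triples become polynomials in them: for
    \<open>x \<in> E1\<close> and \<open>s \<in> E2\<close>, \<open>a2 x * P s - p2 x * Q s\<close>
    is the integral of \<open>y2 - y'\<close> over \<open>y2 \<in> R\<close> under
    \<open>K x\<close> and \<open>y' \<in> J\<close> under \<open>K s\<close>.\<close>
  define p1 where "p1 x = indicator E1 x * (\<integral>y. indicat_real L y \<partial>K x)" for x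
  define a1 where "a1 x = indicator E1 x * (\<integral>y. indicator L y * y \<partial>K x)" for x
  define p2 where "p2 x = indicator E1 x * (\<integral>y. indicat_real R y \<partial>K x)" for x
  define a2 where "a2 x = indicator E1 x * (\<integral>y. indicator R y * y \<partial>K x)" for x
  define P where "P x = indicator E2 x * (\<integral>y. indicat_real J y \<partial>K x)" for x
  define Q where "Q x = indicator E2 x * (\<integral>y. indicator J y * y \<partial>K x)" for x
  \<comment> \<open>For \<open>x \<in> E1\<close> this is the integral of \<open>y2 - y1\<close>
    over \<open>L \<times> R\<close>, positive as soon as the fibre charges both sides.\<close>
  define G where "G x = p1 x * a2 x - a1 x * p2 x" for x
  \<comment> \<open>Each of the three terms of \<open>w\<close> is at most \<open>2 * N\<close>; the
    added 1 keeps the denominator positive.\<close>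
  define \<epsilon> where "\<epsilon> = 1 / (6 * N + 1)"
  define w where "w x y s = \<epsilon> * (indicator L y * (a2 x * P s - p2 x * Q s) +
    indicator R y * (p1 x * Q s - a1 x * P s) + indicator E2 x * indicator J y * G s)" for x y s
  have \<epsilon>: "0 < \<epsilon>" using N0 by (simp add: \<epsilon>_def)
  have [measurable]: "p1 \<in> borel_measurable borel" "a1 \<in> borel_measurable borel" "p2 \<in> borel_measurable borel"
    "a2 \<in> borel_measurable borel" "P \<in> borel_measurable borel" "Q \<in> borel_measurable borel"
    unfolding p1_def a1_def p2_def a2_def P_def Q_def by measurable
  have [measurable]: "G \<in> borel_measurable borel" unfolding G_def by measurable
  have "0 \<le> (\<integral>y. indicat_real A y \<partial>K x)" "(\<integral>y. indicat_real A y \<partial>K x) \<le> 1" if "A \<in> sets borel" for A x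
    using that by simp_all
  then have p01: "0 \<le> p1 x" "p1 x \<le> 1" "0 \<le> p2 x" "p2 x \<le> 1" "0 \<le> P x" "P x \<le> 1" for x
    by (auto simp: p1_def p2_def P_def indicator_def)
  have aN: "\<bar>a1 x\<bar> \<le> N" "\<bar>a2 x\<bar> \<le> N" "\<bar>Q x\<bar> \<le> N" for x
    using integral_indicator_id_bound[of L N x] integral_indicator_id_bound[of R N x]
      integral_indicator_id_bound[of J N x] box N0
    by (auto simp: a1_def a2_def Q_def indicator_def)
  have a1: "a1 x \<le> q1 * p1 x" for x
    using integral_indicator_id_le[of L N q1 x] box by (auto simp: a1_def p1_def indicator_def L_def)
  have a2: "q2 * p2 x \<le> a2 x" for x
    using integral_indicator_id_ge[of R N q2 x] box by (auto simp: a2_def p2_def indicator_def R_def)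
  have QP: "q1 * P x \<le> Q x" "Q x \<le> q2 * P x" for x
    using integral_indicator_id_ge[of J N q1 x] integral_indicator_id_le[of J N q2 x] box
    by (auto simp: Q_def P_def indicator_def J_def)
  have t1: "0 \<le> a2 x * P s - p2 x * Q s" for x s
    using mult_right_mono[OF a2[of x] p01(5)[of s]] mult_left_mono[OF QP(2)[of s] p01(3)[of x]]
    by (simp add: algebra_simps)
  have t2: "0 \<le> p1 x * Q s - a1 x * P s" for x s
    using mult_right_mono[OF a1[of x] p01(5)[of s]] mult_left_mono[OF QP(1)[of s] p01(1)[of x]]
    by (simp add: algebra_simps)
  have t3: "(q2 - q1) * (p1 x * p2 x) \<le> G x" for x
    using mult_right_mono[OF a1[of x] p01(3)[of x]] mult_left_mono[OF a2[of x] p01(1)[of x]]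
    unfolding G_def by (simp add: algebra_simps)
  have G0: "0 \<le> G x" for x
    using t3[of x] q p01[of x] by (meson diff_ge_0_iff_ge less_imp_le mult_nonneg_nonneg order_trans)
  have prod_bound: "\<bar>u * v\<bar> \<le> N" if "\<bar>u\<bar> \<le> N" "0 \<le> v" "v \<le> 1" for u v
    using mult_mono[OF that(1), of "\<bar>v\<bar>" 1] that N0 by (simp add: abs_mult)
  have b1: "a2 x * P s - p2 x * Q s \<le> 2 * N" for x s
    using prod_bound[OF aN(2)[of x] p01(5,6)[of s]] prod_bound[OF aN(3)[of s] p01(3,4)[of x]]
    by (simp add: mult.commute)
  have b2: "p1 x * Q s - a1 x * P s \<le> 2 * N" for x s
    using prod_bound[OF aN(1)[of x] p01(5,6)[of s]] prod_bound[OF aN(3)[of s] p01(1,2)[of x]]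
    by (simp add: mult.commute)
  have b3: "G x \<le> 2 * N" for x
    using prod_bound[OF aN(1)[of x] p01(3,4)[of x]] prod_bound[OF aN(2)[of x] p01(1,2)[of x]]
    by (simp add: G_def mult.commute)
  have off1: "p1 x = 0" "a1 x = 0" "p2 x = 0" "a2 x = 0" "G x = 0" if "x \<notin> E1" for x
    using that by (auto simp: p1_def a1_def p2_def a2_def G_def)
  have off2: "P x = 0" "Q x = 0" if "x \<notin> E2" for x
    using that by (auto simp: P_def Q_def)
  have disj: "x \<notin> E2" if "x \<in> E1" for x using that by (auto simp: defs)

  have wint: "(\<integral>y. w x y s * \<theta> y \<partial>K x) = \<epsilon> * ((a2 x * P s - p2 x * Q s) * (\<integral>y. indicator L y * \<theta> y \<partial>K x) +
      (p1 x * Q s - a1 x * P s) * (\<integral>y. indicator R y * \<theta> y \<partial>K x) +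
      indicator E2 x * G s * (\<integral>y. indicator J y * \<theta> y \<partial>K x))"
    if "\<And>A. A \<in> {L, R, J} \<Longrightarrow> integrable (K x) (\<lambda>y. indicator A y * \<theta> y)" for x s \<theta>
  proof -
    have "w x y s * \<theta> y = \<epsilon> * ((a2 x * P s - p2 x * Q s) * (indicator L y * \<theta> y) +
      (p1 x * Q s - a1 x * P s) * (indicator R y * \<theta> y) +
      indicator E2 x * G s * (indicator J y * \<theta> y))" for y
      by (simp add: w_def algebra_simps)
    then show ?thesis using that by simp
  qed
  have iI: "integrable (K x) (indicator A :: real \<Rightarrow> real)" if "A \<in> {L, R, J}" for A x
    using that by (intro K.integrable_const_bound[where B = 1]) (auto simp: indicator_def)
  have iY: "integrable (K x) (\<lambda>y. indicator A y * y)" if "A \<in> {L, R, J}" for A x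
    using that box by (intro integrable_indicator_id[where N = N]) auto

  \<comment> \<open>The terms with \<open>p1 x * p2 x * Q s\<close> cancel, and what remains is
    symmetric in \<open>x\<close> and \<open>s\<close>, which is the balance of mass. In
    \<open>bal1\<close> the same happens for the first moments.\<close>
  have bal0: "(\<integral>y. w x y s \<partial>K x) = \<epsilon> * (G x * P s + P x * G s)" for x s
  proof -
    have "(\<integral>y. w x y s \<partial>K x) = \<epsilon> * ((a2 x * P s - p2 x * Q s) * (\<integral>y. indicat_real L y \<partial>K x) +
      (p1 x * Q s - a1 x * P s) * (\<integral>y. indicat_real R y \<partial>K x) +
      indicator E2 x * G s * (\<integral>y. indicat_real J y \<partial>K x))"
      using wint[of x "\<lambda>_. 1" s] iI by simp
    also have "(a2 x * P s - p2 x * Q s) * (\<integral>y. indicat_real L y \<partial>K x) = (a2 x * P s - p2 x * Q s) * p1 x"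
      by (cases "x \<in> E1") (simp_all add: p1_def off1)
    also have "(p1 x * Q s - a1 x * P s) * (\<integral>y. indicat_real R y \<partial>K x) = (p1 x * Q s - a1 x * P s) * p2 x"
      by (cases "x \<in> E1") (simp_all add: p2_def off1)
    also have "indicator E2 x * G s * (\<integral>y. indicat_real J y \<partial>K x) = G s * P x"
      by (simp add: P_def)
    finally show ?thesis by (simp add: G_def algebra_simps)
  qed
  have bal1: "(\<integral>y. w x y s * y \<partial>K x) = \<epsilon> * (G x * Q s + Q x * G s)" for x s
  proof -
    have "(\<integral>y. w x y s * y \<partial>K x) = \<epsilon> * ((a2 x * P s - p2 x * Q s) * (\<integral>y. indicator L y * y \<partial>K x) +
      (p1 x * Q s - a1 x * P s) * (\<integral>y. indicator R y * y \<partial>K x) +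
      indicator E2 x * G s * (\<integral>y. indicator J y * y \<partial>K x))"
      using wint[of x "\<lambda>y. y" s] iY by simp
    also have "(a2 x * P s - p2 x * Q s) * (\<integral>y. indicator L y * y \<partial>K x) = (a2 x * P s - p2 x * Q s) * a1 x"
      by (cases "x \<in> E1") (simp_all add: a1_def off1)
    also have "(p1 x * Q s - a1 x * P s) * (\<integral>y. indicator R y * y \<partial>K x) = (p1 x * Q s - a1 x * P s) * a2 x"
      by (cases "x \<in> E1") (simp_all add: a2_def off1)
    also have "indicator E2 x * G s * (\<integral>y. indicator J y * y \<partial>K x) = G s * Q x"
      by (simp add: Q_def)
    finally show ?thesis by (simp add: G_def algebra_simps)
  qed

  interpret X: fibre_exchange \<mu> \<nu> \<pi> K w N
  proof
    show "(\<lambda>(x, y, s). w x y s) \<in> borel_measurable borel"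
      unfolding w_def split_beta by measurable
    fix x y s
    show "0 \<le> w x y s"
      unfolding w_def using \<epsilon> t1 t2 G0 by (intro mult_nonneg_nonneg add_nonneg_nonneg) auto
    have "indicator L y * (a2 x * P s - p2 x * Q s) \<le> 2 * N" "indicator R y * (p1 x * Q s - a1 x * P s) \<le> 2 * N"
      "indicator E2 x * indicator J y * G s \<le> 2 * N"
      using b1[of x s] b2[of x s] b3[of s] N0 by (auto simp: indicator_def)
    then have "w x y s \<le> \<epsilon> * (6 * N)"
      unfolding w_def using \<epsilon> by (intro mult_left_mono) auto
    also have "\<dots> \<le> 1" using N0 by (simp add: \<epsilon>_def)
    finally show "w x y s \<le> 1" .
    show "\<bar>x\<bar> \<le> N \<and> \<bar>y\<bar> \<le> N \<and> \<bar>s\<bar> \<le> N" if "w x y s \<noteq> 0"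
    proof -
      have "y \<in> L \<or> y \<in> R \<or> y \<in> J"
        using that by (auto simp: w_def indicator_def split: if_splits)
      moreover have "x \<in> E1 \<or> x \<in> E2"
        using that off1[of x] by (cases "x \<in> E1"; cases "x \<in> E2") (simp_all add: w_def)
      moreover have "s \<in> E1 \<or> s \<in> E2"
        using that off1[of s] off2[of s] by (cases "s \<in> E1"; cases "s \<in> E2") (simp_all add: w_def)
      ultimately show ?thesis using box by blast
    qed
    show "(\<integral>y. w x y s \<partial>K x) = (\<integral>y. w s y x \<partial>K s)"
      unfolding bal0 by (simp add: algebra_simps)
    show "(\<integral>y. w x y s * y \<partial>K x) = (\<integral>y. w s y x * y \<partial>K s)"
      unfolding bal1 by (simp add: algebra_simps)
  qed

  have conth: "continuous_on UNIV h" using h by (meson DERIV_isCont continuous_at_imp_continuous_on)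
  then have [measurable]: "h \<in> borel_measurable borel" by (rule borel_measurable_continuous_onI)
  have "compact (h ` {- (2 * N)..2 * N})"
    using conth by (intro compact_continuous_image) (auto intro: continuous_on_subset)
  then obtain B where B: "\<And>z. \<bar>z\<bar> \<le> 2 * N \<Longrightarrow> \<bar>h z\<bar> \<le> B"
  proof -
    obtain B where "\<And>v. v \<in> h ` {- (2 * N)..2 * N} \<Longrightarrow> norm v \<le> B"
      using compact_imp_bounded[OF \<open>compact (h ` {- (2 * N)..2 * N})\<close>] unfolding bounded_iff by blast
    then have "\<bar>h z\<bar> \<le> B" if "\<bar>z\<bar> \<le> 2 * N" for z
      using that by (auto simp: abs_le_iff)
    then show thesis by (rule that)
  qed
  define c where "c = (\<lambda>p :: real \<times> real. h (snd p - fst p))"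
  have [measurable]: "c \<in> borel_measurable borel" unfolding c_def by measurable
  have cB: "\<bar>c (x, y)\<bar> \<le> B" if "\<bar>x\<bar> \<le> N" "\<bar>y\<bar> \<le> N" for x y
    using that by (auto simp: c_def intro!: B)
  define \<Phi> where "\<Phi> x s = (\<integral>y. w x y s * (c (s, y) - c (x, y)) \<partial>K x)" for x s
  have ic': "integrable \<pi> c" using ic by (simp add: c_def)
  have gain: "0 \<le> (\<integral>x. (\<integral>s. \<Phi> x s \<partial>\<mu>) \<partial>\<mu>)"
    using X.integral_plan[OF _ ic' cB] X.integrable_plan[OF _ ic' cB] opt[OF X.martingale_kernel_plan]
    by (simp add: \<Phi>_def c_def)

  have core: "\<Phi> x s + \<Phi> s x \<le> 0 \<and> (0 < G x \<longrightarrow> 0 < P s \<longrightarrow> \<Phi> x s + \<Phi> s x < 0)"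
    if x: "x \<in> E1" and s: "s \<in> E2" for x s
  proof -
    have xs: "x < s" using x s by (auto simp: defs)
    obtain \<alpha> \<beta> where chord:
      "\<And>y. y \<le> q1 \<or> q2 \<le> y \<Longrightarrow> \<alpha> + \<beta> * y \<le> h (y - x) - h (y - s)"
      "\<And>y. q1 < y \<Longrightarrow> y < q2 \<Longrightarrow> h (y - x) - h (y - s) < \<alpha> + \<beta> * y"
      using strict_chord[OF g h xs q] by blast
    \<comment> \<open>Balance of mass and mean removes the chord from the change of cost. Only the
      deviation \<open>e\<close> remains, nonnegative on \<open>L\<close> and \<open>R\<close>,
      which leave \<open>x\<close>, and negative on \<open>J\<close>, which leaves
      \<open>s\<close>.\<close>
    define e where "e y = h (y - x) - h (y - s) - (\<alpha> + \<beta> * y)" for y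
    have [measurable]: "e \<in> borel_measurable borel" unfolding e_def by measurable
    have "\<bar>e y\<bar> \<le> 2 * \<bar>B\<bar> + \<bar>\<alpha>\<bar> + \<bar>\<beta>\<bar> * N" if "\<bar>y\<bar> \<le> N" for y
    proof -
      have "\<bar>h (y - x)\<bar> \<le> B" "\<bar>h (y - s)\<bar> \<le> B"
        using that box[of x] box[of s] x s by (auto intro!: B)
      moreover have "\<bar>\<beta> * y\<bar> \<le> \<bar>\<beta>\<bar> * N" using that by (simp add: abs_mult mult_left_mono)
      ultimately show ?thesis unfolding e_def by linarith
    qed
    then have we: "\<bar>w u y v * e y\<bar> \<le> 2 * \<bar>B\<bar> + \<bar>\<alpha>\<bar> + \<bar>\<beta>\<bar> * N" for u y v
    proof (cases "w u y v = 0")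
      case False
      then have "\<bar>e y\<bar> \<le> 2 * \<bar>B\<bar> + \<bar>\<alpha>\<bar> + \<bar>\<beta>\<bar> * N"
        using X.w_support \<open>\<And>y. \<bar>y\<bar> \<le> N \<Longrightarrow> \<bar>e y\<bar> \<le> 2 * \<bar>B\<bar> + \<bar>\<alpha>\<bar> + \<bar>\<beta>\<bar> * N\<close> by blast
      then have "\<bar>w u y v\<bar> * \<bar>e y\<bar> \<le> 1 * (2 * \<bar>B\<bar> + \<bar>\<alpha>\<bar> + \<bar>\<beta>\<bar> * N)"
        using X.w_nonneg X.w_le_1 by (intro mult_mono) auto
      then show ?thesis by (simp add: abs_mult)
    qed (use N0 in simp)
    have ie: "integrable (K u) (\<lambda>y. w u y v * e y)" for u v
      by (rule K.integrable_const_bound[where B = "2 * \<bar>B\<bar> + \<bar>\<alpha>\<bar> + \<bar>\<beta>\<bar> * N"]) (use we in auto)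
    have i0: "integrable (K u) (\<lambda>y. w u y v)" for u v
      by (rule K.integrable_const_bound[where B = 1]) (use X.w_nonneg X.w_le_1 in auto)
    have i1: "integrable (K u) (\<lambda>y. w u y v * y)" for u v
      by (rule K.integrable_const_bound[where B = "\<bar>N\<bar>"]) (use X.w_mult_bound in auto)
    have "\<Phi> x s = (\<integral>y. - (w x y s * e y) - (\<alpha> * w x y s + \<beta> * (w x y s * y)) \<partial>K x)"
      unfolding \<Phi>_def c_def e_def by (rule Bochner_Integration.integral_cong) (auto simp: algebra_simps)
    also have "\<dots> = - (\<integral>y. w x y s * e y \<partial>K x) - (\<alpha> * (\<integral>y. w x y s \<partial>K x) + \<beta> * (\<integral>y. w x y s * y \<partial>K x))"
      using ie i0 i1 by simp
    finally have 1: "\<Phi> x s = - (\<integral>y. w x y s * e y \<partial>K x) - (\<alpha> * (\<integral>y. w x y s \<partial>K x) + \<beta> * (\<integral>y. w x y s * y \<partial>K x))" .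
    have "\<Phi> s x = (\<integral>y. w s y x * e y + (\<alpha> * w s y x + \<beta> * (w s y x * y)) \<partial>K s)"
      unfolding \<Phi>_def c_def e_def by (rule Bochner_Integration.integral_cong) (auto simp: algebra_simps)
    also have "\<dots> = (\<integral>y. w s y x * e y \<partial>K s) + (\<alpha> * (\<integral>y. w s y x \<partial>K s) + \<beta> * (\<integral>y. w s y x * y \<partial>K s))"
      using ie i0 i1 by simp
    finally have 2: "\<Phi> x s + \<Phi> s x = - (\<integral>y. w x y s * e y \<partial>K x) + (\<integral>y. w s y x * e y \<partial>K s)"
      using 1 X.balance_mass[of x s] X.balance_mean[of x s] by simp
    have "s \<notin> E1" using s disj by blast
    have wx: "w x y s * e y \<ge> 0" for y
    proof (cases "y \<in> L \<or> y \<in> R")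
      case True
      then have "0 \<le> e y" using chord(1)[of y] by (auto simp: e_def L_def R_def)
      then show ?thesis using X.w_nonneg by simp
    next
      case False
      then show ?thesis using disj[OF x] by (simp add: w_def)
    qed
    have ws: "w s y x = \<epsilon> * (indicator J y * G x)" for y
      using s \<open>s \<notin> E1\<close> by (simp add: w_def off1)
    have ej: "e y < 0" if "y \<in> J" for y using chord(2)[of y] that by (auto simp: e_def J_def)
    have wsle: "0 \<le> - (w s y x * e y)" for y
      using ej[of y] G0[of x] \<epsilon> by (cases "y \<in> J") (auto simp: ws mult_nonneg_nonpos)
    have A: "0 \<le> (\<integral>y. w x y s * e y \<partial>K x)" using wx by (simp add: integral_nonneg)
    have C: "0 \<le> (\<integral>y. - (w s y x * e y) \<partial>K s)" by (intro integral_nonneg_AE AE_I2 wsle)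
    show ?thesis
    proof (intro conjI impI)
      show "\<Phi> x s + \<Phi> s x \<le> 0" unfolding 2 using A C by simp
      assume G: "0 < G x" and Ps: "0 < P s"
      \<comment> \<open>On \<open>J\<close>, \<open>w s y x\<close> is the positive constant
        \<open>\<epsilon> * G x\<close> and \<open>e\<close> is negative, so the integral vanishes
        only if \<open>K s\<close> gives \<open>J\<close> no mass.\<close>
      have "(\<integral>y. - (w s y x * e y) \<partial>K s) \<noteq> 0"
      proof
        assume "(\<integral>y. - (w s y x * e y) \<partial>K s) = 0"
        then have "AE y in K s. - (w s y x * e y) = 0"
          using integral_nonneg_eq_0_iff_AE[of "K s" "\<lambda>y. - (w s y x * e y)"] ie[of s x] wsle by simp
        then have "AE y in K s. indicator J y = (0 :: real)"
        proof eventually_elim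
          case (elim y)
          then show ?case using G \<epsilon> ej[of y] by (auto simp: ws indicator_def)
        qed
        then have "(\<integral>y. indicat_real J y \<partial>K s) = (0 :: real)" by (rule integral_eq_zero_AE)
        then show False using Ps by (simp add: P_def)
      qed
      then show "\<Phi> x s + \<Phi> s x < 0" unfolding 2 using A C by simp
    qed
  qed
  have le: "\<Phi> x s + \<Phi> s x \<le> 0" for x s
  proof -
    consider "x \<in> E1" "s \<in> E2" | "x \<in> E2" "s \<in> E1" | "\<not> (x \<in> E1 \<and> s \<in> E2)" "\<not> (x \<in> E2 \<and> s \<in> E1)"
      by blast
    then show ?thesis
    proof cases
      case 3
      have "w u y v = 0" if "\<not> (u \<in> E1 \<and> v \<in> E2)" "\<not> (u \<in> E2 \<and> v \<in> E1)" for u y v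
        using that off1[of u] off1[of v] off2[of v] by (auto simp: w_def indicator_def)
      then have "w x y s = 0" "w s y x = 0" for y using 3 by blast+
      then show ?thesis by (simp add: \<Phi>_def)
    qed (use core[of x s] core[of s x] in linarith)+
  qed
  have "emeasure \<mu> {x \<in> E1. 0 < G x} = 0 \<or> emeasure \<mu> {s \<in> E2. 0 < P s} = 0"
  proof (rule X.null_of_no_gain[where c = c and B = B])
    show "\<bar>c (x, y)\<bar> \<le> B" if "\<bar>x\<bar> \<le> N" "\<bar>y\<bar> \<le> N" for x y
      using that by (rule cB)
    show "0 \<le> (\<integral>x. (\<integral>s. (\<integral>y. w x y s * (c (s, y) - c (x, y)) \<partial>K x) \<partial>\<mu>) \<partial>\<mu>)"
      using gain by (simp add: \<Phi>_def)
    show "(\<integral>y. w x y s * (c (s, y) - c (x, y)) \<partial>K x) + (\<integral>y. w s y x * (c (x, y) - c (s, y)) \<partial>K s) \<le> 0" for x s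
      using le[of x s] by (simp add: \<Phi>_def)
    show "(\<integral>y. w x y s * (c (s, y) - c (x, y)) \<partial>K x) + (\<integral>y. w s y x * (c (x, y) - c (s, y)) \<partial>K s) < 0"
      if "x \<in> {x \<in> E1. 0 < G x}" "s \<in> {s \<in> E2. 0 < P s}" for x s
      using core[of x s] that by (simp add: \<Phi>_def)
  qed measurable
  then show ?thesis
  proof (elim disjE)
    assume "emeasure \<mu> {x \<in> E1. 0 < G x} = 0"
    then have "AE x in \<mu>. \<not> (x \<in> E1 \<and> 0 < G x)"
      by (subst AE_iff_measurable[OF _ refl]) auto
    then have "AE x in \<mu>. x \<in> E1 \<longrightarrow> emeasure (K x) L = 0 \<or> emeasure (K x) R = 0"
    proof eventually_elim
      case (elim x)
      show ?case
      proof (rule impI, rule ccontr)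
        assume x: "x \<in> E1" and "\<not> (emeasure (K x) L = 0 \<or> emeasure (K x) R = 0)"
        then have "0 < p1 x" "0 < p2 x"
          by (auto simp: p1_def p2_def K.emeasure_eq_measure measure_nonneg less_le)
        then have "0 < (q2 - q1) * (p1 x * p2 x)" using q by simp
        then show False using t3[of x] elim x by simp
      qed
    qed
    then show ?thesis by (intro disjI1) (simp add: defs)
  next
    assume "emeasure \<mu> {s \<in> E2. 0 < P s} = 0"
    then have "AE s in \<mu>. \<not> (s \<in> E2 \<and> 0 < P s)"
      by (subst AE_iff_measurable[OF _ refl]) auto
    then have "AE s in \<mu>. s \<in> E2 \<longrightarrow> emeasure (K s) J = 0"
      by eventually_elim (auto simp: P_def K.emeasure_eq_measure measure_nonneg less_le)
    then show ?thesis by (intro disjI2) (simp add: defs)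
  qed
qed

end

section \<open>From bounded boxes to a left-monotone support\<close>

context martingale_kernel
begin

lemma emeasure_K_lessThan_eq_0:
  assumes "\<And>n :: nat. emeasure (K x) {- real n..<q} = 0"
  shows "emeasure (K x) {..<q} = 0"
proof -
  have "{..<q} = (\<Union>n. {- real n..<q})"
  proof (intro set_eqI iffI)
    fix y assume y: "y \<in> {..<q}"
    obtain n :: nat where "- y \<le> real n" using real_arch_simple by blast
    then have "y \<in> {- real n..<q}" using y by auto
    then show "y \<in> (\<Union>n. {- real n..<q})" by blast
  qed auto
  also have "emeasure (K x) \<dots> = 0"
    by (rule emeasure_UN_eq_0) (use assms in auto)
  finally show ?thesis .
qed

lemma emeasure_K_greaterThan_eq_0:
  assumes "\<And>n :: nat. emeasure (K x) {q<..real n} = 0"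
  shows "emeasure (K x) {q<..} = 0"
proof -
  have "{q<..} = (\<Union>n. {q<..real n})"
  proof (intro set_eqI iffI)
    fix y assume y: "y \<in> {q<..}"
    obtain n :: nat where "y \<le> real n" using real_arch_simple by blast
    then have "y \<in> {q<..real n}" using y by auto
    then show "y \<in> (\<Union>n. {q<..real n})" by blast
  qed auto
  also have "emeasure (K x) \<dots> = 0"
    by (rule emeasure_UN_eq_0) (use assms in auto)
  finally show ?thesis .
qed

text \<open>The first alternative of \<open>no_crossing_box\<close> passes to smaller boxes. So it
  holds for all \<open>n\<close>, or it fails from some \<open>n\<close> on and the second holds for
  all larger \<open>n\<close>; either way the bounds can be removed.\<close>

lemma no_crossing:
  assumes g: "strictly_convex_on UNIV g" and h: "\<And>x. (h has_real_derivative g x) (at x)"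
    and ic: "integrable \<pi> (\<lambda>p. h (snd p - fst p))"
    and opt: "\<And>\<pi>' K'. martingale_kernel \<mu> \<nu> \<pi>' K' \<Longrightarrow> integrable \<pi>' (\<lambda>p. h (snd p - fst p)) \<Longrightarrow>
      (\<integral>p. h (snd p - fst p) \<partial>\<pi>) \<le> (\<integral>p. h (snd p - fst p) \<partial>\<pi>')"
    and q: "q1 < q2"
  shows "(AE x in \<mu>. x \<le> t \<longrightarrow> emeasure (K x) {..<q1} = 0 \<or> emeasure (K x) {q2<..} = 0) \<or>
    (AE s in \<mu>. t < s \<longrightarrow> emeasure (K s) {q1<..<q2} = 0)"
proof -
  define A where "A n \<longleftrightarrow> (AE x in \<mu>. x \<in> {- real n..t} \<longrightarrow>
    emeasure (K x) {- real n..<q1} = 0 \<or> emeasure (K x) {q2<..real n} = 0)" for n :: nat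
  define B where "B n \<longleftrightarrow> (AE s in \<mu>. s \<in> {t<..real n} \<longrightarrow> emeasure (K s) {q1<..<q2} = 0)" for n :: nat
  have AB: "A n \<or> B n" for n
    using no_crossing_box[OF g h ic opt q, where n = "real n" and t = t] by (simp add: A_def B_def)
  show ?thesis
  proof (cases "\<forall>n. A n")
    case True
    then have "AE x in \<mu>. \<forall>n :: nat. x \<in> {- real n..t} \<longrightarrow>
      emeasure (K x) {- real n..<q1} = 0 \<or> emeasure (K x) {q2<..real n} = 0"
      by (simp add: A_def AE_all_countable)
    then have "AE x in \<mu>. x \<le> t \<longrightarrow> emeasure (K x) {..<q1} = 0 \<or> emeasure (K x) {q2<..} = 0"
    proof eventually_elim
      case (elim x)
      show ?case
      proof (rule impI, rule ccontr)
        assume x: "x \<le> t" and "\<not> (emeasure (K x) {..<q1} = 0 \<or> emeasure (K x) {q2<..} = 0)"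
        then obtain i j :: nat where ij: "emeasure (K x) {- real i..<q1} \<noteq> 0" "emeasure (K x) {q2<..real j} \<noteq> 0"
          using emeasure_K_lessThan_eq_0 emeasure_K_greaterThan_eq_0 by blast
        obtain k :: nat where k: "- x \<le> real k" using real_arch_simple by blast
        define n where "n = max k (max i j)"
        have n: "real i \<le> real n" "real j \<le> real n" "- x \<le> real n" using k by (auto simp: n_def)
        have "emeasure (K x) {- real i..<q1} \<le> emeasure (K x) {- real n..<q1}"
          "emeasure (K x) {q2<..real j} \<le> emeasure (K x) {q2<..real n}"
          using n by (auto intro!: emeasure_mono)
        then show False using ij elim[rule_format, of n] x n by auto
      qed
    qed
    then show ?thesis ..
  next
    case False
    then obtain n where n: "\<not> A n" by blast
    have "B m" if "n \<le> m" for m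
    proof -
      have "\<not> A m"
      proof
        assume "A m"
        then have "A n" unfolding A_def
        proof eventually_elim
          case (elim x)
          have "emeasure (K x) {- real n..<q1} \<le> emeasure (K x) {- real m..<q1}"
            "emeasure (K x) {q2<..real n} \<le> emeasure (K x) {q2<..real m}"
            using that by (auto intro!: emeasure_mono)
          then show ?case using elim that by auto
        qed
        then show False using n by simp
      qed
      then show ?thesis using AB by blast
    qed
    then have "AE s in \<mu>. \<forall>m :: nat. n \<le> m \<longrightarrow> s \<in> {t<..real m} \<longrightarrow> emeasure (K s) {q1<..<q2} = 0"
      by (simp add: B_def AE_all_countable)
    then have "AE s in \<mu>. t < s \<longrightarrow> emeasure (K s) {q1<..<q2} = 0"
    proof eventually_elim
      case (elim s)
      obtain k :: nat where "s \<le> real k" using real_arch_simple by blast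
      then show ?case using elim[rule_format, of "max n k"] by auto
    qed
    then show ?thesis ..
  qed
qed

text \<open>The set \<open>\<Gamma>\<close> arises by removing, for all rational parameters, one of the two null sets of the
  dichotomy.\<close>

lemma left_monotone_of_no_crossing:
  assumes dich: "\<And>t q1 q2. q1 < q2 \<Longrightarrow>
    (AE x in \<mu>. x \<le> t \<longrightarrow> emeasure (K x) {..<q1} = 0 \<or> emeasure (K x) {q2<..} = 0) \<or>
    (AE s in \<mu>. t < s \<longrightarrow> emeasure (K s) {q1<..<q2} = 0)"
  shows "left_monotone \<pi>"
proof -
  define A where "A t q1 q2 \<longleftrightarrow>
    (AE x in \<mu>. x \<le> t \<longrightarrow> emeasure (K x) {..<q1} = 0 \<or> emeasure (K x) {q2<..} = 0)" for t q1 q2 :: real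
  \<comment> \<open>For each triple one alternative is selected, by whether \<open>A\<close> holds,
    so that a single null set is removed.\<close>
  define good where "good t q1 q2 p \<longleftrightarrow> (q1 < q2 \<longrightarrow>
      (A t q1 q2 \<longrightarrow> fst p \<le> t \<longrightarrow> emeasure (K (fst p)) {..<q1} = 0 \<or> emeasure (K (fst p)) {q2<..} = 0) \<and>
      (\<not> A t q1 q2 \<longrightarrow> \<not> (t < fst p \<and> q1 < snd p \<and> snd p < q2)))" for t q1 q2 p
  \<comment> \<open>Almost no point lies in an open half-line that its fibre does not charge. This
    converts single points of \<open>\<Gamma>\<close> into positive mass of a fibre.\<close>
  define supp where "supp q p \<longleftrightarrow> (snd p < q \<longrightarrow> emeasure (K (fst p)) {..<q} \<noteq> 0) \<and>
      (q < snd p \<longrightarrow> emeasure (K (fst p)) {q<..} \<noteq> 0)" for q p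
  define \<Gamma> where "\<Gamma> = {p. (\<forall>t q1 q2 :: rat. good (of_rat t) (of_rat q1) (of_rat q2) p) \<and> (\<forall>q :: rat. supp (of_rat q) p)}"
  have [measurable]: "Measurable.pred borel (good t q1 q2)" for t q1 q2
    unfolding good_def by measurable
  have [measurable]: "Measurable.pred borel (supp q)" for q
    unfolding supp_def by measurable
  have \<Gamma>[measurable]: "\<Gamma> \<in> sets borel"
  proof -
    have "{p \<in> space borel. (\<forall>t q1 q2 :: rat. good (of_rat t) (of_rat q1) (of_rat q2) p) \<and> (\<forall>q :: rat. supp (of_rat q) p)} \<in> sets borel"
      by measurable
    then show ?thesis by (simp add: \<Gamma>_def)
  qed
  have ae_good: "AE p in \<pi>. good t q1 q2 p" for t q1 q2
  proof (subst AE_\<pi>)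
    show "AE x in \<mu>. AE y in K x. good t q1 q2 (x, y)"
    proof (cases "A t q1 q2")
      case True
      then have "AE x in \<mu>. x \<le> t \<longrightarrow> emeasure (K x) {..<q1} = 0 \<or> emeasure (K x) {q2<..} = 0"
        by (simp add: A_def)
      then show ?thesis by eventually_elim (use True in \<open>simp add: good_def\<close>)
    next
      case False
      show ?thesis
      proof (cases "q1 < q2")
        case True
        then have "AE s in \<mu>. t < s \<longrightarrow> emeasure (K s) {q1<..<q2} = 0"
          using dich[of q1 q2 t] False by (simp add: A_def)
        then show ?thesis
        proof eventually_elim
          case (elim s)
          show ?case
          proof (cases "t < s")
            case True
            then have "AE y in K s. y \<notin> {q1<..<q2}"
              using elim by (intro AE_not_in) (simp add: null_sets_def)
            then show ?thesis by eventually_elim (use False in \<open>simp add: good_def\<close>)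
          qed (use False in \<open>simp add: good_def\<close>)
        qed
      qed (simp add: good_def)
    qed
  qed measurable
  have ae_supp: "AE p in \<pi>. supp q p" for q
  proof (subst AE_\<pi>)
    have "AE y in K x. supp q (x, y)" for x
    proof -
      have "AE y in K x. y < q \<longrightarrow> emeasure (K x) {..<q} \<noteq> 0"
      proof (cases "emeasure (K x) {..<q} = 0")
        case True
        then have "AE y in K x. y \<notin> {..<q}" by (intro AE_not_in) (simp add: null_sets_def)
        then show ?thesis by eventually_elim simp
      qed simp
      moreover have "AE y in K x. q < y \<longrightarrow> emeasure (K x) {q<..} \<noteq> 0"
      proof (cases "emeasure (K x) {q<..} = 0")
        case True
        then have "AE y in K x. y \<notin> {q<..}" by (intro AE_not_in) (simp add: null_sets_def)
        then show ?thesis by eventually_elim simp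
      qed simp
      ultimately show ?thesis by eventually_elim (simp add: supp_def)
    qed
    then show "AE x in \<mu>. AE y in K x. supp q (x, y)" by simp
  qed measurable
  have "AE p in \<pi>. p \<in> \<Gamma>"
    using ae_good ae_supp by (simp add: \<Gamma>_def AE_all_countable)
  then have full: "emeasure \<pi> \<Gamma> = 1"
    using \<pi>.AE_in_set_eq_1[of \<Gamma>] by (simp add: \<pi>.emeasure_eq_measure)
  have "\<not> (x < x' \<and> y1 < y' \<and> y' < y2)" if "(x, y1) \<in> \<Gamma>" "(x, y2) \<in> \<Gamma>" "(x', y') \<in> \<Gamma>" for x y1 y2 x' y'
  proof
    assume *: "x < x' \<and> y1 < y' \<and> y' < y2"
    \<comment> \<open>Rationals separate the strict inequalities. By \<open>supp\<close> the fibre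
      over \<open>x\<close> charges both outer half-lines, which excludes the first alternative, and
      \<open>(x', y')\<close> violates the second.\<close>
    obtain t where t: "x < of_rat t" "of_rat t < x'" using * of_rat_dense by blast
    obtain q1 where q1: "y1 < of_rat q1" "of_rat q1 < y'" using * of_rat_dense by blast
    obtain q2 where q2: "y' < of_rat q2" "of_rat q2 < y2" using * of_rat_dense by blast
    have "supp (of_rat q1) (x, y1)" "supp (of_rat q2) (x, y2)"
      "good (of_rat t) (of_rat q1) (of_rat q2) (x, y1)" "good (of_rat t) (of_rat q1) (of_rat q2) (x', y')"
      using that by (auto simp: \<Gamma>_def)
    then show False using t q1 q2 by (auto simp: supp_def good_def)
  qed
  then show ?thesis using \<Gamma> full unfolding left_monotone_def by blast
qed

end

theorem theorem1p9:
  fixes \<mu> \<nu> :: "real measure" and h :: "real \<Rightarrow> real" and c :: "real \<Rightarrow> real \<Rightarrow> real"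
    and \<pi> :: "(real \<times> real) measure"
  assumes "prob_space \<mu>" and "sets \<mu> = sets borel"
    and "prob_space \<nu>" and "sets \<nu> = sets borel"
    and "convex_order \<mu> \<nu>"
    and "\<And>x. h differentiable (at x)"
    and "strictly_convex_on UNIV (deriv h)"
    and "\<And>x y. c x y = h (y - x)"
    and "sufficient_integrability c \<mu> \<nu>"
    and "min_cost c \<mu> \<nu> < \<infinity>"
    and "\<pi> \<in> martingale_plans \<mu> \<nu>"
  shows "(left_monotone \<pi> \<longleftrightarrow> optimal_plan c \<mu> \<nu> \<pi>) \<and>
         (optimal_plan c \<mu> \<nu> \<pi> \<longleftrightarrow> left_curtain \<mu> \<nu> \<pi>)"
proof -
  note kernelE = martingale_plansE[OF assms(1,2,5)]
  obtain K where K: "martingale_kernel \<mu> \<nu> \<pi> K" using kernelE[OF assms(11)] by blast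
  interpret martingale_kernel \<mu> \<nu> \<pi> K by (rule K)
  have h: "(h has_real_derivative deriv h x) (at x)" for x
    using assms(6) by (simp add: DERIV_deriv_iff_real_differentiable)
  obtain w where w: "is_subgradient w (deriv h)"
    using convex_imp_subgradient[OF strictly_convex_imp_convex[OF assms(7)]] by blast
  have "continuous_on UNIV h" using h by (meson DERIV_isCont continuous_at_imp_continuous_on)
  then have [measurable]: "h \<in> borel_measurable borel" by (rule borel_measurable_continuous_onI)
  have c: "c (fst p) (snd p) = h (snd p - fst p)" for p by (rule assms(8))

  have "left_curtain \<mu> \<nu> \<pi>" if lm: "left_monotone \<pi>"
    unfolding left_curtain_def
  proof (intro conjI ballI allI assms(11))
    fix \<pi>' t assume "\<pi>' \<in> martingale_plans \<mu> \<nu>"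
    then obtain K' where K': "martingale_kernel \<mu> \<nu> \<pi>' K'" using kernelE by blast
    show "convex_order (second_marginal_upto \<pi> t) (second_marginal_upto \<pi>' t)"
      using left_monotone_potential_le[OF lm K'] by (simp add: convex_order_second_marginal_upto[OF K'])
  qed
  moreover have "optimal_plan c \<mu> \<nu> \<pi>" if lc: "left_curtain \<mu> \<nu> \<pi>"
    unfolding optimal_plan_def
  proof (intro conjI ballI assms(11))
    fix \<pi>' assume \<pi>': "\<pi>' \<in> martingale_plans \<mu> \<nu>"
    then obtain K' where K': "martingale_kernel \<mu> \<nu> \<pi>' K'" using kernelE by blast
    have "potential \<pi> t k \<le> potential \<pi>' t k" for t k
      using lc \<pi>' convex_order_second_marginal_upto[OF K'] by (auto simp: left_curtain_def)
    then show "transport_cost c \<pi> \<le> transport_cost c \<pi>'"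
      by (rule curtain_cost_le[OF K' _ w h assms(8,9)])
  qed
  moreover have "left_monotone \<pi>" if opt: "optimal_plan c \<mu> \<nu> \<pi>"
  proof (rule left_monotone_of_no_crossing, rule no_crossing[OF assms(7) h])
    \<comment> \<open>An optimal plan inherits finite cost from some competitor, so costs can be
      compared as real integrals.\<close>
    obtain \<pi>0 where "\<pi>0 \<in> martingale_plans \<mu> \<nu>" "transport_cost c \<pi>0 < \<infinity>"
      using assms(10) unfolding min_cost_def INF_less_iff by blast
    then have fin: "transport_cost c \<pi> < \<infinity>"
      using opt by (auto simp: optimal_plan_def intro: le_less_trans)
    have ic: "integrable \<pi> (\<lambda>p. c (fst p) (snd p))"
      by (rule integrable_of_finite_cost[OF assms(9) _ fin]) (simp add: c)
    then show "integrable \<pi> (\<lambda>p. h (snd p - fst p))" by (simp add: c)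
    fix \<pi>' K' assume "martingale_kernel \<mu> \<nu> \<pi>' K'" and i': "integrable \<pi>' (\<lambda>p. h (snd p - fst p))"
    then interpret P': martingale_kernel \<mu> \<nu> \<pi>' K' by simp
    have "transport_cost c \<pi> \<le> transport_cost c \<pi>'"
      using opt P'.plan_mem by (simp add: optimal_plan_def)
    then show "(\<integral>p. h (snd p - fst p) \<partial>\<pi>) \<le> (\<integral>p. h (snd p - fst p) \<partial>\<pi>')"
      using transport_cost_eq_integral[OF ic] P'.transport_cost_eq_integral[of c] i' by (simp add: c)
  qed
  ultimately show ?thesis by blast
qed

end
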